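(* Let $L(f,s)$ be an $L$-function of degree $d\ge1$ in the sense of the context, with analytic conductor $C$. Assume that $\Lambda(f,s)$ has no pole or zero at $s=0,1$, and assume the Generalized Riemann Hypothesis for $L(f,s)$, i.e. all zeros of $\Lambda(f,s)$ lie on $\Re s=\tfrac12$. Let $\lambda_0=0.4912\ldots$ denote the unique positive real number satisfying $e^{-\lambda_0}=\lambda_0+\lambda_0^2/2$. Then for all real $x$ and $\lambda$ with $\log x\ge2$ and $\frac{\log x}{2}\ge\lambda\ge\lambda_0$, $$\log|L(f,\tfrac12)|\le\Re\sum_{2\le n\le x}\frac{a(n)}{n^{\frac12+\frac{\lambda}{\log x}}\log n}\,\frac{\log\frac xn}{\log x}+\left(\frac{1+\lambda}{2}\right)\frac{\log C}{\log x}+\frac{(\lambda^2+\lambda)d}{\log^2x}+\frac{4de^{-\lambda}}{x^{1/2}\log^2x}.$$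
   Context: An $L$-function $L(f,s)$ of degree $d\ge1$ is a Dirichlet series with Euler product $$L(f,s)=\sum_{n\ge1}\lambda_f(n)n^{-s}=\prod_p\prod_{i=1}^d(1-\alpha_i(p)p^{-s})^{-1},$$ with $\lambda_f(1)=1$ and $|\alpha_i(p)|<p$, the series and product converging absolutely for $\Re s>1$, together with the following data. There are complex numbers $k_1,\dots,k_d$ with $\Re k_j\ge0$ and an integer $q(f)\ge1$ (the conductor), with $\alpha_i(p)\ne0$ for $p\nmid q(f)$, such that, putting $$\gamma(f,s)=\pi^{-ds/2}\prod_{j=1}^d\Gamma\Big(\frac{s+k_j}{2}\Big),\qquad \Lambda(f,s)=q(f)^{s/2}\gamma(f,s)L(f,s),$$ the function $\Lambda(f,s)$ continues meromorphically to $\mathbb C$, of order 1 and with at most poles at $s=0,1$ (so it is entire of order 1 when there is no pole at $s=0,1$), and satisfies $\Lambda(f,s)=\epsilon(f)\overline{\Lambda(f,1-\bar s)}$ with $|\epsilon(f)|=1$. The coefficients $a(n)$ are defined by $-\frac{L'}{L}(f,s)=\sum_n a(n)n^{-s}$; thus $a(p^l)=(\alpha_1(p)^l+\dots+\alpha_d(p)^l)\log p$ for primes $p$ and $l\ge1$, and $a(n)=0$ if $n$ is not a prime power (in particular $a(1)=0$). The analytic conductor is $C=\dfrac{q(f)}{\pi^d}\prod_{j=1}^d\left|\dfrac14+\dfrac{k_j}{2}\right|$. If $L(f,\frac12)=0$, the convention $\log0=-\infty$ is used. *)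

theory Defs
  imports "HOL-Complex_Analysis.Complex_Analysis" "HOL-Library.Landau_Symbols"
begin

text \<open>
  The data of an L-function. \<open>lroot f i p\<close> is \<open>\<alpha>\<^sub>i(p)\<close>, \<open>lshift f j\<close> is \<open>k\<^sub>j\<close>
  (with \<open>i\<close>, \<open>j\<close> in \<open>{1..ldeg f}\<close>), \<open>lcond f\<close> is the conductor \<open>q(f)\<close> and \<open>lsign f\<close> is
  \<open>\<epsilon>(f)\<close>. The field \<open>lfun f\<close> is \<open>L(f, \<cdot>)\<close> on the whole plane, i.e. the meromorphic
  continuation of the Dirichlet series with coefficients \<open>lcoeff f\<close>.
\<close>
record L_data =
  ldeg :: nat
  lcoeff :: "nat \<Rightarrow> complex"
  lroot :: "nat \<Rightarrow> nat \<Rightarrow> complex"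
  lshift :: "nat \<Rightarrow> complex"
  lcond :: nat
  lsign :: complex
  lfun :: "complex \<Rightarrow> complex"

definition euler_factor :: "L_data \<Rightarrow> nat \<Rightarrow> complex \<Rightarrow> complex" where
  "euler_factor f p s = (\<Prod>i=1..ldeg f. inverse (1 - lroot f i p / of_nat p powr s))"

definition gamma_factor :: "L_data \<Rightarrow> complex \<Rightarrow> complex" where
  "gamma_factor f s =
     of_real pi powr (- (of_nat (ldeg f) * s / 2)) * (\<Prod>j=1..ldeg f. Gamma ((s + lshift f j) / 2))"

text \<open>
  \<open>Gamma\<close> takes the value 0 at its poles, so the pointwise product below is wrong where
  a pole of a Gamma factor meets a zero of \<open>L(f, \<cdot>)\<close>; \<open>remove_sings\<close> puts in the
  value of the continuation there.
\<close>
definition completed_L :: "L_data \<Rightarrow> complex \<Rightarrow> complex" where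
  "completed_L f = remove_sings (\<lambda>s. of_nat (lcond f) powr (s / 2) * gamma_factor f s * lfun f s)"

text \<open>
  The order of growth. Only large arguments matter, so the definition also applies to a
  meromorphic function with finitely many poles; it then gives the order of the entire function
  obtained by multiplying with a polynomial that cancels the poles.
\<close>
definition growth_order :: "(complex \<Rightarrow> complex) \<Rightarrow> ereal" where
  "growth_order F =
     Inf {ereal \<rho> | \<rho>. 0 \<le> \<rho> \<and> (\<lambda>z. norm (F z)) \<in> O[at_infinity](\<lambda>z. exp (norm z powr \<rho>))}"

text \<open>
  \<open>has_sum\<close> over complex terms is absolute (unordered) convergence. In the Euler product,
  absolute convergence refers to the product over \<open>p\<close> of the local factors of degree \<open>d\<close>.
\<close>
definition L_function :: "L_data \<Rightarrow> bool" where
  "L_function f \<longleftrightarrow>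
     1 \<le> ldeg f \<and> 1 \<le> lcond f \<and> lcoeff f 1 = 1 \<and> norm (lsign f) = 1 \<and>
     (\<forall>p. \<forall>i\<in>{1..ldeg f}. prime p \<longrightarrow> norm (lroot f i p) < real p) \<and>
     (\<forall>p. \<forall>i\<in>{1..ldeg f}. prime p \<longrightarrow> \<not> p dvd lcond f \<longrightarrow> lroot f i p \<noteq> 0) \<and>
     (\<forall>j\<in>{1..ldeg f}. 0 \<le> Re (lshift f j)) \<and>
     (\<forall>s. 1 < Re s \<longrightarrow>
        ((\<lambda>n. lcoeff f n / of_nat n powr s) has_sum lfun f s) {1..} \<and>
        abs_convergent_prod (\<lambda>p. if prime p then euler_factor f p s else 1) \<and>
        (\<lambda>p. if prime p then euler_factor f p s else 1) has_prod lfun f s) \<and>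
     lfun f nicely_meromorphic_on UNIV \<and>
     completed_L f holomorphic_on - {0, 1} \<and>
     growth_order (completed_L f) = 1 \<and>
     (\<forall>s. completed_L f s = lsign f * cnj (completed_L f (1 - cnj s)))"

definition no_pole_or_zero :: "(complex \<Rightarrow> complex) \<Rightarrow> complex \<Rightarrow> bool" where
  "no_pole_or_zero F z \<longleftrightarrow> \<not> is_pole F z \<and> F z \<noteq> 0"

text \<open>
  \<open>completed_L f\<close> has the value 0 at its poles, which are not zeros.
\<close>
definition GRH :: "L_data \<Rightarrow> bool" where
  "GRH f \<longleftrightarrow> (\<forall>s. \<not> is_pole (completed_L f) s \<longrightarrow> completed_L f s = 0 \<longrightarrow> Re s = 1 / 2)"

text \<open>
  \<open>a\<close> is the coefficient sequence of the Dirichlet series of \<open>- L'/L\<close>. The values \<open>a n\<close> with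
  \<open>n \<ge> 1\<close> are determined by the identity on any right half-plane.
\<close>
definition neg_log_deriv_coeffs :: "L_data \<Rightarrow> (nat \<Rightarrow> complex) \<Rightarrow> bool" where
  "neg_log_deriv_coeffs f a \<longleftrightarrow>
     (\<exists>c. \<forall>s. c < Re s \<longrightarrow>
        ((\<lambda>n. a n / of_nat n powr s) has_sum - (deriv (lfun f) s / lfun f s)) {1..})"

definition analytic_conductor :: "L_data \<Rightarrow> real" where
  "analytic_conductor f =
     real (lcond f) / pi ^ ldeg f * (\<Prod>j=1..ldeg f. norm (1 / 4 + lshift f j / 2))"

text \<open>\<open>log |z|\<close> with \<open>log 0 = -\<infinity>\<close>, where the library has \<open>ln 0 = 0\<close>.\<close>
definition log_norm :: "complex \<Rightarrow> ereal" where
  "log_norm z = (if z = 0 then -\<infinity> else ereal (ln (norm z)))"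

definition lambda0 :: real where
  "lambda0 = (THE t. 0 < t \<and> exp (- t) = t + t\<^sup>2 / 2)"

lemma lambda0_ex1: "\<exists>!t::real. 0 < t \<and> exp (- t) = t + t\<^sup>2 / 2"
proof -
  define g where "g = (\<lambda>t::real. t + t\<^sup>2 / 2 - exp (- t))"
  have mono: "g s < g t" if "0 \<le> s" "s < t" for s t
  proof -
    have "s\<^sup>2 \<le> t\<^sup>2" using that by (intro power_mono) auto
    moreover have "exp (- t) < exp (- s)" using that by simp
    ultimately show ?thesis using that unfolding g_def by linarith
  qed
  have "exp (- 1 :: real) \<le> 1" by simp
  moreover have "g 1 = 3 / 2 - exp (- 1)" by (simp add: g_def)
  ultimately have "0 \<le> g 1" by linarith
  then have "\<exists>t\<ge>0. t \<le> 1 \<and> g t = 0"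
    by (intro IVT') (auto simp: g_def intro!: continuous_intros)
  then obtain t where t: "0 \<le> t" "g t = 0" by blast
  have "t \<noteq> 0" using t by (auto simp: g_def)
  show ?thesis
  proof (rule ex1I[of _ t])
    show "0 < t \<and> exp (- t) = t + t\<^sup>2 / 2"
      using t \<open>t \<noteq> 0\<close> by (auto simp: g_def)
  next
    fix u :: real assume u: "0 < u \<and> exp (- u) = u + u\<^sup>2 / 2"
    then have "g u = 0" by (simp add: g_def)
    then show "u = t" using mono[of t u] mono[of u t] t u by (cases u t rule: linorder_cases) auto
  qed
qed

end

theory Submission
  imports Defs "HOL-Real_Asymp.Real_Asymp"
begin

text \<open>
  Put \<open>T = log x\<close>, \<open>y = \<lambda>/T\<close> and \<open>s\<^sub>0 = 1/2 + y\<close>. By Hadamard's theory,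
  \<open>F(s) = Re \<Lambda>'/\<Lambda>(s)\<close> is the sum of \<open>Re 1/(s - \<rho>)\<close> over the zeros, and under GRH every term is
  nonnegative on \<open>s > 1/2\<close>. Since \<open>F(1/2 + t)/t\<close> decreases,
  \<open>log |\<Lambda>(s\<^sub>0)| - log |\<Lambda>(1/2)| \<ge> y F(s\<^sub>0)/2\<close>. On the other hand the explicit formula for
  \<open>\<Sum> a(n) n\<^sup>-\<^sup>s log (x/n)\<close>, integrated over \<open>[s\<^sub>0, \<infinity>)\<close>, bounds
  \<open>T log |L(s\<^sub>0)| + Re L'/L(s\<^sub>0)\<close> by the Dirichlet polynomial plus
  \<open>e\<^sup>-\<^sup>\<lambda> F(s\<^sub>0)/(y T)\<close> and a contribution of the trivial zeros. In the combination \<open>F(s\<^sub>0)\<close> has the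
  coefficient \<open>(e\<^sup>-\<^sup>\<lambda>/\<lambda> - 1 - \<lambda>/2)/T\<close>, which is at most \<open>0\<close> exactly for \<open>\<lambda> \<ge> \<lambda>\<^sub>0\<close>. The
  Gamma factors are controlled by \<open>Re \<psi>(w) \<le> log |w|\<close> on \<open>Re w \<ge> 1/4\<close>.

  The partial fractions of \<open>\<Lambda>'/\<Lambda>\<close> come from the Borel--Caratheodory theorem after moving the
  zeros out of a large disc by Blaschke factors. The explicit formula is not obtained by contour
  integration: for fixed real \<open>s\<close> in the half-plane of absolute convergence both sides are
  functions of \<open>T\<close> with the same Laplace transform at the integers, hence equal, and the identity
  extends to \<open>Re s > 1/2\<close> by analytic continuation.
\<close>

section \<open>The digamma function on \<open>Re w \<ge> 1/4\<close>\<close>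

text \<open>If L(1/2) = 0 the claim is trivial, so 1/2 can serve as the centre of all expansions.
  Subtracting the value of the logarithmic derivative at the centre makes the errors O(log M(R) /
  R^2), which growth with an exponent below 2 sends to 0 without a canonical product. The constant
  left over by Hadamard's formula is removed by the functional equation: |Lambda(1/2 + t)| is even
  in real t, so Re Lambda'/Lambda vanishes at 1/2 and F is exactly a sum of terms of one sign.

  The half-plane Re w >= 1/4 is dictated by C: at s = 1/2 the Gamma arguments are 1/4 + k_j/2, whose
  moduli are the factors of C. The bound on psi there must carry no additive constant, because a
  loss of epsilon would cost a term of order d epsilon / log x, while only d / log^2 x is available.
  Near the edge the asymptotic expansion of psi is too weak for this, and one step of psi(w + 1) =
  psi(w) + 1/w is taken first.

  The trivial zeros cost slightly more than the last term of the bound; half of lambda^2 d / log^2 x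
  is left to pay for it.\<close>

lemma artanh_bound:
  fixes y :: real
  assumes "0 \<le> y" "y < 1"
  shows "ln ((1 + y) / (1 - y)) \<le> 2 * (y + y ^ 3 / (3 * (1 - y\<^sup>2)))"
proof -
  \<comment> \<open>The right-hand side is the series 2 (y + y^3/3 + y^5/5 + ...) with every
    denominator from 3 on replaced by 3; \<open>h'\<close> is the derivative of the
    difference.\<close>
  define h where "h = (\<lambda>t::real. 2 * (t + t ^ 3 / (3 * (1 - t\<^sup>2))) - (ln (1 + t) - ln (1 - t)))"
  define h' where "h' = (\<lambda>t::real. 4 * t ^ 4 / (3 * (1 - t\<^sup>2)\<^sup>2))"
  have "h 0 \<le> h y"
  proof (rule DERIV_nonneg_imp_nondecreasing[OF assms(1)])
    fix t assume t: "0 \<le> t" "t \<le> y"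
    have t1: "t < 1" using t assms by simp
    have t2: "1 - t\<^sup>2 \<noteq> 0" "1 + t \<noteq> 0" "1 - t \<noteq> 0" using t t1 by (auto simp: power2_eq_1_iff)
    have "(h has_real_derivative
        2 * (1 + (3 * t\<^sup>2 * (3 * (1 - t\<^sup>2)) - t ^ 3 * (3 * (- (2 * t)))) / (3 * (1 - t\<^sup>2))\<^sup>2)
        - (1 / (1 + t) + 1 / (1 - t))) (at t)"
      unfolding h_def
      using t t1 t2 by (auto intro!: derivative_eq_intros simp: power2_eq_square)
    moreover have "1 / (1 + t) + 1 / (1 - t) = 2 / (1 - t\<^sup>2)"
      using t2 by (simp add: divide_simps power2_eq_square) (simp add: algebra_simps)
    moreover have "2 * (1 + (3 * t\<^sup>2 * (3 * (1 - t\<^sup>2)) - t ^ 3 * (3 * (- (2 * t)))) / (3 * (1 - t\<^sup>2))\<^sup>2)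
        - 2 / (1 - t\<^sup>2) = h' t"
      unfolding h'_def using t2(1)
      by (simp add: divide_simps) (simp add: algebra_simps eval_nat_numeral)
    ultimately have "(h has_real_derivative h' t) (at t)" by simp
    moreover have "h' t \<ge> 0" unfolding h'_def by (intro divide_nonneg_nonneg mult_nonneg_nonneg) auto
    ultimately show "\<exists>d. (h has_real_derivative d) (at t) \<and> 0 \<le> d" by blast
  qed
  moreover have "ln ((1 + y) / (1 - y)) = ln (1 + y) - ln (1 - y)"
    using assms by (simp add: ln_div)
  ultimately show ?thesis by (simp add: h_def)
qed

text \<open>Expands to Re (1/(2w) + 1/(12 w^2)) - 1/(24 |w|^4): the first two terms of the
  asymptotic expansion of log w - psi(w), with a correction for which the change under w -> w + 1
  takes the compact form \<open>eq\<close> in the next proof.\<close>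

definition digamma_gap :: "complex \<Rightarrow> real" where
  "digamma_gap w = (Re w / 2 - 1 / 4) / (norm w)\<^sup>2 + 1 / (6 * (norm w)\<^sup>2)
     + ((Re w)\<^sup>2 - 1 / 4) / (6 * ((norm w)\<^sup>2)\<^sup>2)"

text \<open>In view of psi(w + 1) = psi(w) + 1/w this says that Re psi - ln |.| +
  \<open>digamma_gap\<close> does not decrease under w -> w + 1. With m = Re w + 1/2 the squares
  |w|^2 and |w + 1|^2 are M - m and M + m, so the left-hand side is artanh (m/M) and the rest is
  rational in m and M.\<close>

lemma ln_norm_plus_1_bound:
  fixes w :: complex
  assumes "0 < Re w"
  shows "ln (norm (w + 1)) - ln (norm w) \<le> Re (1 / w) - digamma_gap w + digamma_gap (w + 1)"
proof -
  define u where "u = Re w"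
  define a where "a = (norm w)\<^sup>2"
  define m where "m = u + 1 / 2"
  define M where "M = a + m"
  define y where "y = m / M"
  have u: "0 < u" using assms by (simp add: u_def)
  have au: "a \<ge> u\<^sup>2" "a > 0"
    using u by (auto simp: a_def u_def cmod_def add_pos_nonneg)
  have b: "(norm (w + 1))\<^sup>2 = M + m"
    by (simp add: M_def m_def a_def u_def cmod_power2) (simp add: power2_eq_square algebra_simps)
  have am: "a = M - m" by (simp add: M_def)
  have m: "m > 0" "M > m" "M > 0" using u au by (auto simp: m_def M_def)
  \<comment> \<open>Besides \<open>artanh_bound\<close> this is the only estimate in the proof: it
    gives (M - 1) M <= M^2 - m^2.\<close>
  have mM: "m\<^sup>2 \<le> M" using au(1) by (simp add: M_def m_def power2_eq_square algebra_simps)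
  have "norm w > 0" "norm (w + 1) > 0" using assms by (auto simp: complex_eq_iff)
  then have "ln ((norm (w + 1))\<^sup>2) = 2 * ln (norm (w + 1))" "ln (a) = 2 * ln (norm w)"
    by (simp_all add: ln_realpow a_def)
  then have "2 * (ln (norm (w + 1)) - ln (norm w)) = ln (M + m) - ln a"
    using b by simp
  also have "\<dots> = ln ((1 + y) / (1 - y))"
  proof -
    have "(1 + y) / (1 - y) = (M + m) / (M - m)" using m by (simp add: y_def field_simps)
    then show ?thesis using m by (simp add: am ln_div)
  qed
  also have "\<dots> \<le> 2 * (y + y ^ 3 / (3 * (1 - y\<^sup>2)))"
    using m by (intro artanh_bound) (auto simp: y_def)
  also have "y ^ 3 / (3 * (1 - y\<^sup>2)) = m ^ 3 / (3 * M * (M\<^sup>2 - m\<^sup>2))"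
  proof -
    have "M\<^sup>2 - m\<^sup>2 > 0" using m by (simp add: power_strict_mono)
    moreover have "1 - y\<^sup>2 = (M\<^sup>2 - m\<^sup>2) / M\<^sup>2" using m by (simp add: y_def field_simps)
    ultimately show ?thesis using m by (simp add: y_def field_simps eval_nat_numeral)
  qed
  also have "2 * (y + m ^ 3 / (3 * M * (M\<^sup>2 - m\<^sup>2))) \<le>
      2 * (Re (1 / w) - digamma_gap w + digamma_gap (w + 1))"
  proof -
    define D where "D = M\<^sup>2 - m\<^sup>2"
    have D: "D > 0" using m by (simp add: D_def power_strict_mono)
    have Dab: "D = (M - m) * (M + m)" by (simp add: D_def power2_eq_square algebra_simps)
    have "Re (1 / w) = u / a" by (simp add: Re_divide a_def u_def cmod_power2)
    then have "Re (1 / w) = (m - 1 / 2) / (M - m)" by (simp add: am m_def)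
    moreover have "digamma_gap w = (m / 2 - 1 / 2) / (M - m) + 1 / (6 * (M - m))
        + ((m - 1/2)\<^sup>2 - 1 / 4) / (6 * (M - m)\<^sup>2)"
    proof -
      have "u / 2 - 1 / 4 = m / 2 - 1 / 2" "u = m - 1 / 2" by (simp_all add: m_def)
      then show ?thesis unfolding digamma_gap_def u_def[symmetric] a_def[symmetric] am by metis
    qed
    moreover have "digamma_gap (w + 1) = (m / 2) / (M + m) + 1 / (6 * (M + m))
        + ((m + 1/2)\<^sup>2 - 1 / 4) / (6 * (M + m)\<^sup>2)"
    proof -
      have "Re (w + 1) / 2 - 1 / 4 = m / 2" "Re (w + 1) = m + 1 / 2" by (simp_all add: m_def u_def)
      then show ?thesis unfolding digamma_gap_def b by metis
    qed
    ultimately have eq: "Re (1 / w) - digamma_gap w + digamma_gap (w + 1)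
        = M * m / D - 2 * m ^ 3 * (M - 1) / (3 * D\<^sup>2)"
    proof -
      assume 1: "Re (1 / w) = (m - 1 / 2) / (M - m)"
      assume 2: "digamma_gap w = (m / 2 - 1 / 2) / (M - m) + 1 / (6 * (M - m))
        + ((m - 1/2)\<^sup>2 - 1 / 4) / (6 * (M - m)\<^sup>2)"
      assume 3: "digamma_gap (w + 1) = (m / 2) / (M + m) + 1 / (6 * (M + m))
        + ((m + 1/2)\<^sup>2 - 1 / 4) / (6 * (M + m)\<^sup>2)"
      have nz: "M - m \<noteq> 0" "M + m \<noteq> 0" using m by auto
      have i: "(m - 1 / 2) / (M - m) - (m / 2 - 1 / 2) / (M - m) + (m / 2) / (M + m) = M * m / D"
        unfolding Dab using nz by (simp add: divide_simps) (simp add: algebra_simps)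
      have ii: "((m + 1/2)\<^sup>2 - 1 / 4) / (6 * (M + m)\<^sup>2) + 1 / (6 * (M + m))
          - 1 / (6 * (M - m)) - ((m - 1/2)\<^sup>2 - 1 / 4) / (6 * (M - m)\<^sup>2)
          = - (2 * m ^ 3 * (M - 1) / (3 * D\<^sup>2))"
        unfolding Dab using nz
        by (simp add: divide_simps power_mult_distrib) (simp add: algebra_simps eval_nat_numeral)
      show ?thesis unfolding 1 2 3 using i ii by linarith
    qed
    have le: "p \<le> q \<Longrightarrow> k = t + r \<Longrightarrow> r - q = s \<Longrightarrow> 2 * (t + s) \<le> 2 * (k - p)" for p q k t r s :: real
      by simp
    have "2 * m ^ 3 * (M - 1) / (3 * D\<^sup>2) \<le> 2 * m ^ 3 / (3 * M * D)"
    proof -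
      have "(M - 1) * M \<le> D" using mM by (simp add: D_def power2_eq_square algebra_simps)
      then have "(M - 1) / D \<le> 1 / M" using D m by (simp add: field_simps)
      then have "2 * m ^ 3 / (3 * D) * ((M - 1) / D) \<le> 2 * m ^ 3 / (3 * D) * (1 / M)"
        using D m by (intro mult_left_mono) auto
      then show ?thesis by (simp add: power2_eq_square mult_ac)
    qed
    moreover have "M * m / D = y + m ^ 3 / (M * D)"
    proof -
      have "M * m / D - m / M = (M\<^sup>2 * m - m * D) / (M * D)"
        using D m by (simp add: field_simps power2_eq_square)
      also have "M\<^sup>2 * m - m * D = m ^ 3" by (simp add: D_def algebra_simps eval_nat_numeral)
      finally show ?thesis by (simp add: y_def)
    qed
    moreover have "m ^ 3 / (M * D) - 2 * m ^ 3 / (3 * M * D) = m ^ 3 / (3 * M * D)"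
      using D m by (simp add: field_simps)
    ultimately show ?thesis unfolding eq D_def[symmetric] by (rule le)
  qed
  finally show ?thesis by simp
qed

lemma tendsto_norm_add_of_nat: "filterlim (\<lambda>n. norm (w + of_nat n :: complex)) at_top sequentially"
proof (rule filterlim_at_top_mono)
  show "filterlim (\<lambda>n. real n + - norm w) at_top sequentially"
    by (rule filterlim_tendsto_add_at_top[OF tendsto_const filterlim_real_sequentially, of "- norm w", simplified add.commute])
  show "\<forall>\<^sub>F n in sequentially. real n + - norm w \<le> norm (w + of_nat n)"
    using norm_triangle_ineq2[of "of_nat _" "- w"] by (intro always_eventually) (auto simp: add.commute)
qed

text \<open>The recurrence turns the limit ln m - sum of 1/(w + n) for psi(w) into psi(w + m) - ln m
  -> 0, and |w + m| / m tends to 1.\<close>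

lemma Digamma_ln_norm_tendsto:
  fixes w :: complex
  assumes "0 < Re w"
  shows "(\<lambda>n. Re (Digamma (w + of_nat n)) - ln (norm (w + of_nat n))) \<longlonglongrightarrow> 0"
proof -
  have w: "w + of_nat n \<noteq> 0" for n using assms by (auto simp: complex_eq_iff)
  then have "w \<noteq> 0" by (metis add.right_neutral of_nat_0)
  have D: "Digamma (w + of_nat m) = Digamma w + (\<Sum>n<m. inverse (w + of_nat n))" for m
  proof (induction m)
    case (Suc m)
    have "Digamma (w + of_nat (Suc m)) = Digamma ((w + of_nat m) + 1)" by (simp add: add_ac)
    also have "\<dots> = Digamma (w + of_nat m) + 1 / (w + of_nat m)" by (rule Digamma_plus1[OF w])
    finally show ?case by (simp add: Suc inverse_eq_divide)
  qed simp
  have "(\<lambda>m. Re (of_real (ln (real m)) - (\<Sum>n<m. inverse (w + of_nat n)))) \<longlonglongrightarrow> Re (Digamma w)"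
    by (intro tendsto_Re Digamma_LIMSEQ \<open>w \<noteq> 0\<close>)
  from tendsto_diff[OF tendsto_const this, of "Re (Digamma w)"]
  have 1: "(\<lambda>m. Re (Digamma (w + of_nat m)) - ln (real m)) \<longlonglongrightarrow> 0"
    by (simp add: D algebra_simps)
  have "(\<lambda>m. w / of_nat m) \<longlonglongrightarrow> 0" by (rule lim_const_over_n)
  then have "(\<lambda>m. ln (norm (w / of_nat m + 1))) \<longlonglongrightarrow> ln (norm (0 + 1 :: complex))"
    by (intro tendsto_intros) auto
  then have "(\<lambda>m. ln (norm (w / of_nat m + 1))) \<longlonglongrightarrow> 0" by simp
  then have 2: "(\<lambda>m. ln (norm (w + of_nat m)) - ln (real m)) \<longlonglongrightarrow> 0"
  proof (rule Lim_transform_eventually)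
    show "\<forall>\<^sub>F m in sequentially. ln (norm (w / of_nat m + 1)) = ln (norm (w + of_nat m)) - ln (real m)"
      using eventually_gt_at_top[of 0]
    proof eventually_elim
      case (elim m)
      have "w / of_nat m + 1 = (w + of_nat m) / of_nat m" using elim by (simp add: field_simps)
      then have "norm (w / of_nat m + 1) = norm (w + of_nat m) / real m" by (simp add: norm_divide)
      then show ?case using w elim by (simp add: ln_div)
    qed
  qed
  show ?thesis using tendsto_diff[OF 1 2] by simp
qed

lemma digamma_gap_tendsto:
  assumes "0 < Re w"
  shows "(\<lambda>n. digamma_gap (w + of_nat n)) \<longlonglongrightarrow> 0"
proof -
  define N where "N = (\<lambda>n. norm (w + of_nat n))"
  have N: "filterlim N at_top sequentially" unfolding N_def by (rule tendsto_norm_add_of_nat)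
  then have I: "(\<lambda>n. inverse (N n)) \<longlonglongrightarrow> 0"
    by (rule tendsto_inverse_0_at_top)
  have "(\<lambda>n. inverse (N n) / 2 + 5 * (inverse (N n))\<^sup>2 + (inverse (N n))\<^sup>2 / 6
     + ((inverse (N n))\<^sup>2)\<^sup>2) \<longlonglongrightarrow> 0 / 2 + 5 * 0\<^sup>2 + 0\<^sup>2 / 6 + (0\<^sup>2)\<^sup>2"
    by (intro tendsto_intros I) simp_all
  then have lim: "(\<lambda>n. inverse (N n) / 2 + 5 * (inverse (N n))\<^sup>2 + (inverse (N n))\<^sup>2 / 6
     + ((inverse (N n))\<^sup>2)\<^sup>2) \<longlonglongrightarrow> 0" by simp
  show ?thesis
  proof (rule Lim_null_comparison[OF _ lim], rule always_eventually, rule allI)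
    fix n
    define z where "z = w + of_nat n"
    define b where "b = norm z"
    define u where "u = Re z"
    have b: "b > 0" using assms by (auto simp: b_def z_def complex_eq_iff)
    have u: "\<bar>u\<bar> \<le> b" unfolding u_def b_def by (rule abs_Re_le_cmod)
    then have u2: "u\<^sup>2 \<le> b\<^sup>2" by (metis abs_le_square_iff abs_of_pos b)
    have 1: "\<bar>(u / 2 - 1 / 4) / b\<^sup>2\<bar> \<le> (b / 2 + 1 / 4) / b\<^sup>2"
      unfolding abs_divide using u by (simp add: divide_right_mono)
    have 2: "\<bar>(u\<^sup>2 - 1 / 4) / (6 * (b\<^sup>2)\<^sup>2)\<bar> \<le> (b\<^sup>2 + 1 / 4) / (6 * (b\<^sup>2)\<^sup>2)"
    proof -
      have "\<bar>u\<^sup>2 - 1 / 4\<bar> \<le> b\<^sup>2 + 1 / 4" using u2 zero_le_power2[of u] by linarith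
      then show ?thesis unfolding abs_divide by (simp add: divide_right_mono)
    qed
    have "\<bar>digamma_gap z\<bar> \<le> (b / 2 + 1 / 4) / b\<^sup>2 + 1 / (6 * b\<^sup>2) + (b\<^sup>2 + 1 / 4) / (6 * (b\<^sup>2)\<^sup>2)"
      using 1 2 b unfolding digamma_gap_def b_def[symmetric] u_def[symmetric]
      by (intro order_trans[OF abs_triangle_ineq] add_mono) auto
    also have "\<dots> = inverse b / 2 + (1/4 + 1 / 6) * (inverse b)\<^sup>2 + (inverse b)\<^sup>2 / 6 + ((inverse b)\<^sup>2)\<^sup>2 / 24"
      using b by (simp add: field_simps eval_nat_numeral)
    also have "\<dots> \<le> inverse b / 2 + 5 * (inverse b)\<^sup>2 + (inverse b)\<^sup>2 / 6 + ((inverse b)\<^sup>2)\<^sup>2"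
      by (intro add_mono mult_right_mono order_refl) (auto simp: divide_le_eq)
    finally show "norm (digamma_gap (w + of_nat n)) \<le> inverse (N n) / 2 + 5 * (inverse (N n))\<^sup>2 + (inverse (N n))\<^sup>2 / 6
     + ((inverse (N n))\<^sup>2)\<^sup>2"
      by (simp add: z_def b_def N_def)
  qed
qed

text \<open>Along w, w + 1, w + 2, ... the sequence Re psi - ln |.| + \<open>digamma_gap\<close> is
  nondecreasing with limit 0, so its first term is at most 0.\<close>

lemma Re_Digamma_le_gap:
  fixes w :: complex
  assumes "0 < Re w"
  shows "Re (Digamma w) \<le> ln (norm w) - digamma_gap w"
proof -
  define X where "X = (\<lambda>n. Re (Digamma (w + of_nat n)) - ln (norm (w + of_nat n)) + digamma_gap (w + of_nat n))"
  have "X n \<le> X (Suc n)" for n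
  proof -
    define z where "z = w + of_nat n"
    have z: "0 < Re z" using assms by (simp add: z_def)
    have "Digamma (z + 1) = Digamma z + 1 / z"
      using z by (intro Digamma_plus1) auto
    then have "Re (Digamma (z + 1)) = Re (Digamma z) + Re (1 / z)"
      by (simp only: plus_complex.simps)
    then have "Re (Digamma z) - ln (norm z) + digamma_gap z
        \<le> Re (Digamma (z + 1)) - ln (norm (z + 1)) + digamma_gap (z + 1)"
      using ln_norm_plus_1_bound[OF z] by linarith
    moreover have "w + of_nat (Suc n) = z + 1" by (simp add: z_def add_ac)
    ultimately show ?thesis unfolding X_def z_def by metis
  qed
  then have "incseq X" by (simp add: incseq_Suc_iff)
  moreover have "X \<longlonglongrightarrow> 0 + 0" unfolding X_def
    by (intro tendsto_add Digamma_ln_norm_tendsto digamma_gap_tendsto assms)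
  ultimately have "X 0 \<le> 0" using incseq_le[of X 0 0] by simp
  then show ?thesis by (simp add: X_def)
qed

text \<open>Where the gap is nonnegative nothing is left to do. It can be negative only for Re w <
  1/2 and |w|^2 < 3/4; there the gap is used at w + 1, and the term Re (1/w) of the recurrence makes
  up for the growth of the logarithm.\<close>

lemma Re_Digamma_le:
  fixes w :: complex
  assumes "1 / 4 \<le> Re w"
  shows "Re (Digamma w) \<le> ln (norm w)"
proof -
  define u where "u = Re w"
  define a where "a = (norm w)\<^sup>2"
  have u: "1 / 4 \<le> u" using assms by (simp add: u_def)
  have au: "u\<^sup>2 \<le> a" by (simp add: a_def u_def cmod_def)
  have u2: "1 / 16 \<le> u\<^sup>2" using power_mono[OF u, of 2] by (simp add: power2_eq_square)
  have a0: "a > 0" using au u2 by linarith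
  have gap: "digamma_gap w = (a * (u / 2 - 1 / 12) + (u\<^sup>2 - 1 / 4) / 6) / a\<^sup>2"
    unfolding digamma_gap_def u_def[symmetric] a_def[symmetric]
    using a0 by (simp add: field_simps power2_eq_square)
  show ?thesis
  \<comment> \<open>At u = 1/4 the numerator of the gap is a/24 - 1/32, which vanishes at a =
    3/4.\<close>
  proof (cases "u \<ge> 1 / 2 \<or> a \<ge> 3 / 4")
    case True
    have "0 \<le> a * (u / 2 - 1 / 12) + (u\<^sup>2 - 1 / 4) / 6"
    proof (cases "u \<ge> 1 / 2")
      case True
      then have "1 / 4 \<le> u\<^sup>2" using power_mono[of "1/2" u 2] by (simp add: power2_eq_square)
      moreover have "0 \<le> a * (u / 2 - 1 / 12)" using True a0 by simp
      ultimately show ?thesis by simp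
    next
      case False
      then have "a \<ge> 3 / 4" using True by simp
      then have "(3 / 4) * (1 / 24) \<le> a * (u / 2 - 1 / 12)" using u by (intro mult_mono) auto
      moreover have "(u\<^sup>2 - 1 / 4) / 6 \<ge> - (1 / 32)" using u2 by simp
      ultimately show ?thesis by linarith
    qed
    then have "0 \<le> digamma_gap w" using a0 by (simp add: gap)
    then show ?thesis using Re_Digamma_le_gap[of w] assms by simp
  next
    case False
    then have u': "u < 1 / 2" and a': "a < 3 / 4" by auto
    define b where "b = a + 2 * u + 1"
    have nb: "(norm (w + 1))\<^sup>2 = b"
      by (simp add: b_def a_def u_def cmod_power2) (simp add: power2_eq_square algebra_simps)
    have b: "0 < b" "b \<le> 11 / 4" "b \<ge> a" using u u' a' a0 by (auto simp: b_def)
    have R: "Re (1 / w) = u / a" by (simp add: Re_divide a_def u_def cmod_power2)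
    have D: "Digamma (w + 1) = Digamma w + 1 / w"
      using assms by (intro Digamma_plus1) auto
    have D': "Re (Digamma w) = Re (Digamma (w + 1)) - u / a"
      unfolding D using R by (simp only: plus_complex.simps)
    have g1: "digamma_gap (w + 1) \<ge> (u + 1 / 2) / (2 * b) + 1 / (6 * b)"
    proof -
      have "(u + 1)\<^sup>2 \<ge> 1\<^sup>2" using u by (intro power_mono) auto
      then have "0 \<le> ((u + 1)\<^sup>2 - 1 / 4) / (6 * b\<^sup>2)" by simp
      moreover have "((u + 1) / 2 - 1 / 4) / b = (u + 1 / 2) / (2 * b)" using b by (simp add: field_simps)
      ultimately show ?thesis unfolding digamma_gap_def nb by (simp add: u_def)
    qed
    have g2: "1 / (6 * b) \<ge> 2 / 33" using b by (simp add: field_simps)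
    have l: "ln (norm (w + 1)) - ln (norm w) = ln (b / a) / 2"
    proof -
      have "norm w > 0" "norm (w + 1) > 0" using u a0 nb b(1) by (auto simp: a_def)
      then have "ln b = 2 * ln (norm (w + 1))" "ln a = 2 * ln (norm w)"
        by (simp_all add: ln_realpow a_def flip: nb)
      then show ?thesis using b a0 by (simp add: ln_div)
    qed
    \<comment> \<open>With d = 2 u + 1, so that b = a + d, this is u/a plus the leading part of the
      gap at w + 1 minus the difference of the logarithms. It increases in d, so u = 1/4 is the
      worst case; the remaining function \<open>J\<close> of a decreases, so a = 3/4 is the worst
      case there.\<close>
    define K where "K = (\<lambda>d::real. (d - 1) / (2 * a) + d / (4 * (a + d)) - (ln (a + d) - ln a) / 2)"
    have K1: "K (3 / 2) \<le> K (2 * u + 1)"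
    proof (rule DERIV_nonneg_imp_nondecreasing[where f = K])
      fix d assume d: "3 / 2 \<le> d" "d \<le> 2 * u + 1"
      have p: "a + d > 0" using a0 d by simp
      have "(K has_real_derivative 1 / (2 * a) + (4 * (a + d) - d * 4) / (4 * (a + d))\<^sup>2 - 1 / (a + d) / 2) (at d)"
        unfolding K_def using a0 p
        by (auto intro!: derivative_eq_intros simp: power2_eq_square) (simp add: divide_simps)
      moreover have "0 \<le> 1 / (2 * a) + (4 * (a + d) - d * 4) / (4 * (a + d))\<^sup>2 - 1 / (a + d) / 2"
      proof -
        have "1 / (a + d) / 2 \<le> 1 / (2 * a)" using a0 d by (simp add: field_simps)
        moreover have "0 \<le> (4 * (a + d) - d * 4) / (4 * (a + d))\<^sup>2" using a0 by simp
        ultimately show ?thesis by linarith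
      qed
      ultimately show "\<exists>y. (K has_real_derivative y) (at d) \<and> 0 \<le> y" by blast
    qed (use u in auto)
    define J where "J = (\<lambda>t::real. 1 / (4 * t) + 3 / (8 * t + 12) - (ln (t + 3 / 2) - ln t) / 2)"
    have J1: "J (3 / 4) \<le> J a"
    proof (rule DERIV_nonpos_imp_nonincreasing[where f = J])
      fix t :: real assume t: "a \<le> t" "t \<le> 3 / 4"
      have p: "t > 0" using a0 t by simp
      have "(J has_real_derivative - (4 / (4 * t)\<^sup>2) - 24 / (8 * t + 12)\<^sup>2 - (1 / (t + 3 / 2) - 1 / t) / 2) (at t)"
        unfolding J_def using p by (auto intro!: derivative_eq_intros simp: power2_eq_square)
      moreover have "- (4 / (4 * t)\<^sup>2) - 24 / (8 * t + 12)\<^sup>2 - (1 / (t + 3 / 2) - 1 / t) / 2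
          = (t\<^sup>2 / 8 + 3 * t / 8 - 9 / 16) / (t\<^sup>2 * (t + 3 / 2)\<^sup>2)"
      proof -
        have e: "8 * t + 12 = 8 * (t + 3 / 2)" by simp
        define q where "q = t + 3 / 2"
        have tq: "t = q - 3 / 2" "q \<noteq> 0" "t \<noteq> 0" using p by (auto simp: q_def)
        show ?thesis unfolding e q_def[symmetric] using tq(2,3)
          by (simp add: divide_simps power2_eq_square) (simp add: tq(1) algebra_simps)
      qed
      moreover have "t\<^sup>2 / 8 + 3 * t / 8 - 9 / 16 \<le> 0"
      proof -
        have "t\<^sup>2 \<le> (3 / 4)\<^sup>2" using p t by (intro power_mono) auto
        then show ?thesis using t by (simp add: power2_eq_square)
      qed
      ultimately show "\<exists>y. (J has_real_derivative y) (at t) \<and> y \<le> 0"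
        by (metis divide_nonpos_nonneg mult_nonneg_nonneg zero_le_power2)
    qed (use a' in auto)
    have J2: "J (3 / 4) = 1 / 2 - ln 3 / 2"
    proof -
      have "ln (9 / 4 :: real) - ln (3 / 4) = ln ((9 / 4) / (3 / 4))" by (subst ln_div) auto
      also have "\<dots> = ln 3" by simp
      finally show ?thesis by (simp add: J_def)
    qed
    \<comment> \<open>The worst value (1 - ln 3)/2 is thus at least -1/18. The term 1/(6 b) >= 2/33,
      kept out of \<open>K\<close>, outweighs it.\<close>
    have ln3: "ln (3 :: real) \<le> 10 / 9"
    proof -
      have "ln ((1 + 1/2) / (1 - 1/2) :: real) \<le> 2 * (1/2 + (1/2) ^ 3 / (3 * (1 - (1/2)\<^sup>2)))"
        by (rule artanh_bound) auto
      then show ?thesis by (simp add: power2_eq_square eval_nat_numeral)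
    qed
    have KJ: "K (3 / 2) = J a"
    proof -
      have "(3 / 2 :: real) / (4 * (a + 3 / 2)) = 3 / (8 * a + 12)"
        using a0 by (simp add: divide_simps)
      then show ?thesis by (simp add: K_def J_def)
    qed
    have "K (2 * u + 1) = u / a + (u + 1 / 2) / (2 * b) - ln (b / a) / 2"
    proof -
      have "a + (2 * u + 1) = b" by (simp add: b_def)
      moreover have "(2 * u + 1) / (4 * b) = (u + 1 / 2) / (2 * b)" using b by (simp add: field_simps)
      ultimately show ?thesis unfolding K_def using b a0 by (simp add: ln_div)
    qed
    then have "u / a + (u + 1 / 2) / (2 * b) - ln (b / a) / 2 \<ge> 1 / 2 - ln 3 / 2"
      using K1 J1 J2 KJ by linarith
    then have "u / a + digamma_gap (w + 1) - ln (b / a) / 2 \<ge> 0"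
      using g1 g2 ln3 by linarith
    moreover have "Re (Digamma (w + 1)) \<le> ln (norm (w + 1)) - digamma_gap (w + 1)"
      using assms by (intro Re_Digamma_le_gap) simp
    ultimately show ?thesis using D' l by linarith
  qed
qed

section \<open>Partial fractions of the logarithmic derivative\<close>

text \<open>The map k -> k / (2 H - k) takes the half-plane Re k < H into the unit disc and fixes 0.
  Schwarz's lemma bounds the image, and solving for k gives the claim.\<close>

lemma Borel_Caratheodory:
  fixes g :: "complex \<Rightarrow> complex"
  assumes g: "g holomorphic_on ball 0 R" and "0 < R"
    and A: "\<And>z. norm z < R \<Longrightarrow> Re (g z) < A" and z: "norm z < R"
  shows "norm (g z - g 0) \<le> 2 * (A - Re (g 0)) * norm z / (R - norm z)"
proof -
  define H where "H = A - Re (g 0)"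
  have H: "H > 0" using A[of 0] \<open>0 < R\<close> by (simp add: H_def)
  define k where "k = (\<lambda>w. g (of_real R * w) - g 0)"
  have in_ball: "norm (of_real R * w) < R" if "norm w < 1" for w :: complex
    using that \<open>0 < R\<close> by (simp add: norm_mult)
  have k: "k holomorphic_on ball 0 1" unfolding k_def
    by (intro holomorphic_intros holomorphic_on_compose_gen[OF _ g, unfolded o_def])
       (use in_ball in auto)
  have Rek: "Re (k w) < H" if "norm w < 1" for w
    using A[OF in_ball[OF that]] by (simp add: k_def H_def)
  have nz: "of_real (2 * H) - k w \<noteq> 0" if "norm w < 1" for w
  proof
    assume "of_real (2 * H) - k w = 0"
    then have "Re (k w) = 2 * H" by (metis Re_complex_of_real eq_iff_diff_eq_0)
    then show False using Rek[OF that] H by simp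
  qed
  define h where "h = (\<lambda>w. k w / (of_real (2 * H) - k w))"
  have "h holomorphic_on ball 0 1" unfolding h_def
    using nz by (intro holomorphic_intros k) auto
  moreover have "h 0 = 0" by (simp add: h_def k_def)
  moreover have "norm (h w) < 1" if w: "norm w < 1" for w
  proof -
    have "(norm (k w))\<^sup>2 < (norm (of_real (2 * H) - k w))\<^sup>2"
      using Rek[OF w] H mult_strict_left_mono[OF Rek[OF w] H]
      unfolding cmod_power2 by (simp add: power2_eq_square algebra_simps)
    then have "norm (k w) < norm (of_real (2 * H) - k w)"
      by (rule power2_less_imp_less) simp
    then show ?thesis using nz[OF w] by (simp add: h_def norm_divide)
  qed
  ultimately have Schw: "norm (h w) \<le> norm w" if "norm w < 1" for w
    using Schwarz_Lemma(1) that by blast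
  define w where "w = z / of_real R"
  have w: "norm w < 1" using z \<open>0 < R\<close> by (simp add: w_def norm_divide)
  have kw: "k w = g z - g 0" using \<open>0 < R\<close> by (simp add: k_def w_def)
  have "norm (k w) = norm (h w) * norm (of_real (2 * H) - k w)"
    using nz[OF w] by (simp add: h_def norm_divide)
  also have "\<dots> \<le> norm w * (2 * H + norm (k w))"
    using Schw[OF w] norm_triangle_ineq4[of "of_real (2 * H)" "k w"] H
    by (intro mult_mono) auto
  finally have "norm (k w) * (1 - norm w) \<le> 2 * H * norm w" by (simp add: algebra_simps)
  then have "norm (k w) \<le> 2 * H * norm w / (1 - norm w)" using w by (simp add: field_simps)
  also have "norm w = norm z / R" using \<open>0 < R\<close> by (simp add: w_def norm_divide)
  also have "2 * H * (norm z / R) / (1 - norm z / R) = 2 * H * norm z / (R - norm z)"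
    using \<open>0 < R\<close> z by (simp add: field_simps)
  finally show ?thesis by (simp add: kw H_def)
qed

text \<open>The zeros are divided out one at a time. The factors already split off do not vanish at
  the next point b, so the order of the cofactor there is still that of f, and
  \<open>zor_poly\<close> supplies the value at the removed singularity. A point of A that is no
  zero gets the exponent 0.\<close>

lemma entire_factor_zeros:
  fixes f :: "complex \<Rightarrow> complex"
  assumes f: "f holomorphic_on UNIV" "f z0 \<noteq> 0" and "finite A"
  shows "\<exists>g. g holomorphic_on UNIV \<and>
    (\<forall>z. f z = g z * (\<Prod>r\<in>A. (z - r) ^ nat (zorder f r))) \<and> (\<forall>r\<in>A. g r \<noteq> 0)"
  using \<open>finite A\<close>
proof (induction rule: finite_induct)
  case empty
  then show ?case using f(1) by (intro exI[of _ f]) auto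
next
  case (insert b A)
  then obtain g where g: "g holomorphic_on UNIV" "\<And>r. r \<in> A \<Longrightarrow> g r \<noteq> 0"
    and fg: "\<And>z. f z = g z * (\<Prod>r\<in>A. (z - r) ^ nat (zorder f r))" by blast
  define P where "P = (\<lambda>z. \<Prod>r\<in>A. (z - r) ^ nat (zorder f r))"
  have P: "P holomorphic_on UNIV" unfolding P_def by (intro holomorphic_intros)
  have Pb: "P b \<noteq> 0" using insert.hyps by (auto simp: P_def)
  have fP: "f = (\<lambda>z. g z * P z)" using fg by (auto simp: P_def)
  have g0: "g z0 \<noteq> 0" using f(2) by (auto simp: fP)
  have ev: "\<forall>\<^sub>F z in at b. f z \<noteq> 0"
    using non_zero_neighbour_alt[OF f(1) open_UNIV connected_UNIV UNIV_I UNIV_I f(2)]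
    by (auto elim: eventually_mono)
  have "zorder f b = zorder g b + zorder P b"
    unfolding fP
  proof (rule zorder_times_analytic)
    show "g analytic_on {b}" "P analytic_on {b}"
      using g(1) P analytic_on_holomorphic open_UNIV by (metis UNIV_I analytic_at)+
    show "\<forall>\<^sub>F z in at b. g z * P z \<noteq> 0" using ev by (simp add: fP)
  qed
  also have "zorder P b = 0" using P Pb by (intro zorder_eq_0I) (metis UNIV_I analytic_at open_UNIV)
  finally have zo: "zorder f b = zorder g b" by simp
  define n where "n = nat (zorder g b)"
  define h where "h = zor_poly g b"
  obtain r where r: "r > 0" "h holomorphic_on cball b r"
    "\<And>w. w \<in> cball b r \<Longrightarrow> g w = h w * (w - b) ^ n \<and> h w \<noteq> 0"
    using zorder_exist_zero[OF g(1) open_UNIV connected_UNIV UNIV_I, of b] g0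
    unfolding n_def h_def by blast
  define q where "q = (\<lambda>w. g w / (w - b) ^ n)"
  define g1 where "g1 = (\<lambda>w. if w = b then h b else q w)"
  have "q \<midarrow>b\<rightarrow> h b"
  proof -
    have "h \<midarrow>b\<rightarrow> h b"
      using r(1,2) by (metis (no_types, lifting) ball_subset_cball centre_in_ball continuous_on_interior
        holomorphic_on_imp_continuous_on interior_cball isContD)
    moreover have "\<forall>\<^sub>F w in at b. h w = q w"
      using eventually_at_ball'[OF r(1), of b UNIV]
      by eventually_elim (use r(3) in \<open>auto simp: q_def\<close>)
    ultimately show ?thesis by (rule Lim_transform_eventually)
  qed
  moreover have "q holomorphic_on UNIV - {b}" unfolding q_def
    using g(1) by (intro holomorphic_intros) (auto intro: holomorphic_on_subset)
  ultimately have g1: "g1 holomorphic_on UNIV" unfolding g1_def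
    by (intro removable_singularity) auto
  have gg1: "g z = g1 z * (z - b) ^ n" for z
    using r(1) r(3)[of b] by (cases "z = b") (auto simp: g1_def q_def)
  have "g1 c \<noteq> 0" if "c \<in> insert b A" for c
    using that r(1) r(3)[of b] g(2)[of c] insert.hyps by (auto simp: g1_def q_def)
  moreover have "f z = g1 z * (\<Prod>r\<in>insert b A. (z - r) ^ nat (zorder f r))" for z
    using insert.hyps by (simp add: fg[of z] gg1[of z] zo n_def)
  ultimately show ?case using g1 by blast
qed

lemma logderiv_prod_power:
  fixes p :: "'a \<Rightarrow> complex \<Rightarrow> complex"
  assumes "finite A" "\<And>i. i \<in> A \<Longrightarrow> (p i has_field_derivative p' i) (at z)"
    and "\<And>i. i \<in> A \<Longrightarrow> p i z \<noteq> 0"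
  shows "((\<lambda>z. \<Prod>i\<in>A. p i z ^ m i) has_field_derivative
    (\<Prod>i\<in>A. p i z ^ m i) * (\<Sum>i\<in>A. of_nat (m i) * (p' i / p i z))) (at z)"
  using assms
proof (induction rule: finite_induct)
  case (insert b A)
  have "((\<lambda>z. p b z ^ m b) has_field_derivative of_nat (m b) * p b z ^ (m b - 1) * p' b) (at z)"
    using insert.prems(1)[of b] by (auto intro!: derivative_eq_intros)
  moreover have "of_nat (m b) * p b z ^ (m b - 1) * p' b = p b z ^ m b * (of_nat (m b) * (p' b / p b z))"
    using insert.prems(2)[of b] by (cases "m b") auto
  ultimately have 1: "((\<lambda>z. p b z ^ m b) has_field_derivative p b z ^ m b * (of_nat (m b) * (p' b / p b z))) (at z)"
    by simp
  show ?case
    using DERIV_mult[OF 1 insert.IH[OF insert.prems]] insert.hyps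
    by (simp add: algebra_simps)
qed simp

lemma finite_zeros_ball:
  fixes f :: "complex \<Rightarrow> complex"
  assumes "f holomorphic_on UNIV" "f z0 \<noteq> 0"
  shows "finite {r. f r = 0 \<and> norm r < R}"
proof (cases "f constant_on UNIV")
  case True
  then have "\<And>z. f z \<noteq> 0" using assms(2) by (metis UNIV_I constant_on_def)
  then show ?thesis by simp
next
  case False
  have "finite {z \<in> cball 0 R. f z = 0}"
    using False by (intro holomorphic_compact_finite_zeros[OF assms(1)]) auto
  then show ?thesis by (rule rev_finite_subset) auto
qed

text \<open>Blaschke factors move the zeros out of the disc without changing \<open>\<bar>f\<bar>\<close> on the circle.\<close>

lemma zero_free_majorant:
  fixes f :: "complex \<Rightarrow> complex"
  assumes f: "f holomorphic_on UNIV" "f 0 \<noteq> 0" and R: "0 < R"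
    and M: "\<And>z. norm z = R \<Longrightarrow> norm (f z) \<le> M"
  defines "Z \<equiv> {r. f r = 0 \<and> norm r < R}" and "m \<equiv> \<lambda>r. nat (zorder f r)"
  obtains F where "F holomorphic_on UNIV" "\<And>z. norm z < R \<Longrightarrow> F z \<noteq> 0"
    "\<And>z. norm z < R \<Longrightarrow> norm (F z) \<le> M"
    "norm (F 0) = norm (f 0) * (\<Prod>r\<in>Z. (R / norm r) ^ m r)"
    "\<And>z. norm z < R \<Longrightarrow> f z \<noteq> 0 \<Longrightarrow> deriv F z / F z = deriv f z / f z
       - (\<Sum>r\<in>Z. of_nat (m r) * (1 / (z - r) + cnj r / (of_real (R\<^sup>2) - cnj r * z)))"
proof -
  have fin: "finite Z" unfolding Z_def by (rule finite_zeros_ball[OF f])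
  obtain g where g: "g holomorphic_on UNIV" "\<And>r. r \<in> Z \<Longrightarrow> g r \<noteq> 0"
    and fg: "\<And>z. f z = g z * (\<Prod>r\<in>Z. (z - r) ^ m r)"
    using entire_factor_zeros[OF f fin] unfolding m_def by blast
  define b where "b = (\<lambda>r z. (of_real (R\<^sup>2) - cnj r * z) / of_real R)"
  define P where "P = (\<lambda>z. \<Prod>r\<in>Z. (z - r) ^ m r)"
  define Q where "Q = (\<lambda>z. \<Prod>r\<in>Z. b r z ^ m r)"
  define F where "F = (\<lambda>z. g z * Q z)"
  have R': "complex_of_real R \<noteq> 0" using R by simp
  have F: "F holomorphic_on UNIV" unfolding F_def Q_def b_def using R'
    by (intro holomorphic_intros g) auto
  have bnz: "b r z \<noteq> 0" if "r \<in> Z" "norm z < R" for r z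
  proof -
    have "norm (cnj r * z) < R * R" unfolding norm_mult using that
      by (intro mult_strict_mono') (auto simp: Z_def)
    moreover have "norm (of_real (R\<^sup>2) :: complex) = R * R" by (simp add: power2_eq_square norm_mult)
    ultimately have "cnj r * z \<noteq> of_real (R\<^sup>2)" by (metis less_irrefl)
    then show ?thesis using R' by (auto simp: b_def)
  qed
  have gnz: "g z \<noteq> 0" if "norm z < R" for z
    using that fg[of z] g(2)[of z] by (auto simp: Z_def)
  have Fnz: "F z \<noteq> 0" if "norm z < R" for z
    using gnz[OF that] bnz[OF _ that] fin by (auto simp: F_def Q_def)
  have circ: "norm (F z) = norm (f z)" if z: "norm z = R" for z
  proof -
    have "norm (b r z) = norm (z - r)" for r
    proof -
      \<comment> \<open>On the circle R^2 - cnj r z = z cnj (z - r), so the Blaschke factor and z -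
        r have the same modulus.\<close>
      have "of_real (R\<^sup>2) = z * cnj z" using z by (simp add: complex_norm_square[symmetric])
      then have "of_real (R\<^sup>2) - cnj r * z = z * cnj (z - r)" by (simp add: algebra_simps)
      then show ?thesis using R z by (simp add: b_def norm_divide norm_mult del: complex_cnj_diff)
    qed
    then show ?thesis by (simp add: F_def Q_def fg[of z] norm_mult prod_norm[symmetric] norm_power)
  qed
  have le: "norm (F z) \<le> M" if z: "norm z < R" for z
  proof (rule maximum_modulus_frontier[of F "cball 0 R"])
    show "F holomorphic_on interior (cball 0 R)" "continuous_on (closure (cball 0 R)) F"
      using F by (auto intro: holomorphic_on_subset holomorphic_on_imp_continuous_on)
    show "norm (F z) \<le> M" if "z \<in> frontier (cball 0 R)" for z
      using that M[of z] circ[of z] R by auto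
  qed (use z in auto)
  have F0: "norm (F 0) = norm (f 0) * (\<Prod>r\<in>Z. (R / norm r) ^ m r)"
  proof -
    have nz: "norm r \<noteq> 0" if "r \<in> Z" for r using that f(2) by (auto simp: Z_def)
    have "norm (F 0) = norm (g 0) * (\<Prod>r\<in>Z. R ^ m r)"
      using R by (simp add: F_def Q_def b_def norm_mult prod_norm[symmetric] norm_power power2_eq_square)
    moreover have "norm (f 0) = norm (g 0) * (\<Prod>r\<in>Z. norm r ^ m r)"
      by (simp add: fg[of 0] norm_mult prod_norm[symmetric] norm_power)
    moreover have "(\<Prod>r\<in>Z. norm r ^ m r) * (\<Prod>r\<in>Z. (R / norm r) ^ m r) = (\<Prod>r\<in>Z. R ^ m r)"
      unfolding prod.distrib[symmetric] using nz by (intro prod.cong) (auto simp: power_divide)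
    ultimately show ?thesis by (simp add: mult.assoc)
  qed
  have ld: "deriv F z / F z = deriv f z / f z
       - (\<Sum>r\<in>Z. of_nat (m r) * (1 / (z - r) + cnj r / (of_real (R\<^sup>2) - cnj r * z)))"
    if z: "norm z < R" and fz: "f z \<noteq> 0" for z
  proof -
    have nz: "z - r \<noteq> 0" if "r \<in> Z" for r using that fz by (auto simp: Z_def)
    have dg: "(g has_field_derivative deriv g z) (at z)"
      using g(1) holomorphic_derivI open_UNIV by blast
    have dP: "(P has_field_derivative P z * (\<Sum>r\<in>Z. of_nat (m r) * (1 / (z - r)))) (at z)"
      unfolding P_def using nz by (intro logderiv_prod_power fin) (auto intro!: derivative_eq_intros)
    have dQ: "(Q has_field_derivative Q z * (\<Sum>r\<in>Z. of_nat (m r) * (- cnj r / of_real R / b r z))) (at z)"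
      unfolding Q_def using bnz[OF _ z] R'
      by (intro logderiv_prod_power fin) (auto simp: b_def intro!: derivative_eq_intros)
    have Pz: "P z \<noteq> 0" using nz fin by (auto simp: P_def)
    have Qz: "Q z \<noteq> 0" using bnz[OF _ z] fin by (auto simp: Q_def)
    have "f = (\<lambda>z. g z * P z)" using fg by (auto simp: P_def)
    then have "deriv f z = deriv g z * P z + P z * (\<Sum>r\<in>Z. of_nat (m r) * (1 / (z - r))) * g z"
      using DERIV_imp_deriv[OF DERIV_mult[OF dg dP]] by simp
    then have 1: "deriv f z / f z = deriv g z / g z + (\<Sum>r\<in>Z. of_nat (m r) * (1 / (z - r)))"
    proof -
      have "f z = g z * P z" using fg[of z] by (simp add: P_def)
      then show ?thesis using \<open>deriv f z = _\<close> Pz gnz[OF z] by (simp add: field_simps)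
    qed
    have "deriv F z = deriv g z * Q z + Q z * (\<Sum>r\<in>Z. of_nat (m r) * (- cnj r / of_real R / b r z)) * g z"
      using DERIV_imp_deriv[OF DERIV_mult[OF dg dQ]] by (simp add: F_def)
    then have 2: "deriv F z / F z = deriv g z / g z + (\<Sum>r\<in>Z. of_nat (m r) * (- cnj r / of_real R / b r z))"
      using Qz gnz[OF z] by (simp add: F_def field_simps)
    have 3: "(\<Sum>r\<in>Z. of_nat (m r) * (- cnj r / of_real R / b r z))
      = - (\<Sum>r\<in>Z. of_nat (m r) * (cnj r / (of_real (R\<^sup>2) - cnj r * z)))"
      unfolding sum_negf[symmetric] using R' by (intro sum.cong) (auto simp: b_def)
    show ?thesis unfolding 1 2 3 by (simp add: distrib_left sum.distrib)
  qed
  show thesis using that[OF F Fnz le F0 ld] .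
qed


text \<open>Jensen's inequality on the disc of radius 2R: every zero inside radius R enlarges |F(0)|
  / |f(0)| by a factor of at least 2, while |F(0)| <= M by the maximum principle.\<close>

lemma zero_count:
  fixes f :: "complex \<Rightarrow> complex"
  assumes f: "f holomorphic_on UNIV" "f 0 \<noteq> 0" and R: "0 < R"
    and M: "\<And>z. norm z = 2 * R \<Longrightarrow> norm (f z) \<le> M"
  defines "Z \<equiv> \<lambda>R. {r. f r = 0 \<and> norm r < R}" and "m \<equiv> \<lambda>r. nat (zorder f r)"
  shows "real (\<Sum>r\<in>Z R. m r) * ln 2 \<le> ln M - ln (norm (f 0))"
proof -
  have fin: "finite (Z R)" for R unfolding Z_def by (rule finite_zeros_ball[OF f])
  have R2: "0 < 2 * R" using R by simp
  obtain F :: "complex \<Rightarrow> complex" where le: "\<And>z. norm z < 2 * R \<Longrightarrow> norm (F z) \<le> M"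
    and F0: "norm (F 0) = norm (f 0) * (\<Prod>r\<in>Z (2 * R). (2 * R / norm r) ^ m r)"
    by (rule zero_free_majorant[OF f R2, of M], erule M, rule that[unfolded Z_def m_def])
  have nz: "norm r > 0" if "r \<in> Z t" for r t using that f(2) by (auto simp: Z_def)
  have ge1: "1 \<le> (2 * R / norm r) ^ m r" if "r \<in> Z (2 * R)" for r
    using that nz[OF that] by (intro one_le_power) (auto simp: Z_def)
  have "2 ^ (\<Sum>r\<in>Z R. m r) = (\<Prod>r\<in>Z R. (2::real) ^ m r)" by (simp add: power_sum)
  also have "\<dots> \<le> (\<Prod>r\<in>Z R. (2 * R / norm r) ^ m r)"
    using nz by (intro prod_mono conjI power_mono) (auto simp: Z_def field_simps)
  also have "\<dots> \<le> (\<Prod>r\<in>Z (2 * R). (2 * R / norm r) ^ m r)"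
  proof (rule prod_mono2[OF fin])
    show "Z R \<subseteq> Z (2 * R)" using R by (auto simp: Z_def)
    show "1 \<le> (2 * R / norm b) ^ m b" if "b \<in> Z (2 * R) - Z R" for b using that ge1 by blast
    show "0 \<le> (2 * R / norm a) ^ m a" if "a \<in> Z R" for a using R by simp
  qed
  finally have "norm (f 0) * 2 ^ (\<Sum>r\<in>Z R. m r) \<le> norm (F 0)"
    unfolding F0 by (rule mult_left_mono) simp
  also have "\<dots> \<le> M" using le[of 0] R by simp
  finally have "norm (f 0) * 2 ^ (\<Sum>r\<in>Z R. m r) \<le> M" .
  moreover have "norm (f 0) > 0" using f(2) by simp
  ultimately have "ln (norm (f 0) * 2 ^ (\<Sum>r\<in>Z R. m r)) \<le> ln M"
    by (intro ln_mono) auto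
  then show ?thesis using f(2) by (simp add: ln_mult ln_realpow)
qed

text \<open>The zero-free majorant F has a logarithm G on the disc. Borel-Caratheodory bounds G on
  the half disc, and Cauchy's inequality then bounds G''. Comparing G' at z and at 0 gains a second
  factor 1/R, without which the error would not vanish for growth of order 1.\<close>

lemma logderiv_partial_fraction_error:
  fixes f :: "complex \<Rightarrow> complex"
  assumes f: "f holomorphic_on UNIV" "f 0 \<noteq> 0" and R: "0 < R" "4 * norm z \<le> R"
    and M: "\<And>z. norm z = R \<Longrightarrow> norm (f z) \<le> M" and fz: "f z \<noteq> 0"
  defines "Z \<equiv> {r. f r = 0 \<and> norm r < R}" and "m \<equiv> \<lambda>r. nat (zorder f r)"
  shows "norm (deriv f z / f z - deriv f 0 / f 0 - (\<Sum>r\<in>Z. of_nat (m r) * (1 / (z - r) + 1 / r)))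
    \<le> 64 * (ln M + 1 - ln (norm (f 0))) * norm z / R\<^sup>2 + 2 * norm z * real (\<Sum>r\<in>Z. m r) / R\<^sup>2"
proof -
  have fin: "finite Z" unfolding Z_def by (rule finite_zeros_ball[OF f])
  \<comment> \<open>The summand 1 makes the upper bound for Re log F strict, as
    \<open>Borel_Caratheodory\<close> demands.\<close>
  define H where "H = ln M + 1 - ln (norm (f 0))"
  obtain F where F: "F holomorphic_on UNIV" and Fnz: "\<And>z. norm z < R \<Longrightarrow> F z \<noteq> 0"
    and le: "\<And>z. norm z < R \<Longrightarrow> norm (F z) \<le> M"
    and F0: "norm (F 0) = norm (f 0) * (\<Prod>r\<in>Z. (R / norm r) ^ m r)"
    and ld: "\<And>z. norm z < R \<Longrightarrow> f z \<noteq> 0 \<Longrightarrow> deriv F z / F z = deriv f z / f z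
       - (\<Sum>r\<in>Z. of_nat (m r) * (1 / (z - r) + cnj r / (of_real (R\<^sup>2) - cnj r * z)))"
    using zero_free_majorant[OF f R(1) M] unfolding Z_def m_def by blast
  have nzr: "norm r > 0" "norm r < R" if "r \<in> Z" for r using that f(2) by (auto simp: Z_def)
  have "1 \<le> (\<Prod>r\<in>Z. (R / norm r) ^ m r)"
    using nzr by (intro prod_ge_1 one_le_power) (auto simp: less_imp_le)
  then have F0': "norm (f 0) \<le> norm (F 0)" unfolding F0 by (simp add: mult_left_le mult_le_cancel_left1)
  obtain G0 where G0: "G0 holomorphic_on ball 0 R" "\<And>x. x \<in> ball 0 R \<Longrightarrow> exp (G0 x) = F x"
    using holomorphic_logarithm_exists[of "ball 0 R" F 0] F Fnz R(1)
    by (auto intro: holomorphic_on_subset)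
  define G where "G = (\<lambda>x. G0 x - G0 0)"
  have G: "G holomorphic_on ball 0 R" unfolding G_def by (intro holomorphic_intros G0)
  have dG: "deriv G x = deriv F x / F x" if x: "norm x < R" for x
  proof -
    have "(G0 has_field_derivative deriv G0 x) (at x)"
      using G0(1) x by (intro holomorphic_derivI) auto
    then have "((\<lambda>x. exp (G0 x)) has_field_derivative exp (G0 x) * deriv G0 x) (at x)"
      "(G has_field_derivative deriv G0 x) (at x)"
      unfolding G_def by (auto intro!: derivative_eq_intros)
    then have "deriv (\<lambda>x. exp (G0 x)) x = F x * deriv G0 x" "deriv G x = deriv G0 x"
      using G0(2)[of x] x by (auto dest!: DERIV_imp_deriv)
    moreover have "deriv (\<lambda>x. exp (G0 x)) x = deriv F x"
    proof (rule deriv_cong_ev)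
      have "\<forall>\<^sub>F y in nhds x. y \<in> ball 0 R" using x by (intro eventually_nhds_in_open) auto
      then show "\<forall>\<^sub>F y in nhds x. exp (G0 y) = F y" by eventually_elim (use G0 in auto)
    qed simp
    ultimately show ?thesis using Fnz[OF x] by (simp add: field_simps)
  qed
  have Re_G0: "Re (G0 x) = ln (norm (F x))" if "norm x < R" for x
    using G0(2)[of x] that by (metis dist_0_norm ln_exp mem_ball norm_exp_eq_Re)
  have Gle: "norm (G x) \<le> 2 * H" if x: "norm x \<le> R / 2" for x
  proof -
    have "Re (G0 y) < ln M + 1" if y: "norm y < R" for y
    proof -
      have "ln (norm (F y)) \<le> ln M" using le[OF y] Fnz[OF y] by (intro ln_mono) auto
      then show ?thesis using Re_G0[OF y] by simp
    qed
    then have "norm (G x) \<le> 2 * (ln M + 1 - Re (G0 0)) * norm x / (R - norm x)"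
      unfolding G_def using x R by (intro Borel_Caratheodory[OF G0(1) R(1)]) auto
    also have "Re (G0 0) = ln (norm (F 0))" using Re_G0[of 0] R by simp
    also have "2 * (ln M + 1 - ln (norm (F 0))) * norm x / (R - norm x)
        = 2 * (ln M + 1 - ln (norm (F 0))) * (norm x / (R - norm x))" by simp
    also have "\<dots> \<le> 2 * H * 1"
    proof (rule mult_mono)
      have "ln (norm (f 0)) \<le> ln (norm (F 0))" using F0' f(2) by (intro ln_mono) auto
      then show "2 * (ln M + 1 - ln (norm (F 0))) \<le> 2 * H" by (simp add: H_def)
      have "norm (f 0) \<le> M" using F0' le[of 0] R by simp
      then have "ln (norm (f 0)) \<le> ln M" using f(2) by (intro ln_mono) auto
      then show "0 \<le> 2 * H" by (simp add: H_def)
      show "norm x / (R - norm x) \<le> 1" "0 \<le> norm x / (R - norm x)" using x R by auto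
    qed
    finally show ?thesis by simp
  qed
  have dd: "norm (deriv (deriv G) w) \<le> 64 * H / R\<^sup>2" if w: "norm w \<le> R / 4" for w
  proof -
    have sub: "cball w (R / 4) \<subseteq> cball 0 (R / 2)"
    proof
      fix x assume "x \<in> cball w (R / 4)"
      then show "x \<in> cball 0 (R / 2)"
        using w norm_triangle_ineq[of w "x - w"] by (auto simp: dist_norm norm_minus_commute)
    qed
    also have "cball 0 (R / 2) \<subseteq> ball (0::complex) R" using R by auto
    finally have sub': "cball w (R / 4) \<subseteq> ball 0 R" "ball w (R / 4) \<subseteq> ball 0 R"
      using ball_subset_cball by (blast, blast)
    \<comment> \<open>Circles of radius R/4 about points with |w| <= R/4 stay in the half disc where
      |G| <= 2 H; the constant is 2! 2 H / (R/4)^2 = 64 H / R^2.\<close>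
    have "norm ((deriv ^^ 2) G w) \<le> fact 2 * (2 * H) / (R / 4) ^ 2"
    proof (rule Cauchy_inequality)
      show "G holomorphic_on ball w (R / 4)" "continuous_on (cball w (R / 4)) G"
        using G sub' by (auto intro: holomorphic_on_subset holomorphic_on_imp_continuous_on continuous_on_subset)
      show "norm (G x) \<le> 2 * H" if "norm (w - x) = R / 4" for x
      proof (rule Gle)
        have "x \<in> cball w (R / 4)" using that by (simp add: dist_norm)
        then have "x \<in> cball 0 (R / 2)" using sub by blast
        then show "norm x \<le> R / 2" by simp
      qed
    qed (use R in auto)
    then show ?thesis by (simp add: eval_nat_numeral power2_eq_square)
  qed
  have zR: "norm z \<le> R / 4" "norm z < R" using R by auto
  have 1: "norm (deriv G z - deriv G 0) \<le> 64 * H / R\<^sup>2 * norm (z - 0)"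
  proof (rule field_differentiable_bound[of "cball 0 (R / 4)" "deriv G" "deriv (deriv G)"])
    fix x :: complex assume x: "x \<in> cball 0 (R / 4)"
    have hol: "deriv G holomorphic_on ball 0 R" by (intro holomorphic_deriv G) auto
    have "x \<in> ball 0 R" using x R by auto
    from holomorphic_derivI[OF hol open_ball this]
    show "(deriv G has_field_derivative deriv (deriv G) x) (at x within cball 0 (R / 4))"
      by (rule has_field_derivative_at_within)
    show "norm (deriv (deriv G) x) \<le> 64 * H / R\<^sup>2" using x by (intro dd) auto
  qed (use zR R in auto)
  have 2: "norm (\<Sum>r\<in>Z. of_nat (m r) * (cnj r / (of_real (R\<^sup>2) - cnj r * z) - cnj r / of_real (R\<^sup>2)))
     \<le> (\<Sum>r\<in>Z. real (m r) * (2 * norm z / R\<^sup>2))"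
  proof (rule sum_norm_le)
    fix r assume r: "r \<in> Z"
    define u where "u = complex_of_real (R\<^sup>2) - cnj r * z"
    have "norm (cnj r * z) \<le> R * (R / 4)" unfolding norm_mult using nzr[OF r] zR R by (intro mult_mono) auto
    moreover have "norm (complex_of_real (R\<^sup>2)) = R * R" by (simp add: power2_eq_square norm_mult)
    ultimately have u: "R\<^sup>2 / 2 \<le> norm u"
      using norm_triangle_ineq2[of "complex_of_real (R\<^sup>2)" "cnj r * z"] unfolding u_def power2_eq_square
      using mult_pos_pos[OF R(1) R(1)] by linarith
    then have u0: "u \<noteq> 0" using R by auto
    have "cnj r / u - cnj r / of_real (R\<^sup>2) = cnj r * (of_real (R\<^sup>2) - u) / (u * of_real (R\<^sup>2))"
      using u0 R by (simp add: field_simps)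
    also have "of_real (R\<^sup>2) - u = cnj r * z" by (simp add: u_def)
    also have "norm (cnj r * (cnj r * z) / (u * of_real (R\<^sup>2))) = (norm r)\<^sup>2 * norm z / (norm u * R\<^sup>2)"
      by (simp add: norm_mult norm_divide power2_eq_square norm_power)
    also have "\<dots> \<le> R\<^sup>2 * norm z / (R\<^sup>2 / 2 * R\<^sup>2)"
      using u R nzr[OF r] by (intro frac_le mult_mono mult_right_mono power_mono) auto
    also have "\<dots> = 2 * norm z / R\<^sup>2" using R by (simp add: field_simps)
    finally have "real (m r) * norm (cnj r / u - cnj r / of_real (R\<^sup>2)) \<le> real (m r) * (2 * norm z / R\<^sup>2)"
      by (intro mult_left_mono) auto
    then show "norm (of_nat (m r) * (cnj r / (of_real (R\<^sup>2) - cnj r * z) - cnj r / of_real (R\<^sup>2)))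
      \<le> real (m r) * (2 * norm z / R\<^sup>2)"
      by (simp add: norm_mult u_def)
  qed
  have "deriv G z = deriv f z / f z
       - (\<Sum>r\<in>Z. of_nat (m r) * (1 / (z - r) + cnj r / (of_real (R\<^sup>2) - cnj r * z)))"
    by (rule trans[OF dG[OF zR(2)] ld[OF zR(2) fz]])
  moreover have "deriv G 0 = deriv f 0 / f 0
       - (\<Sum>r\<in>Z. of_nat (m r) * (1 / (0 - r) + cnj r / (of_real (R\<^sup>2) - cnj r * 0)))"
  proof -
    have n0: "norm (0::complex) < R" using R by simp
    show ?thesis by (rule trans[OF dG[OF n0] ld[OF n0 f(2)]])
  qed
  \<comment> \<open>Subtracting the value at 0 turns 1/(z - r) into 1/(z - r) + 1/r. The reflected
    points leave a difference that estimate 2 above bounds by 2 |z| / R^2 per zero.\<close>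
  moreover have "(\<Sum>r\<in>Z. of_nat (m r) * (1 / (z - r) + cnj r / (of_real (R\<^sup>2) - cnj r * z)))
    = (\<Sum>r\<in>Z. of_nat (m r) * (1 / (z - r) + 1 / r))
      + (\<Sum>r\<in>Z. of_nat (m r) * (1 / (0 - r) + cnj r / (of_real (R\<^sup>2) - cnj r * 0)))
      + (\<Sum>r\<in>Z. of_nat (m r) * (cnj r / (of_real (R\<^sup>2) - cnj r * z) - cnj r / of_real (R\<^sup>2)))"
    unfolding sum.distrib[symmetric]
    by (intro sum.cong) (simp_all add: distrib_left right_diff_distrib)
  ultimately have eq: "deriv f z / f z - deriv f 0 / f 0 - (\<Sum>r\<in>Z. of_nat (m r) * (1 / (z - r) + 1 / r))
    = (deriv G z - deriv G 0) +
      (\<Sum>r\<in>Z. of_nat (m r) * (cnj r / (of_real (R\<^sup>2) - cnj r * z) - cnj r / of_real (R\<^sup>2)))"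
    by simp
  have "norm (deriv f z / f z - deriv f 0 / f 0 - (\<Sum>r\<in>Z. of_nat (m r) * (1 / (z - r) + 1 / r)))
     \<le> 64 * H / R\<^sup>2 * norm (z - 0) + (\<Sum>r\<in>Z. real (m r) * (2 * norm z / R\<^sup>2))"
    unfolding eq by (rule norm_triangle_le[OF add_mono[OF 1 2]])
  also have "\<dots> = 64 * H * norm z / R\<^sup>2 + 2 * norm z * real (\<Sum>r\<in>Z. m r) / R\<^sup>2"
    unfolding sum_distrib_right[symmetric] by simp
  finally show ?thesis unfolding H_def .
qed

text \<open>Both log M(R) and, by \<open>zero_count\<close>, the number of zeros are O(R^p), so the
  error is O(R^(p - 2)). The limit is taken along growing discs; unordered convergence comes later,
  from a sign argument.\<close>

lemma logderiv_partial_fraction_tendsto: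
  fixes f :: "complex \<Rightarrow> complex"
  assumes f: "f holomorphic_on UNIV" "f 0 \<noteq> 0"
    and growth: "\<And>z. norm (f z) \<le> K * exp (norm z powr p)" and p: "0 \<le> p" "p < 2"
    and fz: "f z \<noteq> 0"
  defines "Z \<equiv> \<lambda>R. {r. f r = 0 \<and> norm r < R}" and "m \<equiv> \<lambda>r. nat (zorder f r)"
  shows "(\<lambda>n. \<Sum>r\<in>Z (real n). of_nat (m r) * (1 / (z - r) + 1 / r))
    \<longlonglongrightarrow> deriv f z / f z - deriv f 0 / f 0"
proof -
  have K: "K > 0"
  proof -
    have "0 < norm (f 0)" using f(2) by simp
    also have "\<dots> \<le> K * exp (norm (0::complex) powr p)" by (rule growth)
    finally show ?thesis by (simp add: zero_less_mult_iff)
  qed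
  define l where "l = ln K - ln (norm (f 0))"
  define E where "E = (\<lambda>R. 64 * (l + R powr p + 1) * norm z / R\<^sup>2
     + 2 * norm z * ((l + (2 * R) powr p) / ln 2) / R\<^sup>2)"
  have bound: "norm (deriv f z / f z - deriv f 0 / f 0 - (\<Sum>r\<in>Z R. of_nat (m r) * (1 / (z - r) + 1 / r))) \<le> E R"
    if R: "0 < R" "4 * norm z \<le> R" for R
  proof -
    have lnM: "ln (K * exp t) = ln K + t" for t using K by (simp add: ln_mult)
    have "norm (deriv f z / f z - deriv f 0 / f 0 - (\<Sum>r\<in>Z R. of_nat (m r) * (1 / (z - r) + 1 / r)))
      \<le> 64 * (ln (K * exp (R powr p)) + 1 - ln (norm (f 0))) * norm z / R\<^sup>2
        + 2 * norm z * real (\<Sum>r\<in>Z R. m r) / R\<^sup>2"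
      unfolding Z_def m_def
    proof (rule logderiv_partial_fraction_error[OF f R _ fz])
      show "norm (f w) \<le> K * exp (R powr p)" if "norm w = R" for w using growth[of w] that by simp
    qed
    also have "real (\<Sum>r\<in>Z R. m r) * ln 2 \<le> ln (K * exp ((2 * R) powr p)) - ln (norm (f 0))"
      unfolding Z_def m_def
    proof (rule zero_count[OF f R(1)])
      show "norm (f w) \<le> K * exp ((2 * R) powr p)" if "norm w = 2 * R" for w using growth[of w] that by simp
    qed
    then have "real (\<Sum>r\<in>Z R. m r) \<le> (l + (2 * R) powr p) / ln 2"
      by (simp add: lnM l_def pos_le_divide_eq)
    then have "2 * norm z * real (\<Sum>r\<in>Z R. m r) / R\<^sup>2 \<le> 2 * norm z * ((l + (2 * R) powr p) / ln 2) / R\<^sup>2"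
      by (intro divide_right_mono mult_left_mono) auto
    finally show ?thesis by (simp add: E_def lnM l_def algebra_simps)
  qed
  have "(\<lambda>n. E (real n)) \<longlonglongrightarrow> 0"
  proof -
    have 1: "(\<lambda>n. real n powr p / (real n)\<^sup>2) \<longlonglongrightarrow> 0"
      and 2: "(\<lambda>n. (2 * real n) powr p / (real n)\<^sup>2) \<longlonglongrightarrow> 0"
      and 3: "(\<lambda>n. 1 / (real n)\<^sup>2) \<longlonglongrightarrow> 0"
      using p by real_asymp+
    have "(\<lambda>n. 64 * norm z * (l + 1) * (1 / (real n)\<^sup>2) + 64 * norm z * (real n powr p / (real n)\<^sup>2)
      + 2 * norm z * l / ln 2 * (1 / (real n)\<^sup>2) + 2 * norm z / ln 2 * ((2 * real n) powr p / (real n)\<^sup>2))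
      \<longlonglongrightarrow> 64 * norm z * (l + 1) * 0 + 64 * norm z * 0 + 2 * norm z * l / ln 2 * 0 + 2 * norm z / ln 2 * 0"
      by (intro tendsto_add tendsto_mult_left 1 2 3)
    also have "(\<lambda>n. 64 * norm z * (l + 1) * (1 / (real n)\<^sup>2) + 64 * norm z * (real n powr p / (real n)\<^sup>2)
      + 2 * norm z * l / ln 2 * (1 / (real n)\<^sup>2) + 2 * norm z / ln 2 * ((2 * real n) powr p / (real n)\<^sup>2))
      = (\<lambda>n. E (real n))"
      by (rule ext) (simp add: E_def add_divide_distrib distrib_left distrib_right mult_ac)
    finally show ?thesis by simp
  qed
  then have "(\<lambda>n. deriv f z / f z - deriv f 0 / f 0
      - (\<Sum>r\<in>Z (real n). of_nat (m r) * (1 / (z - r) + 1 / r))) \<longlonglongrightarrow> 0"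
  proof (rule Lim_null_comparison[rotated])
    have "\<forall>\<^sub>F n in sequentially. n > 0 \<and> real n \<ge> 4 * norm z"
      by (intro eventually_conj eventually_gt_at_top filterlim_at_top[THEN iffD1, rule_format] filterlim_real_sequentially)
    then show "\<forall>\<^sub>F n in sequentially. norm (deriv f z / f z - deriv f 0 / f 0
      - (\<Sum>r\<in>Z (real n). of_nat (m r) * (1 / (z - r) + 1 / r))) \<le> E (real n)"
      by eventually_elim (intro bound, auto)
  qed
  from tendsto_diff[OF tendsto_const this, of "deriv f z / f z - deriv f 0 / f 0"]
  show ?thesis by simp
qed

text \<open>Since |s - w| >= Re s, the distance of w from s controls its distance from 1. The point
  1 can thus be the reference point for all sums over zeros.\<close>

lemma norm_one_minus_le:
  fixes s w :: complex
  assumes "0 < Re s" "Re w \<le> 0"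
  shows "norm (1 - w) \<le> (1 + norm (1 - s) / Re s) * norm (s - w)"
proof -
  have "Re s \<le> norm (s - w)" using complex_Re_le_cmod[of "s - w"] assms by simp
  then have "norm (1 - s) / Re s * Re s \<le> norm (1 - s) / Re s * norm (s - w)"
    using assms by (intro mult_left_mono) auto
  then have "norm (1 - s) \<le> norm (1 - s) / Re s * norm (s - w)" using assms by simp
  then show ?thesis using norm_triangle_ineq[of "1 - s" "s - w"] by (simp add: algebra_simps)
qed

text \<open>Each difference equals (t - s) / ((s - z)(t - z)), and both factors in the denominator
  are comparable to |1 - z|.\<close>

lemma summable_on_inverse_diff:
  fixes z :: "'i \<Rightarrow> complex" and m :: "'i \<Rightarrow> real"
  assumes m: "\<And>i. i \<in> I \<Longrightarrow> 0 \<le> m i" and z: "\<And>i. i \<in> I \<Longrightarrow> Re (z i) \<le> 0"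
    and sm: "(\<lambda>i. m i / (norm (1 - z i))\<^sup>2) summable_on I"
    and s: "0 < Re s" "0 < Re t"
  shows "(\<lambda>i. of_real (m i) * (1 / (s - z i) - 1 / (t - z i))) summable_on I"
proof -
  define k where "k = (\<lambda>s. 1 + norm (1 - s) / Re s)"
  have k: "k s > 0" if "0 < Re s" for s using that by (simp add: k_def add_pos_nonneg)
  have le: "norm (1 - z i) / k s \<le> norm (s - z i)" if "0 < Re s" "i \<in> I" for s i
    using norm_one_minus_le[OF that(1) z[OF that(2)]] k[OF that(1)]
    by (simp add: k_def field_simps)
  have 1: "(\<lambda>i. norm (t - s) * k s * k t * (m i / (norm (1 - z i))\<^sup>2)) summable_on I"
    by (intro summable_on_cmult_right sm)
  have 2: "norm (of_real (m i) * (1 / (s - z i) - 1 / (t - z i)))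
    \<le> norm (t - s) * k s * k t * (m i / (norm (1 - z i))\<^sup>2)" if i: "i \<in> I" for i
  proof -
  have nz: "s - z i \<noteq> 0" "t - z i \<noteq> 0" "1 - z i \<noteq> 0"
    using s z[OF i] by (auto simp: complex_eq_iff)
  have "1 / (s - z i) - 1 / (t - z i) = (t - s) / ((s - z i) * (t - z i))"
    using nz by (simp add: field_simps)
  then have "norm (of_real (m i) * (1 / (s - z i) - 1 / (t - z i))) =
      m i * (norm (t - s) / (norm (s - z i) * norm (t - z i)))"
    using m[OF i] by (simp add: norm_mult norm_divide)
  also have "\<dots> \<le> m i * (norm (t - s) / (norm (1 - z i) / k s * (norm (1 - z i) / k t)))"
    using nz m[OF i] k[OF s(1)] k[OF s(2)] le[OF s(1) i] le[OF s(2) i]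
    by (intro mult_left_mono divide_left_mono mult_mono mult_pos_pos divide_nonneg_pos) auto
  also have "\<dots> = norm (t - s) * k s * k t * (m i / (norm (1 - z i))\<^sup>2)"
    by (simp add: power2_eq_square)
  finally show ?thesis .
  qed
  show ?thesis
    by (rule abs_summable_summable[OF Infinite_Sum.abs_summable_on_comparison_test'[OF 1 2]])
qed

text \<open>On the positive real axis all terms of the real part have the same sign; this gives the
  convergence of the sum over the zeros.\<close>

lemma
  fixes f :: "complex \<Rightarrow> complex"
  assumes f: "f holomorphic_on UNIV" "f 0 \<noteq> 0"
    and growth: "\<And>z. norm (f z) \<le> K * exp (norm z powr p)" and p: "0 \<le> p" "p < 2"
    and zeros: "\<And>r. f r = 0 \<Longrightarrow> Re r = 0"
  defines "Z \<equiv> {r. f r = 0}" and "m \<equiv> \<lambda>r. real (nat (zorder f r))"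
  shows imaginary_zeros_Re_logderiv: "\<And>y. 0 < y \<Longrightarrow>
      ((\<lambda>r. m r * y / (y\<^sup>2 + (norm r)\<^sup>2)) has_sum
        Re (deriv f (of_real y) / f (of_real y)) - Re (deriv f 0 / f 0)) Z" (is "\<And>y. _ \<Longrightarrow> ?A y")
    and imaginary_zeros_logderiv: "\<And>s t. 0 < Re s \<Longrightarrow> 0 < Re t \<Longrightarrow>
      ((\<lambda>r. of_real (m r) * (1 / (s - r) - 1 / (t - r))) has_sum
        deriv f s / f s - deriv f t / f t) Z"
    and imaginary_zeros_summable: "(\<lambda>r. m r / (norm (1 - r))\<^sup>2) summable_on Z"
proof -
  define Zn where "Zn = (\<lambda>n. {r. f r = 0 \<and> norm r < real n})"
  have fin: "finite (Zn n)" for n unfolding Zn_def by (rule finite_zeros_ball[OF f])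
  have lim: "(\<lambda>n. \<Sum>r\<in>Zn n. of_real (m r) * (1 / (s - r) + 1 / r))
      \<longlonglongrightarrow> deriv f s / f s - deriv f 0 / f 0" if "0 < Re s" for s
  proof -
    have "f s \<noteq> 0" using zeros[of s] that by auto
    from logderiv_partial_fraction_tendsto[OF f growth p this]
    show ?thesis by (simp add: Zn_def m_def)
  qed
  have Zn: "\<forall>\<^sub>F n in sequentially. F \<subseteq> Zn n" if F: "finite F" "F \<subseteq> Z" for F
  proof -
    obtain B where B: "\<And>r. r \<in> F \<Longrightarrow> norm r \<le> B"
      using finite_imp_bounded[OF F(1)] by (auto simp: bounded_iff)
    obtain N where N: "B < real N" using reals_Archimedean2 by blast
    have "\<forall>\<^sub>F n in sequentially. N \<le> n" by (rule eventually_ge_at_top)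
    then show ?thesis
    proof eventually_elim
      case (elim n)
      show ?case
      proof
        fix r assume r: "r \<in> F"
        then have "norm r < real n" using B[OF r] N elim by linarith
        then show "r \<in> Zn n" using r F(2) by (auto simp: Zn_def Z_def)
      qed
    qed
  qed
  \<comment> \<open>The discs eventually contain every finite set of zeros. Once a sum over Z is
    known to converge unordered, its value is therefore the limit along the discs.\<close>
  have lim_finite_subsets: "filterlim Zn (finite_subsets_at_top Z) sequentially"
    unfolding filterlim_finite_subsets_at_top
  proof safe
    fix F assume "finite F" "F \<subseteq> Z"
    from Zn[OF this] show "\<forall>\<^sub>F n in sequentially. finite (Zn n) \<and> F \<subseteq> Zn n \<and> Zn n \<subseteq> Z"
      by eventually_elim (use fin in \<open>auto simp: Zn_def Z_def\<close>)
  qed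
  have m: "0 \<le> m r" for r by (simp add: m_def)
  have Re0: "Re r = 0" if "r \<in> Z" for r using that zeros by (simp add: Z_def)
  show A: "?A y" if y: "0 < y" for y
  proof -
    define T where "T = (\<lambda>r. m r * y / (y\<^sup>2 + (norm r)\<^sup>2))"
    define l where "l = Re (deriv f (of_real y) / f (of_real y) - deriv f 0 / f 0)"
    \<comment> \<open>The zeros are purely imaginary, so 1/r has real part 0 and |y - r|^2 = y^2 +
      |r|^2.\<close>
    have ReT: "Re (of_real (m r) * (1 / (of_real y - r) + 1 / r)) = T r" if "r \<in> Z" for r
      using Re0[OF that] y
      by (simp add: T_def Re_divide Im_divide cmod_power2)
    have "(\<lambda>n. Re (\<Sum>r\<in>Zn n. of_real (m r) * (1 / (of_real y - r) + 1 / r))) \<longlonglongrightarrow> l"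
      unfolding l_def using y by (intro tendsto_Re lim) simp
    moreover have "Re (\<Sum>r\<in>Zn n. of_real (m r) * (1 / (of_real y - r) + 1 / r)) = sum T (Zn n)" for n
      unfolding Re_sum by (intro sum.cong ReT) (auto simp: Zn_def Z_def)
    ultimately have Tl: "(\<lambda>n. sum T (Zn n)) \<longlonglongrightarrow> l" by simp
    have T0: "0 \<le> T r" for r using y m[of r] by (simp add: T_def)
    have Fl: "sum T F \<le> l" if F: "finite F" "F \<subseteq> Z" for F
    proof (rule tendsto_lowerbound[OF Tl])
      show "\<forall>\<^sub>F n in sequentially. sum T F \<le> sum T (Zn n)"
        using Zn[OF F] by eventually_elim (intro sum_mono2 fin, auto intro: T0)
    qed simp
    have "T summable_on Z"
      using Fl by (intro nonneg_bdd_above_summable_on T0 bdd_aboveI[of _ l]) auto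
    then have hs: "(T has_sum infsum T Z) Z" by simp
    then have "(\<lambda>n. sum T (Zn n)) \<longlonglongrightarrow> infsum T Z"
      unfolding has_sum_def by (rule filterlim_compose[OF _ lim_finite_subsets])
    then have "infsum T Z = l" using Tl LIMSEQ_unique by blast
    then show ?thesis using hs by (simp add: T_def l_def)
  qed
  have "(\<lambda>r. m r * 1 / (1\<^sup>2 + (norm r)\<^sup>2)) summable_on Z"
    using A[of 1] by (intro has_sum_imp_summable) auto
  then show sm: "(\<lambda>r. m r / (norm (1 - r))\<^sup>2) summable_on Z"
  proof (rule summable_on_cong[THEN iffD1, rotated])
    show "m r * 1 / (1\<^sup>2 + (norm r)\<^sup>2) = m r / (norm (1 - r))\<^sup>2" if "r \<in> Z" for r
    proof -
      have "(norm (1 - r))\<^sup>2 = 1\<^sup>2 + (norm r)\<^sup>2" using Re0[OF that] by (simp add: cmod_power2)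
      then show ?thesis by simp
    qed
  qed
  show "((\<lambda>r. of_real (m r) * (1 / (s - r) - 1 / (t - r))) has_sum deriv f s / f s - deriv f t / f t) Z"
    if st: "0 < Re s" "0 < Re t" for s t
  proof -
    define T where "T = (\<lambda>r. of_real (m r) * (1 / (s - r) - 1 / (t - r)))"
    have "T summable_on Z" unfolding T_def
      using summable_on_inverse_diff[of Z m "\<lambda>r. r" s t] m Re0 sm st by simp
    then have hs: "(T has_sum infsum T Z) Z" by simp
    then have 1: "(\<lambda>n. sum T (Zn n)) \<longlonglongrightarrow> infsum T Z"
      unfolding has_sum_def by (rule filterlim_compose[OF _ lim_finite_subsets])
    have "(\<lambda>n. (\<Sum>r\<in>Zn n. of_real (m r) * (1 / (s - r) + 1 / r)) - (\<Sum>r\<in>Zn n. of_real (m r) * (1 / (t - r) + 1 / r)))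
       \<longlonglongrightarrow> (deriv f s / f s - deriv f 0 / f 0) - (deriv f t / f t - deriv f 0 / f 0)"
      by (intro tendsto_diff lim st)
    moreover have "(\<Sum>r\<in>Zn n. of_real (m r) * (1 / (s - r) + 1 / r)) - (\<Sum>r\<in>Zn n. of_real (m r) * (1 / (t - r) + 1 / r))
        = sum T (Zn n)" for n
      unfolding sum_subtractf[symmetric] T_def by (intro sum.cong) (auto simp: algebra_simps)
    ultimately have "(\<lambda>n. sum T (Zn n)) \<longlonglongrightarrow> deriv f s / f s - deriv f t / f t" by simp
    then have "infsum T Z = deriv f s / f s - deriv f t / f t" using 1 LIMSEQ_unique by blast
    then show ?thesis using hs by (simp add: T_def)
  qed
qed

section \<open>The explicit formula\<close>

text \<open>Weierstrass' theorem for unordered sums: the M-test gives uniform convergence along the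
  filter of finite subsets, and derivatives of holomorphic functions pass to such a limit.\<close>

lemma has_sum_deriv_holomorphic:
  fixes g :: "'i \<Rightarrow> complex \<Rightarrow> complex"
  assumes S: "open S" and g: "\<And>i. i \<in> I \<Longrightarrow> g i holomorphic_on S"
    and M: "\<And>i s. i \<in> I \<Longrightarrow> s \<in> S \<Longrightarrow> norm (g i s) \<le> M i" "M summable_on I"
    and G: "\<And>s. s \<in> S \<Longrightarrow> ((\<lambda>i. g i s) has_sum G s) I" and s: "s \<in> S"
  shows "((\<lambda>i. deriv (g i) s) has_sum deriv G s) I" "G field_differentiable at s"
proof -
  obtain r where r: "r > 0" "cball s r \<subseteq> S"
    using S s open_contains_cball by blast
  let ?F = "finite_subsets_at_top I"
  have ev: "\<forall>\<^sub>F F in ?F. continuous_on (cball s r) (\<lambda>w. \<Sum>i\<in>F. g i w) \<and>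
     (\<forall>w \<in> ball s r. ((\<lambda>w. \<Sum>i\<in>F. g i w) has_field_derivative (\<Sum>i\<in>F. deriv (g i) w)) (at w))"
  proof (rule eventually_finite_subsets_at_top_weakI, intro conjI ballI)
    fix F assume F: "finite F" "F \<subseteq> I"
    show "continuous_on (cball s r) (\<lambda>w. \<Sum>i\<in>F. g i w)"
      using F by (intro continuous_on_sum holomorphic_on_imp_continuous_on holomorphic_on_subset[OF g r(2)]) auto
    fix w assume "w \<in> ball s r"
    then have "w \<in> S" using r by auto
    then show "((\<lambda>w. \<Sum>i\<in>F. g i w) has_field_derivative (\<Sum>i\<in>F. deriv (g i) w)) (at w)"
      using F g S by (intro DERIV_sum holomorphic_derivI) auto
  qed
  have ul: "uniform_limit (cball s r) (\<lambda>F w. \<Sum>i\<in>F. g i w) G ?F"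
    by (rule Weierstrass_m_test_general'[OF _ _ M(2)]) (use M(1) G r in auto)
  obtain g' where g': "\<And>w. w \<in> ball s r \<Longrightarrow>
      (G has_field_derivative (g' w)) (at w) \<and> ((\<lambda>F. \<Sum>i\<in>F. deriv (g i) w) \<longlongrightarrow> g' w) ?F"
    using has_complex_derivative_uniform_limit[OF ev ul finite_subsets_at_top_neq_bot r(1)] by blast
  have "s \<in> ball s r" using r by simp
  from g'[OF this] show "((\<lambda>i. deriv (g i) s) has_sum deriv G s) I" "G field_differentiable at s"
    unfolding has_sum_def by (auto dest: DERIV_imp_deriv simp: field_differentiable_def)
qed

lemma has_sum_integral:
  fixes f :: "'i \<Rightarrow> real \<Rightarrow> complex"
  assumes c: "\<And>i. i \<in> I \<Longrightarrow> continuous_on {a..b} (f i)"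
    and M: "\<And>i t. i \<in> I \<Longrightarrow> t \<in> {a..b} \<Longrightarrow> norm (f i t) \<le> M i" "M summable_on I"
    and g: "\<And>t. t \<in> {a..b} \<Longrightarrow> ((\<lambda>i. f i t) has_sum g t) I"
    and J: "\<And>i. i \<in> I \<Longrightarrow> (f i has_integral J i) {a..b}"
  shows "continuous_on {a..b} g" "\<exists>K. (g has_integral K) {a..b} \<and> (J has_sum K) I"
proof -
  let ?F = "finite_subsets_at_top I"
  have ul: "uniform_limit {a..b} (\<lambda>F t. \<Sum>i\<in>F. f i t) g ?F"
    by (rule Weierstrass_m_test_general'[OF _ _ M(2)]) (use M(1) g in auto)
  have fin: "\<forall>\<^sub>F F in ?F. finite F \<and> F \<subseteq> I" by (rule eventually_finite_subsets_at_top_weakI) simp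
  then have "\<forall>\<^sub>F F in ?F. continuous_on {a..b} (\<lambda>t. \<Sum>i\<in>F. f i t)"
    by eventually_elim (intro continuous_intros c, auto)
  from uniform_limit_theorem[OF this ul] show "continuous_on {a..b} g" by simp
  \<comment> \<open>\<open>uniform_limit_integral\<close> is applied with continuity at every index,
    so sets that are not finite subsets of I are assigned the zero function.\<close>
  define f' where "f' = (\<lambda>F. if finite F \<and> F \<subseteq> I then (\<lambda>t. \<Sum>i\<in>F. f i t) else (\<lambda>_. 0))"
  have ul': "uniform_limit {a..b} f' g ?F"
    by (rule uniform_limit_cong[THEN iffD1, OF _ _ ul])
       (use fin in \<open>auto elim!: eventually_mono simp: f'_def\<close>)
  have cont: "continuous_on {a..b} (f' F)" for F
    by (auto simp: f'_def intro!: continuous_intros c)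
  obtain IF K where IF: "\<And>F. (f' F has_integral IF F) {a..b}" "(g has_integral K) {a..b}" "(IF \<longlongrightarrow> K) ?F"
    using uniform_limit_integral[OF ul' cont] by auto
  have "\<forall>\<^sub>F F in ?F. IF F = (\<Sum>i\<in>F. J i)"
    using fin
  proof eventually_elim
    case (elim F)
    then have "(f' F has_integral (\<Sum>i\<in>F. J i)) {a..b}"
      unfolding f'_def by (auto intro!: has_integral_sum J)
    then show ?case using IF(1)[of F] has_integral_unique by blast
  qed
  then have "(J has_sum K) I" unfolding has_sum_def using IF(3) by (rule Lim_transform_eventually[rotated])
  then show "\<exists>K. (g has_integral K) {a..b} \<and> (J has_sum K) I" using IF(2) by blast
qed

section \<open>Moments on the unit interval\<close>

lemma moments_zero_imp_zero_real:
  fixes h :: "real \<Rightarrow> real"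
  assumes h: "continuous_on {0..1} h" and mom: "\<And>k::nat. ((\<lambda>t. t ^ k * h t) has_integral 0) {0..1}"
    and t: "t \<in> {0..1}"
  shows "h t = 0"
proof -
  obtain B where B: "B > 0" "\<And>t. t \<in> {0..1} \<Longrightarrow> \<bar>h t\<bar> \<le> B"
    using compact_imp_bounded[OF compact_continuous_image[OF h compact_Icc]]
    by (auto simp: bounded_pos)
  have h2: "continuous_on {0..1} (\<lambda>t. (h t)\<^sup>2)" by (intro continuous_intros h)
  then have int2: "((\<lambda>t. (h t)\<^sup>2) has_integral integral {0..1} (\<lambda>t. (h t)\<^sup>2)) {0..1}"
    using integrable_continuous_real by blast
  \<comment> \<open>As h is orthogonal to all polynomials q, the integral of h^2 equals that of (h -
    q) h, which is small when q approximates h uniformly.\<close>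
  have le: "integral {0..1} (\<lambda>t. (h t)\<^sup>2) \<le> 0"
  proof (rule field_le_epsilon)
    fix e :: real assume e: "e > 0"
    obtain q where q: "real_polynomial_function q" "\<And>t. t \<in> {0..1} \<Longrightarrow> \<bar>h t - q t\<bar> < e / B"
      using Stone_Weierstrass_real_polynomial_function[OF compact_Icc h, of "e / B"] e B by auto
    obtain a n where "q = (\<lambda>x. \<Sum>i\<le>n. a i * x ^ i)" using q(1) by (auto simp: real_polynomial_function_iff_sum)
    then have "(\<lambda>t. q t * h t) = (\<lambda>t. \<Sum>i\<le>n. a i * (t ^ i * h t))"
      by (auto simp: sum_distrib_left sum_distrib_right mult_ac)
    moreover have "((\<lambda>t. \<Sum>i\<le>n. a i * (t ^ i * h t)) has_integral (\<Sum>i\<le>n. a i * 0)) {0..1}"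
      by (intro has_integral_sum has_integral_mult_right mom) auto
    ultimately have "((\<lambda>t. q t * h t) has_integral 0) {0..1}" by simp
    from has_integral_diff[OF int2 this]
    have "((\<lambda>t. (h t - q t) * h t) has_integral integral {0..1} (\<lambda>t. (h t)\<^sup>2)) {0..1}"
      by (simp add: algebra_simps power2_eq_square)
    moreover have "((\<lambda>t. e) has_integral e) {0..1::real}" using has_integral_const_real[of e 0 1] by simp
    ultimately show "integral {0..1} (\<lambda>t. (h t)\<^sup>2) \<le> 0 + e"
    proof (rule has_integral_le[THEN order_trans])
      fix t :: real assume t: "t \<in> {0..1}"
      have "\<bar>(h t - q t) * h t\<bar> \<le> e / B * B" unfolding abs_mult
        using q(2)[OF t] B(1) B(2)[OF t] e by (intro mult_mono) auto
      then show "(h t - q t) * h t \<le> e" using B by simp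
    qed simp
  qed
  moreover have "0 \<le> integral {0..1} (\<lambda>t. (h t)\<^sup>2)" by (rule has_integral_nonneg[OF int2]) simp
  ultimately have "((\<lambda>t. (h t)\<^sup>2) has_integral 0) (cbox 0 1)" using int2 by simp
  then have "(h t)\<^sup>2 = 0"
    using t h2 by (intro has_integral_0_cbox_imp_0[of 0 1 "\<lambda>t. (h t)\<^sup>2"]) auto
  then show ?thesis by simp
qed

lemma moments_zero_imp_zero:
  fixes h :: "real \<Rightarrow> complex"
  assumes h: "continuous_on {0..1} h" and mom: "\<And>k::nat. ((\<lambda>t. of_real t ^ k * h t) has_integral 0) {0..1}"
    and t: "t \<in> {0..1}"
  shows "h t = 0"
proof -
  have "((\<lambda>t. Re (of_real t ^ k * h t)) has_integral 0) {0..1}" "((\<lambda>t. Im (of_real t ^ k * h t)) has_integral 0) {0..1}" for k :: nat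
    using has_integral_Re[OF mom[of k]] has_integral_Im[OF mom[of k]] by simp_all
  then have mm: "((\<lambda>t. t ^ k * Re (h t)) has_integral 0) {0..1}" "((\<lambda>t. t ^ k * Im (h t)) has_integral 0) {0..1}" for k :: nat
    by (simp_all flip: of_real_power)
  have "Re (h t) = 0" by (rule moments_zero_imp_zero_real[OF _ mm(1) t]) (intro continuous_intros h)
  moreover have "Im (h t) = 0" by (rule moments_zero_imp_zero_real[OF _ mm(2) t]) (intro continuous_intros h)
  ultimately show ?thesis by (simp add: complex_eq_iff)
qed

lemma has_integral_of_real_powr:
  fixes q :: complex
  assumes q: "0 < Re q"
  shows "((\<lambda>t. of_real t ^ k * of_real t powr q) has_integral 1 / (of_nat k + 1 + q)) {0..1}"
proof -
  define r where "r = of_nat k + 1 + q"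
  have r: "0 < Re r" "r \<noteq> 0" using q by (auto simp: r_def complex_eq_iff)
  define \<Phi> where "\<Phi> = (\<lambda>t. of_real t powr r / r)"
  have "((\<lambda>t. of_real t ^ k * of_real t powr q) has_integral (\<Phi> 1 - \<Phi> 0)) {0..1}"
  proof (rule fundamental_theorem_of_calculus_interior)
    show "continuous_on {0..1} \<Phi>" unfolding \<Phi>_def using r
      by (intro continuous_intros) auto
    fix t :: real assume t: "t \<in> {0<..<1}"
    have "((\<lambda>z. z powr r / r) has_field_derivative (r * of_real t powr (r - 1)) / r) (at (of_real t))"
      using t by (intro DERIV_cdivide has_field_derivative_powr) (auto simp: complex_nonpos_Reals_iff)
    from has_vector_derivative_real_field[OF this]
    have "(\<Phi> has_vector_derivative of_real t powr (r - 1)) (at t)"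
      using r by (simp add: \<Phi>_def)
    moreover have "of_real t powr (r - 1) = of_real t ^ k * of_real t powr q"
    proof -
      have "of_real t powr (r - 1) = complex_of_real t powr (of_nat k + q)" by (simp add: r_def)
      then show ?thesis using t by (simp add: powr_add powr_nat')
    qed
    ultimately show "(\<Phi> has_vector_derivative of_real t ^ k * of_real t powr q) (at t)" by simp
  qed simp
  then show ?thesis using r by (simp add: \<Phi>_def r_def)
qed

text \<open>With t = e^-T this is the Laplace transform at k + 2 of the positive part of ln n - T.
  The integrand vanishes for t <= 1/n, hence the split there.\<close>

lemma has_integral_ln_max:
  fixes n :: nat
  assumes n: "1 \<le> n"
  shows "((\<lambda>t. t ^ k * (t * ln (max 1 (real n * t)))) has_integral
     (ln (real n) / real (k + 2) - (1 - 1 / real n ^ (k + 2)) / (real (k + 2))\<^sup>2)) {0..1}"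
proof -
  define p where "p = k + 2"
  have p: "real p \<noteq> 0" by (simp add: p_def)
  define w where "w = (\<lambda>t. t ^ k * (t * ln (max 1 (real n * t))))"
  define \<Phi> where "\<Phi> = (\<lambda>t. t ^ p * ln (real n * t) / real p - t ^ p / (real p)\<^sup>2)"
  have n0: "0 < 1 / real n" "1 / real n \<le> 1" using n by auto
  have "(w has_integral 0) {0..1 / real n}"
  proof (rule has_integral_spike_eq[THEN iffD1, OF negligible_empty _ has_integral_0])
    fix t assume "t \<in> {0..1 / real n} - {}"
    then have "max 1 (real n * t) = 1" using n by (auto simp: field_simps max_def)
    then show "w t = 0" by (simp add: w_def)
  qed
  moreover have "(w has_integral (\<Phi> 1 - \<Phi> (1 / real n))) {1 / real n..1}"
  proof (rule fundamental_theorem_of_calculus_interior)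
    show "continuous_on {1 / real n..1} \<Phi>" unfolding \<Phi>_def using n n0 p
      by (intro continuous_intros) auto
    fix t :: real assume t: "t \<in> {1 / real n<..<1}"
    then have t': "0 < t" using n0 less_trans by (metis greaterThanLessThan_iff)
    have t'': "1 < real n * t" using t n by (simp add: field_simps)
    have "(\<Phi> has_real_derivative ((real p * t ^ (p - 1) * ln (real n * t) + real n / (real n * t) * t ^ p) / real p
        - real p * t ^ (p - 1) / (real p)\<^sup>2)) (at t)"
      unfolding \<Phi>_def using t' t'' p n
      by (auto intro!: derivative_eq_intros) (simp add: divide_simps eval_nat_numeral)
    moreover have "(real p * t ^ (p - 1) * ln (real n * t) + real n / (real n * t) * t ^ p) / real p
        - real p * t ^ (p - 1) / (real p)\<^sup>2 = w t"
    proof -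
      have "t ^ p = t ^ (p - 1) * t" "t ^ (p - 1) = t ^ k * t" by (simp_all add: p_def)
      then show ?thesis using t' t'' n p by (simp add: w_def max_def field_simps power2_eq_square)
    qed
    ultimately show "(\<Phi> has_vector_derivative w t) (at t)" by (simp add: has_real_derivative_iff_has_vector_derivative)
  qed (use n0 in auto)
  ultimately have "(w has_integral 0 + (\<Phi> 1 - \<Phi> (1 / real n))) {0..1}"
    using n0 by (intro has_integral_combine[of 0 "1 / real n" 1]) auto
  moreover have "0 + (\<Phi> 1 - \<Phi> (1 / real n)) = ln (real n) / real p - (1 - 1 / real n ^ p) / (real p)\<^sup>2"
    using n by (simp add: \<Phi>_def power_divide diff_divide_distrib)
  ultimately show ?thesis by (simp add: w_def p_def)
qed

text \<open>In the locale below, \<open>D\<close> stands for \<open>- L'/L\<close> as a function of \<open>w\<close> with \<open>s = 1/2 + w\<close>, and the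
  \<open>z\<^sub>i\<close> with multiplicities \<open>m\<^sub>i\<close> are the zeros of \<open>L\<close>, trivial and non-trivial, shifted by \<open>- 1/2\<close>.\<close>

locale zeros_and_dirichlet =
  fixes I :: "'i set" and m :: "'i \<Rightarrow> real" and z :: "'i \<Rightarrow> complex"
    and D :: "complex \<Rightarrow> complex" and b :: "nat \<Rightarrow> complex" and c :: real
  assumes m_nonneg: "\<And>i. i \<in> I \<Longrightarrow> 0 \<le> m i"
    and Re_z: "\<And>i. i \<in> I \<Longrightarrow> Re (z i) \<le> 0"
    and summable: "(\<lambda>i. m i / (norm (1 - z i))\<^sup>2) summable_on I"
    and D_diff: "\<And>s t. 0 < Re s \<Longrightarrow> 0 < Re t \<Longrightarrow>
       ((\<lambda>i. of_real (m i) * (1 / (t - z i) - 1 / (s - z i))) has_sum (D s - D t)) I"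
    and c_nonneg: "0 \<le> c"
    and D_dirichlet: "\<And>s. c < Re s \<Longrightarrow> ((\<lambda>n. b n / of_nat n powr s) has_sum D s) {1..}"
begin

lemma z_neq: "0 < Re s \<Longrightarrow> i \<in> I \<Longrightarrow> s - z i \<noteq> 0"
  using Re_z[of i] by (auto simp: complex_eq_iff)

text \<open>One constant K for a whole ball about \<open>s0\<close>, which provides the majorants
  for the M-test there.\<close>

lemma local_bound:
  assumes "0 < Re s0"
  obtains K where "K > 0"
    "\<And>i s. i \<in> I \<Longrightarrow> s \<in> ball s0 (Re s0 / 2) \<Longrightarrow> 0 < Re s \<and> norm (1 - z i) \<le> K * norm (s - z i)"
proof
  define r where "r = Re s0 / 2"
  define K where "K = 1 + (norm (1 - s0) + r) / r"
  have r: "r > 0" using assms by (simp add: r_def)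
  show "K > 0" using r by (simp add: K_def add_pos_nonneg)
  fix i s assume i: "i \<in> I" and s: "s \<in> ball s0 (Re s0 / 2)"
  have d: "norm (s0 - s) < r" using s by (simp add: dist_norm r_def)
  have "\<bar>Re (s0 - s)\<bar> \<le> norm (s0 - s)" by (rule abs_Re_le_cmod)
  then have Re: "r \<le> Re s" using d unfolding r_def by auto
  have "norm (1 - s) \<le> norm (1 - s0) + r"
    using norm_triangle_ineq[of "1 - s0" "s0 - s"] d by simp
  then have "1 + norm (1 - s) / Re s \<le> K" unfolding K_def using Re r
    by (intro add_left_mono frac_le) auto
  then have "(1 + norm (1 - s) / Re s) * norm (s - z i) \<le> K * norm (s - z i)"
    by (rule mult_right_mono) simp
  moreover have "norm (1 - z i) \<le> (1 + norm (1 - s) / Re s) * norm (s - z i)"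
    using norm_one_minus_le[of s "z i"] Re r Re_z[OF i] by simp
  ultimately show "0 < Re s \<and> norm (1 - z i) \<le> K * norm (s - z i)" using Re r by linarith
qed

lemma inverse_square_summable:
  assumes "0 < Re s"
  shows "(\<lambda>i. m i / (norm (s - z i))\<^sup>2) summable_on I"
proof -
  obtain K where K: "K > 0" "\<And>i. i \<in> I \<Longrightarrow> norm (1 - z i) \<le> K * norm (s - z i)"
    using local_bound[OF assms] assms by (metis centre_in_ball half_gt_zero)
  have 1: "(\<lambda>i. K\<^sup>2 * (m i / (norm (1 - z i))\<^sup>2)) summable_on I"
    by (intro summable_on_cmult_right summable)
  have 2: "norm (m i / (norm (s - z i))\<^sup>2) \<le> K\<^sup>2 * (m i / (norm (1 - z i))\<^sup>2)" if i: "i \<in> I" for i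
  proof -
    have nz: "s - z i \<noteq> 0" "1 - z i \<noteq> 0" using z_neq[OF assms i] z_neq[of 1 i] i by auto
    have "(norm (1 - z i))\<^sup>2 \<le> (K * norm (s - z i))\<^sup>2" using K(2)[OF i] by (intro power_mono) auto
    then have "1 / (norm (s - z i))\<^sup>2 \<le> K\<^sup>2 / (norm (1 - z i))\<^sup>2"
      using nz by (simp add: field_simps power_mult_distrib)
    then have "m i * (1 / (norm (s - z i))\<^sup>2) \<le> m i * (K\<^sup>2 / (norm (1 - z i))\<^sup>2)"
      using m_nonneg[OF i] by (rule mult_left_mono)
    then show ?thesis using m_nonneg[OF i] by (simp add: mult.commute)
  qed
  show ?thesis
    by (rule abs_summable_summable[OF Infinite_Sum.abs_summable_on_comparison_test'[OF 1 2]])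
qed

text \<open>Termwise differentiation of \<open>D_diff\<close> with one of the two points fixed. Only
  differences of D are expanded over the zeros, because the sum of 1/(s - z) alone need not converge
  absolutely.\<close>

lemma D_deriv:
  assumes s: "0 < Re s"
  shows "((\<lambda>i. of_real (m i) / (s - z i)\<^sup>2) has_sum deriv D s) I" "D field_differentiable at s"
proof -
  define r where "r = Re s / 2"
  obtain K where K: "K > 0"
    "\<And>i t. i \<in> I \<Longrightarrow> t \<in> ball s r \<Longrightarrow> 0 < Re t \<and> norm (1 - z i) \<le> K * norm (t - z i)"
    using local_bound[OF s] unfolding r_def by blast
  have sr: "s \<in> ball s r" using s by (simp add: r_def)
  have Ret: "0 < Re t" if "t \<in> ball s r" for t
  proof -
    have "\<bar>Re (s - t)\<bar> \<le> norm (s - t)" by (rule abs_Re_le_cmod)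
    then show ?thesis using that s unfolding r_def by (auto simp: dist_norm)
  qed
  define g where "g = (\<lambda>i t. of_real (m i) * (1 / (s - z i) - 1 / (t - z i)))"
  have dg: "(g i has_field_derivative of_real (m i) / (t - z i)\<^sup>2) (at t)" if "i \<in> I" "t \<in> ball s r" for i t
    unfolding g_def using z_neq[OF Ret[OF that(2)] that(1)]
    by (auto intro!: derivative_eq_intros simp: power2_eq_square)
  have M: "norm (g i t) \<le> r * K * K * (m i / (norm (1 - z i))\<^sup>2)" if i: "i \<in> I" and t: "t \<in> ball s r" for i t
  proof -
    have nz: "s - z i \<noteq> 0" "t - z i \<noteq> 0" "1 - z i \<noteq> 0"
      using z_neq[OF s i] z_neq[OF Ret[OF t] i] z_neq[of 1 i] i by auto
    have "1 / (s - z i) - 1 / (t - z i) = (t - s) / ((s - z i) * (t - z i))"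
      using nz by (simp add: field_simps)
    then have "norm (g i t) = m i * (norm (t - s) / (norm (s - z i) * norm (t - z i)))"
      using m_nonneg[OF i] by (simp add: g_def norm_mult norm_divide)
    also have "\<dots> \<le> m i * (r / (norm (1 - z i) / K * (norm (1 - z i) / K)))"
    proof -
      have "norm (1 - z i) / K \<le> norm (s - z i)" "norm (1 - z i) / K \<le> norm (t - z i)"
        using K(2)[OF i sr] K(2)[OF i t] K(1) by (auto simp: field_simps)
      moreover have "norm (t - s) \<le> r" using t by (simp add: dist_norm norm_minus_commute)
      moreover have "0 \<le> r" using s by (simp add: r_def)
      ultimately show ?thesis using nz m_nonneg[OF i] K(1)
        by (intro mult_left_mono frac_le mult_mono mult_pos_pos) auto
    qed
    also have "\<dots> = r * K * K * (m i / (norm (1 - z i))\<^sup>2)" by (simp add: power2_eq_square)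
    finally show ?thesis .
  qed
  have G: "((\<lambda>i. g i t) has_sum (D t - D s)) I" if "t \<in> ball s r" for t
    unfolding g_def by (rule D_diff[OF Ret[OF that] s])
  have sm: "(\<lambda>i. r * K * K * (m i / (norm (1 - z i))\<^sup>2)) summable_on I"
    by (intro summable_on_cmult_right summable)
  have hol: "g i holomorphic_on ball s r" if "i \<in> I" for i
    using dg[OF that] unfolding holomorphic_on_open[OF open_ball] by blast
  note * = has_sum_deriv_holomorphic[of "ball s r" I g, OF open_ball hol M sm G sr]
  have "(\<lambda>t. (D t - D s) + D s) field_differentiable at s"
    by (intro field_differentiable_add *(2)) auto
  then show fd: "D field_differentiable at s" by simp
  have "deriv (\<lambda>t. D t - D s) s = deriv D s"
    using fd by (simp add: deriv_diff)
  then have "((\<lambda>i. deriv (g i) s) has_sum deriv D s) I" using *(1) by simp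
  then show "((\<lambda>i. of_real (m i) / (s - z i)\<^sup>2) has_sum deriv D s) I"
    by (rule has_sum_cong[THEN iffD1, rotated]) (rule DERIV_imp_deriv[OF dg[OF _ sr]])
qed

text \<open>The zero side of the explicit formula at T = ln x. For T >= 0 and Re z <= 0 < Re s the
  exponentials have modulus at most 1, so the sum is dominated by that of m / |s - z|^2.\<close>

definition zero_sum :: "real \<Rightarrow> complex \<Rightarrow> complex" where
  "zero_sum T s = (\<Sum>\<^sub>\<infinity>i\<in>I. of_real (m i) * exp ((z i - s) * of_real T) / (s - z i)\<^sup>2)"

lemma norm_zero_sum_term:
  assumes "0 \<le> T" "0 < Re s" "i \<in> I"
  shows "norm (of_real (m i) * exp ((z i - s) * of_real T) / (s - z i)\<^sup>2)
    = m i * exp ((Re (z i) - Re s) * T) / (norm (s - z i))\<^sup>2"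
  using m_nonneg[OF assms(3)] by (simp add: norm_mult norm_divide norm_power)

lemma zero_sum_has_sum:
  assumes "0 \<le> T" "0 < Re s"
  shows "((\<lambda>i. of_real (m i) * exp ((z i - s) * of_real T) / (s - z i)\<^sup>2) has_sum zero_sum T s) I"
proof -
  have 2: "norm (of_real (m i) * exp ((z i - s) * of_real T) / (s - z i)\<^sup>2) \<le> m i / (norm (s - z i))\<^sup>2"
    if i: "i \<in> I" for i
    unfolding norm_zero_sum_term[OF assms i] using m_nonneg[OF i] Re_z[OF i] assms
    by (intro divide_right_mono mult_left_le) (auto intro: mult_nonpos_nonneg)
  have "(\<lambda>i. of_real (m i) * exp ((z i - s) * of_real T) / (s - z i)\<^sup>2) summable_on I"
    by (rule abs_summable_summable[OF Infinite_Sum.abs_summable_on_comparison_test'[OF inverse_square_summable[OF assms(2)] 2]])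
  then show ?thesis unfolding zero_sum_def by simp
qed

lemma zero_sum_holomorphic:
  assumes T: "0 \<le> T"
  shows "zero_sum T holomorphic_on {s. 0 < Re s}"
proof -
  have "zero_sum T field_differentiable at s" if s: "0 < Re s" for s
  proof -
    define r where "r = Re s / 2"
    obtain K where K: "K > 0"
      "\<And>i t. i \<in> I \<Longrightarrow> t \<in> ball s r \<Longrightarrow> 0 < Re t \<and> norm (1 - z i) \<le> K * norm (t - z i)"
      using local_bound[OF s] unfolding r_def by blast
    have sr: "s \<in> ball s r" using s by (simp add: r_def)
    have Ret: "0 < Re t" if "t \<in> ball s r" for t
    proof -
      have "\<bar>Re (s - t)\<bar> \<le> norm (s - t)" by (rule abs_Re_le_cmod)
      then show ?thesis using that s unfolding r_def by (auto simp: dist_norm)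
    qed
    have hol: "(\<lambda>t. of_real (m i) * exp ((z i - t) * of_real T) / (t - z i)\<^sup>2) holomorphic_on ball s r"
      if "i \<in> I" for i
      using z_neq[OF Ret that] by (intro holomorphic_intros) auto
    have M: "norm (of_real (m i) * exp ((z i - t) * of_real T) / (t - z i)\<^sup>2) \<le> K\<^sup>2 * (m i / (norm (1 - z i))\<^sup>2)"
      if i: "i \<in> I" and t: "t \<in> ball s r" for i t
    proof -
      have nz: "t - z i \<noteq> 0" "1 - z i \<noteq> 0" using z_neq[OF Ret[OF t] i] z_neq[of 1 i] i by auto
      have "(norm (1 - z i))\<^sup>2 \<le> (K * norm (t - z i))\<^sup>2" using K(2)[OF i t] by (intro power_mono) auto
      then have le: "1 / (norm (t - z i))\<^sup>2 \<le> K\<^sup>2 / (norm (1 - z i))\<^sup>2"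
        using nz by (simp add: field_simps power_mult_distrib)
      have "norm (of_real (m i) * exp ((z i - t) * of_real T) / (t - z i)\<^sup>2) \<le> m i / (norm (t - z i))\<^sup>2"
        unfolding norm_zero_sum_term[OF T Ret[OF t] i] using m_nonneg[OF i] Re_z[OF i] T Ret[OF t]
        by (intro divide_right_mono mult_left_le) (auto intro: mult_nonpos_nonneg)
      also have "\<dots> = m i * (1 / (norm (t - z i))\<^sup>2)" by simp
      also have "\<dots> \<le> m i * (K\<^sup>2 / (norm (1 - z i))\<^sup>2)"
        using le m_nonneg[OF i] by (rule mult_left_mono)
      finally show ?thesis by (simp add: mult.commute)
    qed
    have sm: "(\<lambda>i. K\<^sup>2 * (m i / (norm (1 - z i))\<^sup>2)) summable_on I"
      by (intro summable_on_cmult_right summable)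
    show ?thesis
      by (rule has_sum_deriv_holomorphic(2)[of "ball s r" I, OF open_ball hol M sm zero_sum_has_sum[OF T Ret] sr])
  qed
  then show ?thesis by (auto simp: holomorphic_on_def intro: field_differentiable_at_within)
qed

lemma dirichlet_abs_summable:
  assumes "c < s"
  shows "(\<lambda>n. norm (b n) / real n powr s) summable_on {1..}"
proof -
  have "(\<lambda>n. b n / of_nat n powr (of_real s)) summable_on {1..}"
    using D_dirichlet[of "of_real s"] assms by (intro has_sum_imp_summable) auto
  then have "(\<lambda>n. norm (b n / of_nat n powr (of_real s))) summable_on {1..}"
    by (simp add: summable_on_iff_abs_summable_on_complex)
  then show ?thesis
    by (rule summable_on_cong[THEN iffD1, rotated]) (auto simp: norm_divide norm_powr_real_powr)
qed

lemma D_deriv_dirichlet: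
  assumes s: "c < Re s"
  shows "((\<lambda>n. - (b n * of_real (ln (real n)) / of_nat n powr s)) has_sum deriv D s) {1..}"
proof -
  define u where "u = (c + Re s) / 2"
  define S where "S = {t. u < Re t}"
  have S: "open S" "s \<in> S" "c < u" using s open_halfspace_Re_gt[of u] by (auto simp: S_def u_def)
  have M: "norm (b n / of_nat n powr t) \<le> norm (b n) / real n powr u" if "n \<in> {1..}" "t \<in> S" for n t
    using that by (auto simp: norm_divide norm_powr_real_powr S_def intro!: divide_left_mono powr_mono)
  have dg: "((\<lambda>t. b n / of_nat n powr t) has_field_derivative
      - (b n * of_real (ln (real n)) / of_nat n powr t)) (at t)" if n: "n \<in> {1..}" for n t
  proof -
    have "((\<lambda>t. b n * of_nat n powr (- t)) has_field_derivative
        b n * (Ln (of_nat n) * of_nat n powr (- t) * (-1))) (at t)"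
      using n by (auto intro!: derivative_eq_intros DERIV_chain2[OF has_field_derivative_powr_right])
    moreover have "Ln (of_nat n) = of_real (ln (real n))" using n Ln_of_real[of "real n"] by simp
    ultimately show ?thesis by (simp add: powr_minus divide_inverse mult_ac)
  qed
  have "((\<lambda>n. deriv (\<lambda>t. b n / of_nat n powr t) s) has_sum deriv D s) {1..}"
  proof (rule has_sum_deriv_holomorphic(1)[OF S(1) _ M dirichlet_abs_summable[OF S(3)] _ S(2)])
    show "(\<lambda>t. b n / of_nat n powr t) holomorphic_on S" if "n \<in> {1..}" for n
      using dg[OF that] unfolding holomorphic_on_open[OF S(1)] by blast
    show "((\<lambda>n. b n / of_nat n powr t) has_sum D t) {1..}" if "t \<in> S" for t
      using that S(3) by (intro D_dirichlet) (auto simp: S_def)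
  qed
  then show ?thesis
    by (rule has_sum_cong[THEN iffD1, rotated]) (rule DERIV_imp_deriv[OF dg])
qed


text \<open>The term \<open>v i t\<close> is t times the term of \<open>zero_sum\<close> for T = -
  ln t, extended continuously to t = 0. The k-th moment integrates t^(k + 1 + s - z), and the M-test
  allows sum and integral to be exchanged.\<close>

lemma zeros_side_moments:
  assumes s: "0 < s"
  defines "v \<equiv> \<lambda>i t. of_real (m i) * of_real t powr (1 + of_real s - z i) / (of_real s - z i)\<^sup>2"
  shows "\<exists>g. continuous_on {0..1} g \<and> (\<forall>t\<in>{0..1}. ((\<lambda>i. v i t) has_sum g t) I) \<and>
    (\<forall>k. \<exists>K. ((\<lambda>t. of_real t ^ k * g t) has_integral K) {0..1} \<and>
      ((\<lambda>i. of_real (m i) / ((of_real s - z i)\<^sup>2 * (of_nat k + 2 + of_real s - z i))) has_sum K) I)"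
proof -
  have Re: "0 < Re (1 + of_real s - z i)" if "i \<in> I" for i using Re_z[OF that] s by simp
  have cont: "continuous_on {0..1} (\<lambda>t. of_real t ^ k * v i t)" if i: "i \<in> I" for i k
    unfolding v_def using Re[OF i] z_neq[of "of_real s" i] s i
    by (intro continuous_intros) auto
  have M: "norm (of_real t ^ k * v i t) \<le> m i / (norm (of_real s - z i))\<^sup>2" if i: "i \<in> I" and t: "t \<in> {0..1}" for i t k
  proof -
    have 1: "norm (of_real t powr (1 + of_real s - z i)) \<le> 1"
    proof (cases "t = 0")
      case False
      then have "norm (of_real t powr (1 + of_real s - z i)) = t powr Re (1 + of_real s - z i)"
        using t by (subst norm_powr_real_powr) auto
      also have "\<dots> \<le> 1" using t Re[OF i] False by (intro powr_le1) auto
      finally show ?thesis .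
    qed simp
    have "norm (of_real t ^ k * v i t) = t ^ k * (m i * norm (of_real t powr (1 + of_real s - z i)) / (norm (of_real s - z i))\<^sup>2)"
      using m_nonneg[OF i] t by (simp add: v_def norm_mult norm_divide norm_power)
    also have "\<dots> \<le> 1 * (m i * 1 / (norm (of_real s - z i))\<^sup>2)"
      using m_nonneg[OF i] t 1 by (intro mult_mono divide_right_mono mult_left_mono power_le_one) auto
    finally show ?thesis by simp
  qed
  have sm: "(\<lambda>i. m i / (norm (of_real s - z i))\<^sup>2) summable_on I"
    by (rule inverse_square_summable) (use s in simp)
  define g where "g = (\<lambda>t. \<Sum>\<^sub>\<infinity>i\<in>I. v i t)"
  have hs: "((\<lambda>i. v i t) has_sum g t) I" if t: "t \<in> {0..1}" for t
  proof -
    have "(\<lambda>i. v i t) summable_on I"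
      by (rule abs_summable_summable[OF Infinite_Sum.abs_summable_on_comparison_test'[OF sm]])
         (use M[OF _ t, of _ 0] in simp)
    then show ?thesis unfolding g_def by simp
  qed
  have int: "((\<lambda>t. of_real t ^ k * v i t) has_integral
      of_real (m i) / ((of_real s - z i)\<^sup>2 * (of_nat k + 2 + of_real s - z i))) {0..1}" if i: "i \<in> I" for i k
  proof -
    have e: "of_nat k + 1 + (1 + of_real s - z i) = of_nat k + 2 + of_real s - z i" by simp
    show ?thesis
      using has_integral_mult_right[OF has_integral_of_real_powr[OF Re[OF i], of k, unfolded e],
        of "of_real (m i) / (of_real s - z i)\<^sup>2"]
      by (simp add: v_def mult_ac)
  qed
  have ks: "((\<lambda>i. of_real t ^ k * v i t) has_sum of_real t ^ k * g t) I" if "t \<in> {0..1}" for t k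
    by (rule has_sum_cmult_right[OF hs[OF that]])
  show ?thesis
  proof (intro exI[of _ g] conjI allI ballI hs)
    show "continuous_on {0..1} g"
      using has_sum_integral(1)[OF cont[of _ 0] M[of _ _ 0] sm ks[of _ 0] int[of _ 0]] by simp
    show "\<exists>K. ((\<lambda>t. of_real t ^ k * g t) has_integral K) {0..1} \<and>
      ((\<lambda>i. of_real (m i) / ((of_real s - z i)\<^sup>2 * (of_nat k + 2 + of_real s - z i))) has_sum K) I" for k
      by (rule has_sum_integral(2)[OF cont M sm ks int])
  qed
qed

text \<open>The weight vanishes for n <= 1/t, so g is t times the tail of the Dirichlet series
  beyond x = 1/t with weights ln (n/x). Integration replaces the weights by ln n, 1 and n^-(k + 2),
  which sum to - D'(s), D(s) and D(s + k + 2).\<close>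

lemma dirichlet_side_moments:
  assumes s: "c < s"
  defines "w \<equiv> \<lambda>n t. b n / of_nat n powr of_real s * of_real (t * ln (max 1 (real n * t)))"
  shows "\<exists>g. continuous_on {0..1} g \<and> (\<forall>t\<in>{0..1}. ((\<lambda>n. w n t) has_sum g t) {1..}) \<and>
    (\<forall>k. ((\<lambda>t. of_real t ^ k * g t) has_integral
       (- deriv D (of_real s) / of_nat (k + 2)
         - (D (of_real s) - D (of_real s + of_nat (k + 2))) / (of_nat (k + 2))\<^sup>2)) {0..1})"
proof -
  have cont: "continuous_on {0..1} (\<lambda>t. of_real t ^ k * w n t)" if n: "n \<in> {1..}" for n k
    unfolding w_def by (intro continuous_intros) auto
  have sm: "(\<lambda>n. norm (b n * of_real (ln (real n)) / of_nat n powr (of_real s))) summable_on {1..}"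
    using has_sum_imp_summable[OF D_deriv_dirichlet[of "of_real s"]] s
    by (simp add: summable_on_iff_abs_summable_on_complex norm_mult norm_divide)
  have M: "norm (of_real t ^ k * w n t) \<le> norm (b n * of_real (ln (real n)) / of_nat n powr (of_real s))"
    if n: "n \<in> {1..}" and t: "t \<in> {0..1}" for n t k
  proof -
    have n1: "1 \<le> real n" using n by simp
    have mx: "1 \<le> max 1 (real n * t)" "max 1 (real n * t) \<le> real n"
      using t n1 by (auto simp: mult_left_le)
    then have l: "0 \<le> ln (max 1 (real n * t))" "ln (max 1 (real n * t)) \<le> ln (real n)" by simp_all
    have "norm (of_real t ^ k * w n t) = t ^ k * (norm (b n / of_nat n powr of_real s) * (t * ln (max 1 (real n * t))))"
      using t l by (simp add: w_def norm_mult norm_power norm_divide abs_mult)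
    also have "\<dots> \<le> 1 * (norm (b n / of_nat n powr of_real s) * (1 * ln (real n)))"
      using t l by (intro mult_mono power_le_one) auto
    also have "\<dots> = norm (b n * of_real (ln (real n)) / of_nat n powr (of_real s))"
      using n1 by (simp add: norm_mult norm_divide)
    finally show ?thesis .
  qed
  define g where "g = (\<lambda>t. \<Sum>\<^sub>\<infinity>n\<in>{1..}. w n t)"
  have hs: "((\<lambda>n. w n t) has_sum g t) {1..}" if t: "t \<in> {0..1}" for t
  proof -
    have "(\<lambda>n. w n t) summable_on {1..}"
      by (rule abs_summable_summable[OF Infinite_Sum.abs_summable_on_comparison_test'[OF sm]])
         (use M[OF _ t, of _ 0] in simp)
    then show ?thesis unfolding g_def by simp
  qed
  have ks: "((\<lambda>n. of_real t ^ k * w n t) has_sum of_real t ^ k * g t) {1..}" if "t \<in> {0..1}" for t k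
    by (rule has_sum_cmult_right[OF hs[OF that]])
  define J where "J = (\<lambda>k n. b n / of_nat n powr of_real s *
      of_real (ln (real n) / real (k + 2) - (1 - 1 / real n ^ (k + 2)) / (real (k + 2))\<^sup>2))"
  have int: "((\<lambda>t. of_real t ^ k * w n t) has_integral J k n) {0..1}" if n: "n \<in> {1..}" for n k
  proof -
    have "((\<lambda>t. b n / of_nat n powr of_real s * of_real (t ^ k * (t * ln (max 1 (real n * t))))) has_integral J k n) {0..1}"
      unfolding J_def using n by (intro has_integral_mult_right has_integral_of_real has_integral_ln_max) auto
    then show ?thesis by (simp add: w_def mult_ac)
  qed
  have val: "(J k has_sum (- deriv D (of_real s) / of_nat (k + 2)
         - (D (of_real s) - D (of_real s + of_nat (k + 2))) / (of_nat (k + 2))\<^sup>2)) {1..}" for k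
  proof -
    let ?p = "of_nat (k + 2) :: complex"
    have p: "?p \<noteq> 0" by (metis of_nat_eq_0_iff add_2_eq_Suc' nat.distinct(1))
    have 1: "((\<lambda>n. - (b n * of_real (ln (real n)) / of_nat n powr of_real s)) has_sum deriv D (of_real s)) {1..}"
      by (rule D_deriv_dirichlet) (use s in simp)
    have 2: "((\<lambda>n. b n / of_nat n powr of_real s) has_sum D (of_real s)) {1..}"
      by (rule D_dirichlet) (use s in simp)
    have 3: "((\<lambda>n. b n / of_nat n powr (of_real s + ?p)) has_sum D (of_real s + ?p)) {1..}"
      by (rule D_dirichlet) (use s in simp)
    have "((\<lambda>n. (- 1 / ?p) * (- (b n * of_real (ln (real n)) / of_nat n powr of_real s))
         + ((- 1 / ?p\<^sup>2) * (b n / of_nat n powr of_real s) + (1 / ?p\<^sup>2) * (b n / of_nat n powr (of_real s + ?p)))) has_sum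
         ((- 1 / ?p) * deriv D (of_real s) + ((- 1 / ?p\<^sup>2) * D (of_real s) + (1 / ?p\<^sup>2) * D (of_real s + ?p)))) {1..}"
      by (intro has_sum_add has_sum_cmult_right 1 2 3)
    moreover have "(- 1 / ?p) * (- (b n * of_real (ln (real n)) / of_nat n powr of_real s))
         + ((- 1 / ?p\<^sup>2) * (b n / of_nat n powr of_real s) + (1 / ?p\<^sup>2) * (b n / of_nat n powr (of_real s + ?p)))
         = J k n" if n: "n \<in> {1..}" for n
    proof -
      have "of_nat n powr (of_real s + ?p) = of_nat n powr of_real s * (of_nat n :: complex) ^ (k + 2)"
      proof -
        have "of_nat n powr ?p = (of_nat n :: complex) ^ (k + 2)" by (rule powr_nat') (use n in auto)
        then show ?thesis by (simp only: powr_add)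
      qed
      moreover have "J k n = b n / of_nat n powr of_real s *
          (of_real (ln (real n)) / ?p - (1 - 1 / of_nat n ^ (k + 2)) / ?p\<^sup>2)"
        unfolding J_def by simp
      moreover have "(- 1 / q) * (- (A * l / P)) + ((- 1 / q\<^sup>2) * (A / P) + (1 / q\<^sup>2) * (A / (P * y)))
          = A / P * (l / q - (1 - 1 / y) / q\<^sup>2)" for A P l y q :: complex
        by (simp add: diff_divide_distrib algebra_simps)
      ultimately show ?thesis by (simp only:)
    qed
    moreover have "(- 1 / ?p) * deriv D (of_real s) + ((- 1 / ?p\<^sup>2) * D (of_real s) + (1 / ?p\<^sup>2) * D (of_real s + ?p))
       = - deriv D (of_real s) / ?p - (D (of_real s) - D (of_real s + ?p)) / ?p\<^sup>2"
      by (simp add: diff_divide_distrib)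
    ultimately show ?thesis by (metis (no_types, lifting) has_sum_cong)
  qed
  show ?thesis
  proof (intro exI[of _ g] conjI allI ballI hs)
    show "continuous_on {0..1} g"
      using has_sum_integral(1)[OF cont[of _ 0] M[of _ _ 0] sm ks[of _ 0] int[of _ 0]] by simp
    fix k
    obtain K where K: "((\<lambda>t. of_real t ^ k * g t) has_integral K) {0..1}" "(J k has_sum K) {1..}"
      using has_sum_integral(2)[OF cont[of _ k] M[of _ _ k] sm ks[of _ k] int[of _ k]] by blast
    have "K = - deriv D (of_real s) / of_nat (k + 2)
         - (D (of_real s) - D (of_real s + of_nat (k + 2))) / (of_nat (k + 2))\<^sup>2"
      using has_sum_unique[OF K(2) val] .
    then show "((\<lambda>t. of_real t ^ k * g t) has_integral
       (- deriv D (of_real s) / of_nat (k + 2)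
         - (D (of_real s) - D (of_real s + of_nat (k + 2))) / (of_nat (k + 2))\<^sup>2)) {0..1}" using K(1) by simp
  qed
qed

text \<open>With \<open>t = e\<^sup>-\<^sup>T\<close> both sides of the explicit formula at a fixed real \<open>s\<close> become
  continuous functions on the unit interval with the same moments.\<close>

lemma explicit_formula_real:
  assumes s: "c < s" and x: "1 \<le> x"
  shows "((\<lambda>n. b n / of_nat n powr of_real s * of_real (ln (max 1 (real n / x)))) has_sum
     - zero_sum (ln x) (of_real s)) {1..}"
proof -
  have s0: "0 < s" using s c_nonneg by simp
  obtain g where g: "continuous_on {0..1} g"
    "\<And>t. t \<in> {0..1} \<Longrightarrow> ((\<lambda>n. b n / of_nat n powr of_real s * of_real (t * ln (max 1 (real n * t)))) has_sum g t) {1..}"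
    "\<And>k. ((\<lambda>t. of_real t ^ k * g t) has_integral
       (- deriv D (of_real s) / of_nat (k + 2)
         - (D (of_real s) - D (of_real s + of_nat (k + 2))) / (of_nat (k + 2))\<^sup>2)) {0..1}"
    using dirichlet_side_moments[OF s] by blast
  obtain h where h: "continuous_on {0..1} h"
    "\<And>t. t \<in> {0..1} \<Longrightarrow> ((\<lambda>i. of_real (m i) * of_real t powr (1 + of_real s - z i) / (of_real s - z i)\<^sup>2) has_sum h t) I"
    "\<And>k. \<exists>K. ((\<lambda>t. of_real t ^ k * h t) has_integral K) {0..1} \<and>
      ((\<lambda>i. of_real (m i) / ((of_real s - z i)\<^sup>2 * (of_nat k + 2 + of_real s - z i))) has_sum K) I"
    using zeros_side_moments[OF s0] by blast
  have mom: "((\<lambda>t. of_real t ^ k * (g t + h t)) has_integral 0) {0..1}" for k :: nat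
  proof -
    let ?p = "of_nat (k + 2) :: complex" and ?s = "of_real s :: complex"
    obtain K where K: "((\<lambda>t. of_real t ^ k * h t) has_integral K) {0..1}"
      "((\<lambda>i. of_real (m i) / ((?s - z i)\<^sup>2 * (of_nat k + 2 + ?s - z i))) has_sum K) I"
      using h(3) by blast
    have p: "?p \<noteq> 0" by (metis of_nat_eq_0_iff add_2_eq_Suc' nat.distinct(1))
    have 1: "((\<lambda>i. of_real (m i) / (?s - z i)\<^sup>2) has_sum deriv D ?s) I" by (rule D_deriv) (use s0 in simp)
    have 2: "((\<lambda>i. of_real (m i) * (1 / (?s + ?p - z i) - 1 / (?s - z i))) has_sum (D ?s - D (?s + ?p))) I"
      by (rule D_diff) (use s0 in auto)
    \<comment> \<open>Partial fractions 1/(u^2 (u + p)) = 1/(p u^2) + (1/(u + p) - 1/u)/p^2 with u =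
      s - z and p = k + 2. Summed over the zeros they express the moment of h by D'(s) and D(s) -
      D(s + p), which is minus the moment of g.\<close>
    have "((\<lambda>i. (1 / ?p) * (of_real (m i) / (?s - z i)\<^sup>2)
        + (1 / ?p\<^sup>2) * (of_real (m i) * (1 / (?s + ?p - z i) - 1 / (?s - z i)))) has_sum
        ((1 / ?p) * deriv D ?s + (1 / ?p\<^sup>2) * (D ?s - D (?s + ?p)))) I"
      by (intro has_sum_add has_sum_cmult_right 1 2)
    moreover have "(1 / ?p) * (of_real (m i) / (?s - z i)\<^sup>2)
        + (1 / ?p\<^sup>2) * (of_real (m i) * (1 / (?s + ?p - z i) - 1 / (?s - z i)))
        = of_real (m i) / ((?s - z i)\<^sup>2 * (of_nat k + 2 + ?s - z i))" if i: "i \<in> I" for i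
    proof -
      define u where "u = ?s - z i"
      have u: "u \<noteq> 0" "u + ?p \<noteq> 0"
        using z_neq[OF _ i, of ?s] z_neq[OF _ i, of "?s + ?p"] s0 by (auto simp: u_def algebra_simps)
      have e: "?s + ?p - z i = u + ?p" "of_nat k + 2 + ?s - z i = u + ?p" by (simp_all add: u_def)
      have "(1 / ?p) * (M / u\<^sup>2) + (1 / ?p\<^sup>2) * (M * (1 / (u + ?p) - 1 / u)) = M / (u\<^sup>2 * (u + ?p))" for M
      proof -
        have q: "(1 / q) * (M / u\<^sup>2) + (1 / q\<^sup>2) * (M * (1 / (u + q) - 1 / u)) = M / (u\<^sup>2 * (u + q))"
          if "q \<noteq> 0" "u + q \<noteq> 0" for q
          using u(1) that by (simp add: divide_simps) (simp add: algebra_simps power2_eq_square)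
        show ?thesis by (rule q[OF p u(2)])
      qed
      then show ?thesis unfolding e u_def[symmetric] .
    qed
    ultimately have "((\<lambda>i. of_real (m i) / ((?s - z i)\<^sup>2 * (of_nat k + 2 + ?s - z i))) has_sum
        ((1 / ?p) * deriv D ?s + (1 / ?p\<^sup>2) * (D ?s - D (?s + ?p)))) I"
      by (metis (no_types, lifting) has_sum_cong)
    then have "K = (1 / ?p) * deriv D ?s + (1 / ?p\<^sup>2) * (D ?s - D (?s + ?p))"
      using K(2) has_sum_unique by blast
    then have "(- deriv D ?s / ?p - (D ?s - D (?s + ?p)) / ?p\<^sup>2) + K = 0" by simp
    then show ?thesis using has_integral_add[OF g(3)[of k] K(1)] by (simp add: distrib_left)
  qed
  define t where "t = 1 / x"
  have t: "t \<in> {0..1}" "t > 0" using x by (auto simp: t_def)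
  have "g t + h t = 0"
    by (rule moments_zero_imp_zero[OF _ mom t(1)]) (intro continuous_intros g h)
  then have gh: "g t = - h t" by (simp add: eq_neg_iff_add_eq_0)
  have "of_real t powr (1 + of_real s - z i) = of_real t * exp ((z i - of_real s) * of_real (ln x))" for i
  proof -
    have "Ln (of_real t) = - of_real (ln x)"
      using x Ln_of_real[of t] t(2) by (simp add: t_def ln_div)
    then have "of_real t powr (of_real s - z i) = exp ((z i - of_real s) * of_real (ln x))"
      using t(2) by (simp add: powr_def algebra_simps)
    moreover have "of_real t powr (1 + of_real s - z i) = of_real t * of_real t powr (of_real s - z i)"
      using t(2) by (simp only: add_diff_eq[symmetric] powr_add) simp
    ultimately show ?thesis by simp
  qed
  then have "((\<lambda>i. of_real t * (of_real (m i) * exp ((z i - of_real s) * of_real (ln x)) / (of_real s - z i)\<^sup>2)) has_sum h t) I"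
    using h(2)[OF t(1)] by (simp add: mult_ac)
  moreover have "((\<lambda>i. of_real t * (of_real (m i) * exp ((z i - of_real s) * of_real (ln x)) / (of_real s - z i)\<^sup>2)) has_sum
      of_real t * zero_sum (ln x) (of_real s)) I"
    using x s0 by (intro has_sum_cmult_right zero_sum_has_sum) auto
  ultimately have ht: "h t = of_real t * zero_sum (ln x) (of_real s)" using has_sum_unique by blast
  have "((\<lambda>n. of_real x * (b n / of_nat n powr of_real s * of_real (t * ln (max 1 (real n * t))))) has_sum of_real x * g t) {1..}"
    by (intro has_sum_cmult_right g(2) t)
  moreover have "of_real x * g t = - zero_sum (ln x) (of_real s)"
    unfolding gh ht using x by (simp add: t_def)
  moreover have "of_real x * (b n / of_nat n powr of_real s * of_real (t * ln (max 1 (real n * t))))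
     = b n / of_nat n powr of_real s * of_real (ln (max 1 (real n / x)))" for n
    using x by (simp add: t_def)
  ultimately show ?thesis by (simp only:)
qed

text \<open>The tail weight max 0 (ln n - ln x) is ln n - ln x plus, for n <= x only, ln x - ln n.
  Over all n the first part sums to - D' - ln x D, so \<open>explicit_formula_real\<close> is the
  claim for real s > c; both sides are holomorphic on Re s > 0.\<close>

lemma explicit_formula:
  assumes s: "0 < Re s" and x: "1 \<le> x"
  shows "deriv D s + of_real (ln x) * D s
     - (\<Sum>n | 1 \<le> n \<and> real n \<le> x. b n / of_nat n powr s * of_real (ln x - ln (real n)))
     = zero_sum (ln x) s"
proof -
  define N where "N = {n. 1 \<le> n \<and> real n \<le> x}"
  have N: "finite N"
  proof (rule finite_subset)
    show "N \<subseteq> {..nat \<lfloor>x\<rfloor>}" using x by (auto simp: N_def le_nat_floor)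
  qed simp
  define H where "H = {s. 0 < Re s}"
  have H: "open H" "connected H"
    unfolding H_def by (auto simp: open_halfspace_Re_gt intro!: convex_connected convex_halfspace_Re_gt)
  define F where "F = (\<lambda>s. deriv D s + of_real (ln x) * D s
     - (\<Sum>n\<in>N. b n / of_nat n powr s * of_real (ln x - ln (real n))) - zero_sum (ln x) s)"
  have D: "D holomorphic_on H"
    unfolding holomorphic_on_def H_def using D_deriv(2) field_differentiable_at_within by blast
  have F: "F holomorphic_on H"
    unfolding F_def using zero_sum_holomorphic[of "ln x"] x H(1) N
    by (intro holomorphic_intros holomorphic_deriv D) (auto simp: H_def N_def)
  have rearrange: "- p + (- l * d + S) = - y \<Longrightarrow> p + l * d - S - y = 0" for p l d S y :: complex
    by (simp add: add_eq_0_iff) (simp add: algebra_simps)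
  have real: "F (of_real s) = 0" if s: "c < s" for s
  proof -
    have s': "c < Re (of_real s)" using s by simp
    have 1: "((\<lambda>n. - (- (b n * of_real (ln (real n)) / of_nat n powr of_real s))) has_sum - deriv D (of_real s)) {1..}"
      by (intro has_sum_uminusI D_deriv_dirichlet s')
    have 2: "((\<lambda>n. - of_real (ln x) * (b n / of_nat n powr of_real s)) has_sum - of_real (ln x) * D (of_real s)) {1..}"
      by (intro has_sum_cmult_right D_dirichlet s')
    have "((\<lambda>n. b n / of_nat n powr of_real s * of_real (ln x - ln (real n))) has_sum
        (\<Sum>n\<in>N. b n / of_nat n powr of_real s * of_real (ln x - ln (real n)))) N"
      using N by (rule has_sum_finite)
    then have 3: "((\<lambda>n. if n \<in> N then b n / of_nat n powr of_real s * of_real (ln x - ln (real n)) else 0) has_sum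
        (\<Sum>n\<in>N. b n / of_nat n powr of_real s * of_real (ln x - ln (real n)))) {1..}"
      by (rule has_sum_cong_neutral[THEN iffD1, rotated 3]) (auto simp: N_def)
    have "((\<lambda>n. - (- (b n * of_real (ln (real n)) / of_nat n powr of_real s))
        + (- of_real (ln x) * (b n / of_nat n powr of_real s)
        + (if n \<in> N then b n / of_nat n powr of_real s * of_real (ln x - ln (real n)) else 0))) has_sum
        (- deriv D (of_real s) + (- of_real (ln x) * D (of_real s)
        + (\<Sum>n\<in>N. b n / of_nat n powr of_real s * of_real (ln x - ln (real n)))))) {1..}"
      by (intro has_sum_add 1 2 3)
    moreover have "- (- (b n * of_real (ln (real n)) / of_nat n powr of_real s))
        + (- of_real (ln x) * (b n / of_nat n powr of_real s)
        + (if n \<in> N then b n / of_nat n powr of_real s * of_real (ln x - ln (real n)) else 0))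
        = b n / of_nat n powr of_real s * of_real (ln (max 1 (real n / x)))" if n: "n \<in> {1..}" for n
    proof (cases "n \<in> N")
      case True
      then have "max 1 (real n / x) = 1" using x by (auto simp: N_def max_def)
      then show ?thesis using True by (simp add: algebra_simps diff_divide_distrib)
    next
      case False
      then have "max 1 (real n / x) = real n / x" using x n by (auto simp: N_def max_def)
      then have e: "ln (max 1 (real n / x)) = ln (real n) - ln x" using x n by (simp add: ln_div)
      show ?thesis unfolding e using False by (simp add: algebra_simps diff_divide_distrib)
    qed
    ultimately have "((\<lambda>n. b n / of_nat n powr of_real s * of_real (ln (max 1 (real n / x)))) has_sum
        (- deriv D (of_real s) + (- of_real (ln x) * D (of_real s)
        + (\<Sum>n\<in>N. b n / of_nat n powr of_real s * of_real (ln x - ln (real n)))))) {1..}"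
      by (metis (no_types, lifting) has_sum_cong)
    from has_sum_unique[OF this explicit_formula_real[OF s x]]
    show ?thesis unfolding F_def by (rule rearrange)
  qed
  define s1 where "s1 = c + 1"
  have "F s = 0"
  proof (rule analytic_continuation[OF F H])
    show "complex_of_real ` {c<..} \<subseteq> H" using c_nonneg by (auto simp: H_def)
    show "of_real s1 \<in> H" using c_nonneg by (simp add: H_def s1_def)
    show "complex_of_real s1 islimpt complex_of_real ` {c<..}"
    proof (rule islimpt_isCont_image)
      show "s1 islimpt {c<..}" using islimpt_greaterThanLessThan1 
        by (metis greaterThan_iff interior_limit_point interior_open less_add_one open_greaterThan s1_def)
      show "isCont complex_of_real s1" by (intro continuous_intros)
      show "\<forall>\<^sub>F y in at s1. complex_of_real y \<noteq> complex_of_real s1" by (auto simp: eventually_at intro: exI[of _ 1])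
    qed
    show "F w = 0" if "w \<in> complex_of_real ` {c<..}" for w using that real by auto
    show "s \<in> H" using s by (simp add: H_def)
  qed
  then show ?thesis by (simp add: F_def N_def)
qed

end

section \<open>Integration of the explicit formula along the real axis\<close>

lemma DERIV_Re_of_real:
  assumes "(f has_field_derivative f') (at (of_real y))"
  shows "((\<lambda>t. Re (f (of_real t))) has_real_derivative Re f') (at y)"
  using has_vector_derivative_real_field[OF assms]
  unfolding has_real_derivative_iff_has_vector_derivative
  by (rule bounded_linear.has_vector_derivative[OF bounded_linear_Re])

text \<open>Writing ln |f| as ln (Re^2 + Im^2) / 2 avoids the choice of a branch of log f.\<close>

lemma DERIV_ln_norm_of_real:
  assumes f: "(f has_field_derivative f') (at (of_real y))" and nz: "f (of_real y) \<noteq> 0"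
  shows "((\<lambda>t. ln (norm (f (of_real t)))) has_real_derivative Re (f' / f (of_real y))) (at y)"
proof -
  have v: "((\<lambda>t. f (of_real t)) has_vector_derivative f') (at y)"
    using has_vector_derivative_real_field[OF f] .
  have R: "((\<lambda>t. Re (f (of_real t))) has_real_derivative Re f') (at y)"
    by (rule DERIV_Re_of_real[OF f])
  have I: "((\<lambda>t. Im (f (of_real t))) has_real_derivative Im f') (at y)"
    unfolding has_real_derivative_iff_has_vector_derivative
    by (rule bounded_linear.has_vector_derivative[OF bounded_linear_Im v])
  define u where "u = (norm (f (of_real y)))\<^sup>2"
  have "u > 0" using nz by (simp add: u_def)
  moreover have "u = (Re (f (of_real y)))\<^sup>2 + (Im (f (of_real y)))\<^sup>2"
    by (simp add: u_def cmod_power2)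
  ultimately have u: "u > 0" "u = (Re (f (of_real y)))\<^sup>2 + (Im (f (of_real y)))\<^sup>2" .
  have gen: "((\<lambda>t. ln ((g t)\<^sup>2 + (h t)\<^sup>2) / 2) has_real_derivative
     (1 / u * (2 * g y * g' + 2 * h y * h')) / 2) (at y)"
    if "(g has_real_derivative g') (at y)" "(h has_real_derivative h') (at y)" "u = (g y)\<^sup>2 + (h y)\<^sup>2"
    for g h g' h'
    using that u(1) by (auto intro!: derivative_eq_intros simp: power2_eq_square divide_simps)
       (simp add: algebra_simps)
  note gen[OF R I u(2)]
  moreover have "ln ((Re (f (of_real t)))\<^sup>2 + (Im (f (of_real t)))\<^sup>2) / 2 = ln (norm (f (of_real t)))" for t
    by (simp add: cmod_def ln_sqrt)
  moreover have "(1 / u * (2 * Re (f (of_real y)) * Re f' + 2 * Im (f (of_real y)) * Im f')) / 2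
      = Re (f' / f (of_real y))"
  proof -
    have "Re (f' / f (of_real y)) = (Re f' * Re (f (of_real y)) + Im f' * Im (f (of_real y))) / u"
      by (simp add: Re_divide u(2))
    then show ?thesis using u(1) by (simp add: field_simps)
  qed
  ultimately show ?thesis by simp
qed

text \<open>For n >= 2 and y >= s the ratio n^(s - y) is at most 2^(s - y), so everything beyond the
  first term decays exponentially in y.\<close>

lemma dirichlet_series_tendsto:
  fixes b :: "nat \<Rightarrow> complex" and F :: "real \<Rightarrow> complex"
  assumes F: "\<And>y. c < y \<Longrightarrow> ((\<lambda>n. b n / of_nat n powr of_real y) has_sum F y) {1..}"
  shows "(F \<longlongrightarrow> b 1) at_top"
proof -
  define s where "s = c + 1"
  have "(\<lambda>n. b n / of_nat n powr of_real s) summable_on {1..}"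
    using F[of s] by (intro has_sum_imp_summable) (auto simp: s_def)
  then have sm1: "(\<lambda>n. norm (b n / of_nat n powr of_real s)) summable_on {1..}"
    by (simp add: summable_on_iff_abs_summable_on_complex)
  have sm: "(\<lambda>n. norm (b n) / real n powr s) summable_on {2..}"
  proof (rule summable_on_subset_banach[where A = "{1..}"])
    show "(\<lambda>n. norm (b n) / real n powr s) summable_on {1..}"
      using sm1 by (rule summable_on_cong[THEN iffD1, rotated]) (auto simp: norm_divide norm_powr_real_powr)
  qed auto
  define M where "M = (\<Sum>\<^sub>\<infinity>n\<in>{2..}. norm (b n) / real n powr s)"
  have bound: "norm (F y - b 1) \<le> 2 powr (s - y) * M" if y: "s \<le> y" for y
  proof -
    have "{1..} = insert 1 {2::nat..}" by auto
    then have "((\<lambda>n. b n / of_nat n powr of_real y) has_sum (F y)) (insert 1 {2..})"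
      using F[of y] y by (simp add: s_def)
    then have "((\<lambda>n. b n / of_nat n powr of_real y) has_sum (F y - b 1)) (insert 1 {2..} - {1})"
      by (intro has_sum_Diff) (auto intro!: has_sum_finiteI)
    moreover have "insert 1 {2::nat..} - {1} = {2..}" by auto
    ultimately have hs: "((\<lambda>n. b n / of_nat n powr of_real y) has_sum (F y - b 1)) {2..}" by simp
    have sm': "((\<lambda>n. 2 powr (s - y) * (norm (b n) / real n powr s)) has_sum 2 powr (s - y) * M) {2..}"
      unfolding M_def by (intro has_sum_cmult_right has_sum_infsum sm)
    show ?thesis
    proof (rule norm_infsum_le[OF hs sm'])
      fix n :: nat assume n: "n \<in> {2..}"
      have "real n powr (s - y) \<le> 2 powr (s - y)" using n y by (intro powr_mono2') auto
      then have "norm (b n) / real n powr s * real n powr (s - y) \<le> norm (b n) / real n powr s * 2 powr (s - y)"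
        by (intro mult_left_mono) auto
      moreover have "norm (b n / of_nat n powr of_real y) = norm (b n) / real n powr s * real n powr (s - y)"
        using n by (simp add: norm_divide norm_powr_real_powr powr_diff)
      ultimately show "norm (b n / of_nat n powr of_real y) \<le> 2 powr (s - y) * (norm (b n) / real n powr s)"
        by (simp add: mult.commute)
    qed
  qed
  have "((\<lambda>y. 2 powr (s - y) * M) \<longlongrightarrow> 0 * M) at_top"
    by (intro tendsto_mult tendsto_const) real_asymp
  then have lim: "((\<lambda>y. 2 powr (s - y) * M) \<longlongrightarrow> 0) at_top" by simp
  have "\<forall>\<^sub>F y in at_top. norm (F y - b 1) \<le> 2 powr (s - y) * M"
    using eventually_ge_at_top[of s] by eventually_elim (rule bound)
  then have "((\<lambda>y. F y - b 1) \<longlongrightarrow> 0) at_top"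
    by (rule Lim_null_comparison[OF _ lim])
  then show ?thesis by (simp add: LIM_zero_iff)
qed

context zeros_and_dirichlet
begin

lemma D_tendsto: "((\<lambda>y. D (of_real y)) \<longlongrightarrow> b 1) at_top"
  by (rule dirichlet_series_tendsto[of c], rule D_dirichlet) simp

text \<open>The explicit formula contains T Re (b 1), whereas the sum to be bounded starts at n = 2.
  The mean value theorem gives P(n + 2) - P(n + 1) = - Re D(u) with u > n + 1; the left-hand side
  tends to 0 and the right-hand side to - Re (b 1).\<close>

lemma Re_b_1:
  assumes P: "\<And>y. 0 < y \<Longrightarrow> (P has_real_derivative - Re (D (of_real y))) (at y)"
    and P0: "(P \<longlongrightarrow> 0) at_top"
  shows "Re (b 1) = 0"
proof -
  have "\<exists>u>real n + 1. P (real n + 2) - P (real n + 1) = - Re (D (of_real u))" for n :: nat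
  proof -
    have "\<exists>u>real n + 1. u < real n + 2 \<and> P (real n + 2) - P (real n + 1)
        = (real n + 2 - (real n + 1)) * (- Re (D (of_real u)))"
      by (rule MVT2) (auto intro!: P)
    then show ?thesis by auto
  qed
  then obtain u where u: "\<And>n. u n > real n + 1"
    "\<And>n::nat. P (real n + 2) - P (real n + 1) = - Re (D (of_real (u n)))" by metis
  have ut: "filterlim u at_top sequentially"
  proof (rule filterlim_at_top_mono[OF filterlim_real_sequentially], rule always_eventually, rule allI)
    show "real n \<le> u n" for n using u(1)[of n] by linarith
  qed
  have "(\<lambda>n. - Re (D (of_real (u n)))) \<longlonglongrightarrow> - Re (b 1)"
    by (intro tendsto_minus tendsto_Re filterlim_compose[OF D_tendsto ut])
  moreover have "(\<lambda>n. P (real n + 2) - P (real n + 1)) \<longlonglongrightarrow> 0 - 0"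
    by (intro tendsto_diff filterlim_compose[OF P0]) real_asymp+
  ultimately have "- Re (b 1) = 0 - 0" unfolding u(2) by (rule LIMSEQ_unique)
  then show ?thesis by simp
qed

text \<open>By the explicit formula T P - Re D - Re G has derivative - Re \<open>zero_sum\<close>,
  and |\<open>zero_sum\<close>| at t >= y is at most S exp (- t T), because |t - z| >= |y - z|.
  Hence Q, which subtracts the integral of this bound, is nondecreasing on [y, infinity) with limit
  0, and Q y <= 0.\<close>

lemma log_upper_bound:
  assumes P: "\<And>y. 0 < y \<Longrightarrow> (P has_real_derivative - Re (D (of_real y))) (at y)"
    and P0: "(P \<longlongrightarrow> 0) at_top" and x: "1 < x" and y: "0 < y"
    and S: "((\<lambda>i. m i * exp (Re (z i) * ln x) / (norm (of_real y - z i))\<^sup>2) has_sum S) I"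
  shows "ln x * P y - Re (D (of_real y))
     - Re (\<Sum>n | 2 \<le> n \<and> real n \<le> x. b n / (of_nat n powr of_real y * of_real (ln (real n))) * of_real (ln x - ln (real n)))
     \<le> S * exp (- y * ln x) / ln x"
proof -
  define T where "T = ln x"
  have T: "T > 0" using x by (simp add: T_def)
  define N where "N = {n. 2 \<le> n \<and> real n \<le> x}"
  have N1: "{n. 1 \<le> n \<and> real n \<le> x} = insert 1 N" using x by (auto simp: N_def)
  have N: "finite N"
  proof (rule finite_subset)
    show "N \<subseteq> {..nat \<lfloor>x\<rfloor>}" using x by (auto simp: N_def le_nat_floor)
  qed simp
  define G where "G = (\<lambda>s. \<Sum>n\<in>N. b n / (of_nat n powr s * of_real (ln (real n))) * of_real (T - ln (real n)))"
  define G' where "G' = (\<lambda>s. \<Sum>n\<in>N. b n / of_nat n powr s * of_real (T - ln (real n)))"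
  have dG: "(G has_field_derivative - G' s) (at s)" for s
  proof -
    have "((\<lambda>s. b n / (of_nat n powr s * of_real (ln (real n))) * of_real (T - ln (real n))) has_field_derivative
        - (b n / of_nat n powr s * of_real (T - ln (real n)))) (at s)" if n: "n \<in> N" for n
    proof -
      have l: "ln (real n) > 0" using n by (simp add: N_def)
      have "((\<lambda>s. b n * of_nat n powr (- s)) has_field_derivative
          b n * (Ln (of_nat n) * of_nat n powr (- s) * (-1))) (at s)"
        using n by (auto intro!: derivative_eq_intros DERIV_chain2[OF has_field_derivative_powr_right] simp: N_def)
      moreover have "Ln (of_nat n) = of_real (ln (real n))" using n Ln_of_real[of "real n"] by (simp add: N_def)
      ultimately have "((\<lambda>s. b n / of_nat n powr s) has_field_derivative
          - (b n / of_nat n powr s * of_real (ln (real n)))) (at s)"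
        by (simp add: powr_minus divide_inverse mult_ac)
      note d = DERIV_cmult_right[OF this, of "of_real (T - ln (real n)) / of_real (ln (real n))"]
      have l': "complex_of_real (ln (real n)) \<noteq> 0" using l by simp
      have e1: "B / (A * l) * q = B / A * (q / l)" for B A l q :: complex by simp
      have e2: "- (B * l) * (q / l) = - (B * q)" if "l \<noteq> 0" for B l q :: complex using that by simp
      show ?thesis using d unfolding e1 e2[OF l'] .
    qed
    then show ?thesis unfolding G_def G'_def sum_negf[symmetric] by (intro DERIV_sum)
  qed
  define Q where "Q = (\<lambda>t. T * P t - Re (D (of_real t)) - Re (G (of_real t)) - S * exp (- t * T) / T)"
  have dQ: "\<exists>d. (Q has_real_derivative d) (at t) \<and> 0 \<le> d" if t: "y \<le> t" for t
  proof -
    have t0: "0 < t" using t y by simp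
    have "(D has_field_derivative deriv D (of_real t)) (at (of_real t))"
      using D_deriv(2)[of "of_real t"] t0 by (simp add: field_differentiable_derivI)
    note dD = DERIV_Re_of_real[OF this]
    have "(Q has_real_derivative (T * (- Re (D (of_real t))) - Re (deriv D (of_real t)) - Re (- G' (of_real t))
        + S * exp (- t * T))) (at t)"
    proof -
      have gen: "((\<lambda>t. T * p t - d t - g t - S * exp (- t * T) / T) has_real_derivative
          (T * p' - d' - g' + S * exp (- t * T))) (at t)"
        if "(p has_real_derivative p') (at t)" "(d has_real_derivative d') (at t)" "(g has_real_derivative g') (at t)"
        for p d g p' d' g'
        using that T by (auto intro!: derivative_eq_intros)
      show ?thesis unfolding Q_def by (rule gen[OF P[OF t0] dD DERIV_Re_of_real[OF dG]])
    qed
    moreover have "T * (- Re (D (of_real t))) - Re (deriv D (of_real t)) - Re (- G' (of_real t)) = - Re (zero_sum T (of_real t))"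
    proof -
      have "deriv D (of_real t) + of_real T * D (of_real t) - (b 1 * of_real T + G' (of_real t)) = zero_sum T (of_real t)"
        using explicit_formula[of "of_real t" x] t0 x N unfolding N1 T_def[symmetric]
        by (simp add: G'_def N_def)
      then have "Re (deriv D (of_real t) + of_real T * D (of_real t) - (b 1 * of_real T + G' (of_real t))) = Re (zero_sum T (of_real t))"
        by simp
      then show ?thesis using Re_b_1[OF P P0] by simp
    qed
    moreover have "norm (zero_sum T (of_real t)) \<le> exp (- t * T) * S"
    proof (rule norm_infsum_le[OF zero_sum_has_sum has_sum_cmult_right[OF S]])
      fix i assume i: "i \<in> I"
      have nz: "of_real y - z i \<noteq> 0" using z_neq[OF _ i, of "of_real y"] y by simp
      have "(norm (of_real y - z i))\<^sup>2 \<le> (norm (of_real t - z i))\<^sup>2"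
        using Re_z[OF i] t y by (simp add: cmod_power2 power_mono)
      then have "m i * exp ((Re (z i) - t) * T) / (norm (of_real t - z i))\<^sup>2
          \<le> m i * exp ((Re (z i) - t) * T) / (norm (of_real y - z i))\<^sup>2"
        using m_nonneg[OF i] nz by (intro divide_left_mono mult_pos_pos) (auto simp: zero_less_power2 intro: order_less_le_trans)
      also have "\<dots> = exp (- t * T) * (m i * exp (Re (z i) * ln x) / (norm (of_real y - z i))\<^sup>2)"
        by (simp add: T_def left_diff_distrib exp_diff exp_minus field_simps)
      finally show "norm (of_real (m i) * exp ((z i - of_real t) * of_real T) / (of_real t - z i)\<^sup>2)
        \<le> exp (- t * T) * (m i * exp (Re (z i) * ln x) / (norm (of_real y - z i))\<^sup>2)"
        using norm_zero_sum_term[of T "of_real t" i] T t0 i by simp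
    qed (use T t0 in auto)
    then have "Re (zero_sum T (of_real t)) \<le> S * exp (- t * T)"
      using complex_Re_le_cmod[of "zero_sum T (of_real t)"] by (simp add: mult.commute)
    ultimately have "(Q has_real_derivative - Re (zero_sum T (of_real t)) + S * exp (- t * T)) (at t)"
      "0 \<le> - Re (zero_sum T (of_real t)) + S * exp (- t * T)" by simp_all
    then show ?thesis by blast
  qed
  have "(Q \<longlongrightarrow> T * 0 - Re (b 1) - Re 0 - S * 0 / T) at_top"
    unfolding Q_def
  proof (intro tendsto_intros P0 D_tendsto)
    have "((\<lambda>t. G (of_real t)) \<longlongrightarrow> (\<Sum>n\<in>N. b n * 0 * of_real (T - ln (real n)))) at_top"
      unfolding G_def
    proof (intro tendsto_sum tendsto_mult tendsto_const)
      fix n assume n: "n \<in> N"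
      then have n2: "real n > 1" by (simp add: N_def)
      have "((\<lambda>t. 1 / (real n powr t * ln (real n))) \<longlongrightarrow> 0) at_top"
        using n2 by real_asymp
      then have "((\<lambda>t. complex_of_real (1 / (real n powr t * ln (real n)))) \<longlongrightarrow> of_real 0) at_top"
        by (rule tendsto_of_real)
      moreover have "complex_of_real (1 / (real n powr t * ln (real n))) = 1 / (of_nat n powr of_real t * of_real (ln (real n)))" for t
        using powr_of_real[of "real n" t] by simp
      ultimately have "((\<lambda>t. 1 / (of_nat n powr of_real t * of_real (ln (real n)))) \<longlongrightarrow> complex_of_real 0) at_top"
        by (simp only:)
      from tendsto_mult[OF tendsto_const this, of "b n"]
      show "((\<lambda>t. b n / (of_nat n powr of_real t * of_real (ln (real n)))) \<longlongrightarrow> b n * 0) at_top" by simp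
    qed
    then show "((\<lambda>t. G (of_real t)) \<longlongrightarrow> 0) at_top" by simp
    show "((\<lambda>t. exp (- t * T)) \<longlongrightarrow> 0) at_top" using T by real_asymp
  qed (use T in auto)
  then have Q0: "(Q \<longlongrightarrow> 0) at_top" using Re_b_1[OF P P0] by simp
  have "Q y \<le> 0"
  proof (rule tendsto_lowerbound[OF Q0])
    show "\<forall>\<^sub>F t in at_top. Q y \<le> Q t"
      using eventually_ge_at_top[of y]
    proof eventually_elim
      case (elim t)
      then show ?case by (rule DERIV_nonneg_imp_nondecreasing[of y t Q]) (rule dQ)
    qed
  qed simp
  then show ?thesis by (simp add: Q_def G_def N_def T_def)
qed

end

section \<open>The completed L-function\<close>

definition L_prefactor :: "L_data \<Rightarrow> complex \<Rightarrow> complex" where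
  "L_prefactor f s = of_nat (lcond f) powr (s / 2) * gamma_factor f s"

definition L_prefactor_logderiv :: "L_data \<Rightarrow> complex \<Rightarrow> complex" where
  "L_prefactor_logderiv f s = of_real (ln (real (lcond f))) / 2 - of_nat (ldeg f) * of_real (ln pi) / 2
     + (\<Sum>j=1..ldeg f. Digamma ((s + lshift f j) / 2)) / 2"

lemma Gamma_meromorphic: "Gamma meromorphic_on (A :: complex set)"
proof -
  have "(rGamma :: complex \<Rightarrow> complex) meromorphic_on A"
    by (intro analytic_on_imp_meromorphic_on analytic_intros)
  then have "(\<lambda>z::complex. inverse (rGamma z)) meromorphic_on A" by (rule meromorphic_on_inverse)
  \<comment> \<open>At the poles both sides have the value 0, as inverse 0 = 0.\<close>
  also have "(\<lambda>z::complex. inverse (rGamma z)) = Gamma" by (simp add: Gamma_def fun_eq_iff)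
  finally show ?thesis .
qed

lemma nonpos_Ints_Re_pos: "0 < Re z \<Longrightarrow> z \<notin> \<int>\<^sub>\<le>\<^sub>0"
  by (auto elim!: nonpos_Ints_cases)

lemma
  assumes f: "L_function f" and s: "0 < Re s"
  shows L_prefactor_nonzero: "L_prefactor f s \<noteq> 0"
    and L_prefactor_deriv: "(L_prefactor f has_field_derivative L_prefactor f s * L_prefactor_logderiv f s) (at s)"
proof -
  have q: "1 \<le> lcond f" and k: "\<And>j. j \<in> {1..ldeg f} \<Longrightarrow> 0 \<le> Re (lshift f j)"
    using f by (auto simp: L_function_def)
  have Re: "0 < Re ((s + lshift f j) / 2)" if "j \<in> {1..ldeg f}" for j using k[OF that] s by simp
  define G where "G = (\<lambda>s. \<Prod>j=1..ldeg f. Gamma ((s + lshift f j) / 2))"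
  have Gnz: "Gamma ((s + lshift f j) / 2) \<noteq> 0" if "j \<in> {1..ldeg f}" for j
    using nonpos_Ints_Re_pos[OF Re[OF that]] by (simp add: Gamma_eq_zero_iff)
  have lnq: "Ln (of_nat (lcond f)) = of_real (ln (real (lcond f)))"
    using q Ln_of_real[of "real (lcond f)"] by simp
  have lnpi: "Ln (of_real pi) = of_real (ln pi)" by (rule Ln_of_real) simp
  have powr_chain: "((\<lambda>s. c powr (u s)) has_field_derivative Ln c * c powr (u s) * u') (at s)"
    if "c \<noteq> 0" "(u has_field_derivative u') (at s)" for c u u' and s :: complex
    by (rule DERIV_chain2[OF has_field_derivative_powr_right[OF that(1)] that(2)])
  have 1: "((\<lambda>s. of_nat (lcond f) powr (s / 2)) has_field_derivative
      of_nat (lcond f) powr (s / 2) * (of_real (ln (real (lcond f))) / 2)) (at s)"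
  proof -
    have d: "((\<lambda>s::complex. s / 2) has_field_derivative 1 / 2) (at s)" by (auto intro!: derivative_eq_intros)
    show ?thesis using powr_chain[OF _ d, of "of_nat (lcond f)"] q by (simp add: lnq mult_ac)
  qed
  have 2: "((\<lambda>s. of_real pi powr (- (of_nat (ldeg f) * s / 2))) has_field_derivative
      of_real pi powr (- (of_nat (ldeg f) * s / 2)) * (- (of_nat (ldeg f) * of_real (ln pi) / 2))) (at s)"
  proof -
    have d: "((\<lambda>s::complex. - (of_nat (ldeg f) * s / 2)) has_field_derivative - (of_nat (ldeg f) / 2)) (at s)"
      by (auto intro!: derivative_eq_intros)
    show ?thesis using powr_chain[OF _ d, of "of_real pi"] by (simp add: lnpi mult_ac)
  qed
  have "(G has_field_derivative G s * (\<Sum>j=1..ldeg f. (Gamma ((s + lshift f j) / 2) * Digamma ((s + lshift f j) / 2) / 2)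
      / Gamma ((s + lshift f j) / 2))) (at s)"
    unfolding G_def
  proof (rule has_field_derivative_prod'[where f = "\<lambda>j s. Gamma ((s + lshift f j) / 2)"])
    show "Gamma ((s + lshift f j) / 2) \<noteq> 0" if "j \<in> {1..ldeg f}" for j by (rule Gnz[OF that])
    fix j assume j: "j \<in> {1..ldeg f}"
    have "((\<lambda>s. (s + lshift f j) / 2) has_field_derivative 1 / 2) (at s)"
      by (auto intro!: derivative_eq_intros)
    from DERIV_chain2[OF has_field_derivative_Gamma[OF nonpos_Ints_Re_pos[OF Re[OF j]]] this]
    show "((\<lambda>s. Gamma ((s + lshift f j) / 2)) has_field_derivative
       Gamma ((s + lshift f j) / 2) * Digamma ((s + lshift f j) / 2) / 2) (at s)" by simp
  qed
  also have "(\<Sum>j=1..ldeg f. (Gamma ((s + lshift f j) / 2) * Digamma ((s + lshift f j) / 2) / 2)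
      / Gamma ((s + lshift f j) / 2)) = (\<Sum>j=1..ldeg f. Digamma ((s + lshift f j) / 2)) / 2"
    unfolding sum_divide_distrib using Gnz by (intro sum.cong) auto
  finally have 3: "(G has_field_derivative G s * ((\<Sum>j=1..ldeg f. Digamma ((s + lshift f j) / 2)) / 2)) (at s)" .
  have eq: "L_prefactor f = (\<lambda>s. of_nat (lcond f) powr (s / 2) * (of_real pi powr (- (of_nat (ldeg f) * s / 2)) * G s))"
    by (simp add: L_prefactor_def gamma_factor_def G_def fun_eq_iff)
  show "(L_prefactor f has_field_derivative L_prefactor f s * L_prefactor_logderiv f s) (at s)"
    unfolding eq L_prefactor_logderiv_def
    by (rule DERIV_cong[OF DERIV_mult[OF 1 DERIV_mult[OF 2 3]]]) (simp add: algebra_simps)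
  show "L_prefactor f s \<noteq> 0" unfolding eq using q Gnz by (auto simp: G_def)
qed

text \<open>After \<open>remove_sings\<close> a meromorphic function can fail to be analytic only at
  poles. These are excluded at 0 and 1 by assumption and elsewhere by holomorphy.\<close>

lemma completed_L_entire:
  assumes f: "L_function f" and np: "no_pole_or_zero (completed_L f) 0" "no_pole_or_zero (completed_L f) 1"
  shows "completed_L f holomorphic_on UNIV"
proof -
  have q: "1 \<le> lcond f" and L: "lfun f nicely_meromorphic_on UNIV"
    and hol: "completed_L f holomorphic_on - {0, 1}"
    using f by (auto simp: L_function_def)
  have "(\<lambda>s. of_nat (lcond f) powr (s / 2) * gamma_factor f s * lfun f s) meromorphic_on UNIV"
    unfolding gamma_factor_def
  proof (intro meromorphic_intros)
    show "(\<lambda>s. of_nat (lcond f) powr (s / 2)) meromorphic_on (UNIV :: complex set)"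
      "(\<lambda>s. of_real pi powr (- (of_nat (ldeg f) * s / 2))) meromorphic_on (UNIV :: complex set)"
      by (intro analytic_on_imp_meromorphic_on holomorphic_on_imp_analytic_at; 
          auto simp: analytic_on_open intro!: holomorphic_intros)+
    show "(\<lambda>s. Gamma ((s + lshift f j) / 2)) meromorphic_on UNIV" for j
      by (rule meromorphic_on_compose[OF Gamma_meromorphic[of UNIV]]) (auto intro!: analytic_intros)
    show "lfun f meromorphic_on UNIV" using L by (simp add: nicely_meromorphic_on_def)
  qed
  then have nm: "completed_L f nicely_meromorphic_on UNIV"
    unfolding completed_L_def by (rule remove_sings_nicely_meromorphic)
  have "\<not> is_pole (completed_L f) z" for z
  proof (cases "z \<in> {0, 1}")
    case True
    then show ?thesis using np by (auto simp: no_pole_or_zero_def)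
  next
    case False
    have "open (- {0, 1 :: complex})" by (intro open_Compl finite_imp_closed) auto
    then have "completed_L f analytic_on {z}" using False hol by (auto simp: analytic_at)
    then show ?thesis by (rule analytic_at_imp_no_pole)
  qed
  then have "completed_L f analytic_on UNIV"
    using nicely_meromorphic_without_singularities[OF nm] by blast
  then show ?thesis by (rule analytic_imp_holomorphic)
qed

text \<open>The prefactor has neither poles nor zeros on Re s > 0, so the quotient of
  \<open>completed_L f\<close> by it is continuous there and \<open>lfun f\<close> has a finite
  limit at s. Being nicely meromorphic, it is then analytic at s, and \<open>remove_sings\<close>
  changes nothing.\<close>

lemma completed_L_right_half_plane:
  assumes f: "L_function f" and np: "no_pole_or_zero (completed_L f) 0" "no_pole_or_zero (completed_L f) 1"
    and s: "0 < Re s"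
  shows "completed_L f s = L_prefactor f s * lfun f s" and "lfun f field_differentiable at s"
proof -
  define h where "h = (\<lambda>s. L_prefactor f s * lfun f s)"
  have h: "completed_L f = remove_sings h"
    by (simp add: completed_L_def h_def L_prefactor_def)
  have L: "lfun f nicely_meromorphic_on UNIV" using f by (auto simp: L_function_def)
  define H where "H = {s. 0 < Re s}"
  have H: "open H" "s \<in> H" using s by (auto simp: H_def open_halfspace_Re_gt)
  have gH: "L_prefactor f holomorphic_on H"
    unfolding holomorphic_on_open[OF H(1)] using L_prefactor_deriv[OF f] by (auto simp: H_def)
  have g_an: "L_prefactor f analytic_on {s}" using gH H analytic_at by blast
  have h_mer: "h meromorphic_on {s}" unfolding h_def
    using L unfolding nicely_meromorphic_on_def
    by (intro meromorphic_on_mult analytic_on_imp_meromorphic_on[OF g_an])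
       (auto intro: meromorphic_on_subset)
  then have "isolated_singularity_at h s" by (auto intro: meromorphic_on_isolated_singularity)
  then have ev1: "\<forall>\<^sub>F w in at s. completed_L f w = h w"
    unfolding h by (rule eventually_remove_sings_eq_at)
  have ev2: "\<forall>\<^sub>F w in at s. w \<in> H" using H by (rule eventually_at_in_open')
  have cont: "(\<lambda>w. completed_L f w / L_prefactor f w) \<midarrow>s\<rightarrow> completed_L f s / L_prefactor f s"
  proof (intro tendsto_divide)
    show "completed_L f \<midarrow>s\<rightarrow> completed_L f s"
      using completed_L_entire[OF f np]
      by (metis UNIV_I continuous_on_eq_continuous_at holomorphic_on_imp_continuous_on isContD open_UNIV)
    show "L_prefactor f \<midarrow>s\<rightarrow> L_prefactor f s"
      using gH H by (metis continuous_on_eq_continuous_at holomorphic_on_imp_continuous_on isContD)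
    show "L_prefactor f s \<noteq> 0" by (rule L_prefactor_nonzero[OF f s])
  qed
  have "\<forall>\<^sub>F w in at s. completed_L f w / L_prefactor f w = lfun f w"
    using ev1 ev2 by eventually_elim (use L_prefactor_nonzero[OF f] in \<open>auto simp: h_def H_def\<close>)
  from Lim_transform_eventually[OF cont this]
  have lim: "lfun f \<midarrow>s\<rightarrow> completed_L f s / L_prefactor f s" .
  then have "\<not> is_pole (lfun f) s"
    unfolding is_pole_def using not_tendsto_and_filterlim_at_infinity at_neq_bot by blast
  then have an: "lfun f analytic_on {s}"
    using nicely_meromorphic_on_imp_analytic_at[OF L] by simp
  then show "lfun f field_differentiable at s"
    using analytic_on_imp_differentiable_at by blast
  have "h analytic_on {s}" unfolding h_def by (intro analytic_intros g_an an)
  then show "completed_L f s = L_prefactor f s * lfun f s"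
    unfolding h by (subst remove_sings_at_analytic) (auto simp: h_def)
qed

lemma completed_L_growth:
  assumes f: "L_function f" and np: "no_pole_or_zero (completed_L f) 0" "no_pole_or_zero (completed_L f) 1"
  obtains K p where "0 \<le> p" "p < 2" "\<And>w. norm (completed_L f (1 / 2 + w)) \<le> K * exp (norm w powr p)"
proof -
  have "growth_order (completed_L f) < ereal 2"
    using f by (auto simp: L_function_def one_ereal_def)
  then obtain r where r: "0 \<le> r" "r < 2"
    "(\<lambda>z. norm (completed_L f z)) \<in> O[at_infinity](\<lambda>z. exp (norm z powr r))"
    unfolding growth_order_def Inf_less_iff by auto
  \<comment> \<open>An exponent strictly between r and 2 absorbs the shift of the argument by
    1/2.\<close>
  define p where "p = (r + 2) / 2"
  have p: "0 \<le> p" "p < 2" "r < p" using r by (auto simp: p_def)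
  obtain c where c: "c > 0" "\<forall>\<^sub>F z in at_infinity. norm (completed_L f z) \<le> c * norm (exp (norm z powr r))"
    using landau_o.bigE[OF r(3)] by auto
  obtain B where B: "\<And>z. norm z \<ge> B \<Longrightarrow> norm (completed_L f z) \<le> c * exp (norm z powr r)"
    using c(2) by (auto simp: eventually_at_infinity)
  have "\<forall>\<^sub>F t in at_top. (t + 1 / 2) powr r \<le> t powr p" using p r by real_asymp
  then obtain B' where B': "\<And>t. t \<ge> B' \<Longrightarrow> (t + 1 / 2) powr r \<le> t powr p"
    by (auto simp: eventually_at_top_linorder)
  define R where "R = max (B + 1 / 2) B'"
  have "continuous_on (cball 0 R) (\<lambda>w. completed_L f (1 / 2 + w))"
    by (intro continuous_on_compose2[OF holomorphic_on_imp_continuous_on[OF completed_L_entire[OF f np]]] continuous_intros) auto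
  then have "bounded ((\<lambda>w. completed_L f (1 / 2 + w)) ` cball 0 R)"
    by (intro compact_imp_bounded compact_continuous_image) auto
  then obtain M where "\<And>x. x \<in> (\<lambda>w. completed_L f (1 / 2 + w)) ` cball 0 R \<Longrightarrow> norm x \<le> M"
    unfolding bounded_iff by blast
  then have M: "norm (completed_L f (1 / 2 + w)) \<le> M" if "norm w \<le> R" for w
    using that by auto
  have "norm (completed_L f (1 / 2 + w)) \<le> max M c * exp (norm w powr p)" for w
  proof (cases "norm w \<le> R")
    case True
    then have "norm (completed_L f (1 / 2 + w)) \<le> max M c * 1" using M[OF True] by simp
    also have "\<dots> \<le> max M c * exp (norm w powr p)" using c(1) by (intro mult_left_mono) auto
    finally show ?thesis .
  next
    case False
    then have w: "norm w \<ge> B + 1 / 2" "norm w \<ge> B'" by (auto simp: R_def)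
    have n: "norm (1 / 2 + w) \<le> norm w + 1 / 2" "norm w \<le> norm (1 / 2 + w) + 1 / 2"
      using norm_triangle_ineq[of "1 / 2" w] norm_triangle_ineq[of "1 / 2 + w" "- 1 / 2"] by auto
    have "norm (completed_L f (1 / 2 + w)) \<le> c * exp (norm (1 / 2 + w) powr r)"
      using n w by (intro B) auto
    also have "norm (1 / 2 + w) powr r \<le> (norm w + 1 / 2) powr r" using n r by (intro powr_mono2) auto
    also have "\<dots> \<le> norm w powr p" by (rule B'[OF w(2)])
    also have "c * exp (norm w powr p) \<le> max M c * exp (norm w powr p)" by (intro mult_right_mono) auto
    finally show ?thesis using c(1) by simp
  qed
  then show thesis using that[OF p(1,2)] by blast
qed

text \<open>The functional equation makes |Lambda(1/2 + t)| even in real t, so the derivative of its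
  logarithm vanishes at t = 0.\<close>

lemma completed_L_logderiv_center:
  assumes f: "L_function f" and np: "no_pole_or_zero (completed_L f) 0" "no_pole_or_zero (completed_L f) 1"
    and nz: "completed_L f (1 / 2) \<noteq> 0"
  shows "Re (deriv (completed_L f) (1 / 2) / completed_L f (1 / 2)) = 0"
proof -
  define X where "X = (\<lambda>w. completed_L f (1 / 2 + w))"
  define N where "N = (\<lambda>t. ln (norm (X (of_real t))))"
  have FE: "completed_L f s = lsign f * cnj (completed_L f (1 - cnj s))" for s
    using f unfolding L_function_def by blast
  have sgn: "norm (lsign f) = 1" using f by (auto simp: L_function_def)
  have even: "N (- t) = N t" for t
  proof -
    have "norm (X (of_real t)) = norm (completed_L f (1 - cnj (1 / 2 + of_real t)))"
      unfolding X_def by (subst FE) (simp add: norm_mult sgn)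
    also have "1 - cnj (1 / 2 + of_real t) = 1 / 2 + of_real (- t)" by simp
    finally show ?thesis by (simp add: N_def X_def)
  qed
  have "(completed_L f has_field_derivative deriv (completed_L f) (1 / 2)) (at (1 / 2 + 0))"
    using holomorphic_derivI[OF completed_L_entire[OF f np] open_UNIV, of "1 / 2"] by simp
  then have "(X has_field_derivative deriv (completed_L f) (1 / 2) * 1) (at 0)"
    unfolding X_def by (rule DERIV_chain2) (auto intro!: derivative_eq_intros)
  then have "(X has_field_derivative deriv (completed_L f) (1 / 2)) (at (of_real 0))" by simp
  from DERIV_ln_norm_of_real[OF this] nz
  have d: "(N has_real_derivative Re (deriv (completed_L f) (1 / 2) / completed_L f (1 / 2))) (at 0)"
    by (simp add: N_def X_def)
  have "((\<lambda>t. N (- t)) has_real_derivative Re (deriv (completed_L f) (1 / 2) / completed_L f (1 / 2)) * (- 1)) (at 0)"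
    by (rule DERIV_chain2[where f = N]) (use d in \<open>auto intro!: derivative_eq_intros\<close>)
  then have "(N has_real_derivative Re (deriv (completed_L f) (1 / 2) / completed_L f (1 / 2)) * (- 1)) (at 0)"
    by (simp add: even)
  from DERIV_unique[OF d this] show ?thesis by simp
qed

section \<open>Estimates at the point \<open>1/2 + y\<close>\<close>

text \<open>The bound ln |z + t| is compared with ln |z|, since for z = 1/4 + k_j/2 it is |z| that
  occurs in the conductor. The 4 is the bound for 1/|z|.\<close>

lemma Re_Digamma_shift_le:
  fixes z :: complex
  assumes z: "1 / 4 \<le> Re z" and t: "0 \<le> t"
  shows "Re (Digamma (z + of_real t)) \<le> ln (norm z) + 4 * t"
proof -
  have nz: "1 / 4 \<le> norm z" using complex_Re_le_cmod[of z] z by simp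
  then have "z \<noteq> 0" by auto
  have "Re (Digamma (z + of_real t)) \<le> ln (norm (z + of_real t))"
    using z t by (intro Re_Digamma_le) simp
  also have "\<dots> \<le> ln (norm z * (1 + t / norm z))"
  proof (intro ln_mono)
    show "0 < norm (z + of_real t)" using z t by (auto simp: complex_eq_iff)
    have "norm (z + of_real t) \<le> norm z + t" using norm_triangle_ineq[of z "of_real t"] t by simp
    then show "norm (z + of_real t) \<le> norm z * (1 + t / norm z)" using \<open>z \<noteq> 0\<close> by (simp add: distrib_left)
  qed
  also have "\<dots> = ln (norm z) + ln (1 + t / norm z)"
  proof -
    have "0 < 1 + t / norm z" using nz t by (simp add: add_pos_nonneg)
    then show ?thesis using nz by (simp add: ln_mult)
  qed
  also have "ln (1 + t / norm z) \<le> t / norm z" using nz t by (intro ln_add_one_self_le_self) auto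
  also have "t / norm z \<le> 4 * t"
    using \<open>z \<noteq> 0\<close> mult_left_mono[OF nz t] by (simp add: pos_divide_le_eq mult_ac)
  finally show ?thesis by simp
qed

text \<open>Integral of \<open>Re_Digamma_shift_le\<close> over [0, h].\<close>

lemma ln_norm_Gamma_shift_le:
  fixes z :: complex
  assumes z: "1 / 4 \<le> Re z" and h: "0 \<le> h"
  shows "ln (norm (Gamma (z + of_real h))) - ln (norm (Gamma z)) \<le> h * ln (norm z) + 2 * h\<^sup>2"
proof -
  define Q where "Q = (\<lambda>t. t * ln (norm z) + 2 * t\<^sup>2 - ln (norm (Gamma (z + of_real t))))"
  have "Q 0 \<le> Q h"
  proof (rule DERIV_nonneg_imp_nondecreasing[OF h])
    fix t assume t: "0 \<le> t" "t \<le> h"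
    have "z + of_real t \<notin> \<int>\<^sub>\<le>\<^sub>0" using z t by (intro nonpos_Ints_Re_pos) simp
    then have nz: "Gamma (z + of_real t) \<noteq> 0"
      and d: "(Gamma has_field_derivative Gamma (z + of_real t) * Digamma (z + of_real t)) (at (z + of_real t))"
      by (auto simp: Gamma_eq_zero_iff intro: has_field_derivative_Gamma)
    have "((\<lambda>w. z + w) has_field_derivative 1) (at (of_real t))" by (auto intro!: derivative_eq_intros)
    from DERIV_ln_norm_of_real[OF DERIV_chain2[OF d this]] nz
    have d': "((\<lambda>t. ln (norm (Gamma (z + of_real t)))) has_real_derivative Re (Digamma (z + of_real t))) (at t)"
      by simp
    have "(Q has_real_derivative (ln (norm z) + 4 * t - Re (Digamma (z + of_real t)))) (at t)"
      unfolding Q_def by (rule DERIV_diff[OF _ d']) (auto intro!: derivative_eq_intros)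
    moreover have "0 \<le> ln (norm z) + 4 * t - Re (Digamma (z + of_real t))"
      using Re_Digamma_shift_le[OF z t(1)] by simp
    ultimately show "\<exists>y. (Q has_real_derivative y) (at t) \<and> 0 \<le> y" by blast
  qed
  then show ?thesis by (simp add: Q_def)
qed

lemma lambda0_props:
  assumes "lambda0 \<le> t"
  shows "exp (- t) \<le> t + t\<^sup>2 / 2" "2 / 5 \<le> t"
proof -
  have l: "0 < lambda0" "exp (- lambda0) = lambda0 + lambda0\<^sup>2 / 2"
    using theI'[OF lambda0_ex1] unfolding lambda0_def by auto
  have "exp (- t) \<le> exp (- lambda0)" using assms by simp
  also have "\<dots> = lambda0 + lambda0\<^sup>2 / 2" by (rule l(2))
  also have "\<dots> \<le> t + t\<^sup>2 / 2" using l(1) assms by (intro add_mono divide_right_mono power_mono) auto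
  finally show "exp (- t) \<le> t + t\<^sup>2 / 2" .
  \<comment> \<open>Below 2/5 the left side of 1 - t <= e^-t exceeds 3/5, while t + t^2/2 is less
    than 12/25.\<close>
  have "2 / 5 \<le> lambda0"
  proof (rule ccontr)
    assume "\<not> 2 / 5 \<le> lambda0"
    then have less: "lambda0 < 2 / 5" by simp
    have "1 - lambda0 \<le> exp (- lambda0)" using exp_ge_add_one_self[of "- lambda0"] by simp
    moreover have "lambda0\<^sup>2 \<le> (2 / 5)\<^sup>2" using l(1) less by (intro power_mono) auto
    ultimately show False using l(2) less by (simp add: power2_eq_square)
  qed
  then show "2 / 5 \<le> t" using assms by simp
qed

text \<open>Each term t / (t^2 + |r|^2) of Re f'/f(t), divided by t, decreases in t, so Re f'/f(t)
  >= t F / y for t <= y. Integration over [0, y] gives y F / 2. The assumption \<open>center\<close>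
  removes the constant from the partial fraction expansion.\<close>

lemma ln_norm_growth_imaginary_zeros:
  fixes f :: "complex \<Rightarrow> complex"
  assumes f: "f holomorphic_on UNIV" "f 0 \<noteq> 0"
    and growth: "\<And>z. norm (f z) \<le> K * exp (norm z powr p)" and p: "0 \<le> p" "p < 2"
    and zeros: "\<And>r. f r = 0 \<Longrightarrow> Re r = 0" and center: "Re (deriv f 0 / f 0) = 0" and y: "0 < y"
  defines "F \<equiv> Re (deriv f (of_real y) / f (of_real y))"
  shows "0 \<le> F" "y * F / 2 \<le> ln (norm (f (of_real y))) - ln (norm (f 0))"
    "((\<lambda>r. real (nat (zorder f r)) / (norm (of_real y - r))\<^sup>2) has_sum F / y) {r. f r = 0}"
proof -
  have hs: "((\<lambda>r. real (nat (zorder f r)) * t / (t\<^sup>2 + (norm r)\<^sup>2)) has_sum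
       Re (deriv f (of_real t) / f (of_real t))) {r. f r = 0}" if "0 < t" for t
    using imaginary_zeros_Re_logderiv[OF f growth p zeros that] center by simp
  show F0: "0 \<le> F" unfolding F_def using y by (intro has_sum_nonneg[OF hs[OF y]]) auto
  have ge: "t * F / y \<le> Re (deriv f (of_real t) / f (of_real t))" if t: "0 < t" "t \<le> y" for t
  proof -
    have "((\<lambda>r. t / y * (real (nat (zorder f r)) * y / (y\<^sup>2 + (norm r)\<^sup>2))) has_sum t / y * F) {r. f r = 0}"
      unfolding F_def by (intro has_sum_cmult_right hs y)
    then have "t / y * F \<le> Re (deriv f (of_real t) / f (of_real t))"
    proof (rule has_sum_mono[OF _ hs[OF t(1)]])
      fix r :: complex
      have "t\<^sup>2 + (norm r)\<^sup>2 \<le> y\<^sup>2 + (norm r)\<^sup>2" using t by (intro add_right_mono power_mono) auto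
      moreover have "0 < t\<^sup>2 + (norm r)\<^sup>2" "0 < y\<^sup>2 + (norm r)\<^sup>2" using t by (simp_all add: add_pos_nonneg)
      ultimately have "real (nat (zorder f r)) * t / (y\<^sup>2 + (norm r)\<^sup>2) \<le> real (nat (zorder f r)) * t / (t\<^sup>2 + (norm r)\<^sup>2)"
        using t by (intro divide_left_mono mult_pos_pos) auto
      then show "t / y * (real (nat (zorder f r)) * y / (y\<^sup>2 + (norm r)\<^sup>2)) \<le> real (nat (zorder f r)) * t / (t\<^sup>2 + (norm r)\<^sup>2)"
        using y by (simp add: mult_ac)
    qed
    then show ?thesis by simp
  qed
  define Q where "Q = (\<lambda>t. ln (norm (f (of_real t))) - t\<^sup>2 * F / (2 * y))"
  have "Q 0 \<le> Q y"
  proof (rule DERIV_nonneg_imp_nondecreasing[where f = Q])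
    fix t assume t: "0 \<le> t" "t \<le> y"
    have nz: "f (of_real t) \<noteq> 0" using zeros[of "of_real t"] f(2) by (cases "t = 0") auto
    have "(f has_field_derivative deriv f (of_real t)) (at (of_real t))"
      using f(1) holomorphic_derivI open_UNIV by blast
    from DERIV_ln_norm_of_real[OF this nz]
    have "(Q has_real_derivative (Re (deriv f (of_real t) / f (of_real t)) - t * F / y)) (at t)"
      unfolding Q_def by (rule DERIV_diff) (use y in \<open>auto intro!: derivative_eq_intros\<close>)
    moreover have "0 \<le> Re (deriv f (of_real t) / f (of_real t)) - t * F / y"
      using ge[of t] t center by (cases "t = 0") auto
    ultimately show "\<exists>d. (Q has_real_derivative d) (at t) \<and> 0 \<le> d" by blast
  qed (use y in simp)
  moreover have "y\<^sup>2 * F / (2 * y) = y * F / 2" using y by (simp add: power2_eq_square)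
  ultimately show "y * F / 2 \<le> ln (norm (f (of_real y))) - ln (norm (f 0))" by (simp add: Q_def)
  have "((\<lambda>r. 1 / y * (real (nat (zorder f r)) * y / (y\<^sup>2 + (norm r)\<^sup>2))) has_sum 1 / y * F) {r. f r = 0}"
    unfolding F_def by (intro has_sum_cmult_right hs y)
  then have "((\<lambda>r. real (nat (zorder f r)) / (norm (of_real y - r))\<^sup>2) has_sum 1 / y * F) {r. f r = 0}"
  proof (rule has_sum_cong[THEN iffD1, rotated])
    fix r assume "r \<in> {r. f r = 0}"
    then have "(norm (of_real y - r))\<^sup>2 = y\<^sup>2 + (norm r)\<^sup>2" using zeros[of r] by (simp add: cmod_power2)
    then show "1 / y * (real (nat (zorder f r)) * y / (y\<^sup>2 + (norm r)\<^sup>2)) = real (nat (zorder f r)) / (norm (of_real y - r))\<^sup>2"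
      using y by simp
  qed
  then show "((\<lambda>r. real (nat (zorder f r)) / (norm (of_real y - r))\<^sup>2) has_sum F / y) {r. f r = 0}" by simp
qed

section \<open>Sums over the trivial zeros\<close>

lemma has_sum_Plus:
  fixes g :: "'a + 'b \<Rightarrow> 'c :: topological_comm_monoid_add"
  assumes "((\<lambda>x. g (Inl x)) has_sum s) A" "((\<lambda>x. g (Inr x)) has_sum t) B"
  shows "(g has_sum (s + t)) (A <+> B)"
  unfolding Plus_def
proof (rule has_sum_Un_disjoint)
  show "(g has_sum s) (Inl ` A)" using assms(1) by (subst has_sum_reindex) (auto simp: o_def)
  show "(g has_sum t) (Inr ` B)" using assms(2) by (subst has_sum_reindex) (auto simp: o_def)
qed auto

text \<open>The zeros of \<open>L\<close> at the poles of the Gamma factors, shifted by \<open>- 1/2\<close> like all other zeros.\<close>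

definition trivial_zero :: "L_data \<Rightarrow> nat \<times> nat \<Rightarrow> complex" where
  "trivial_zero f i = - (1 / 2 + lshift f (fst i) + 2 * of_nat (snd i))"

text \<open>Pairs of a Gamma factor and a pole number, so that coinciding poles are counted with
  multiplicity.\<close>

abbreviation trivial_index :: "L_data \<Rightarrow> (nat \<times> nat) set" where
  "trivial_index f \<equiv> {1..ldeg f} \<times> UNIV"

lemma Re_trivial_zero:
  assumes "L_function f" "i \<in> trivial_index f"
  shows "Re (trivial_zero f i) \<le> - (1 / 2 + 2 * real (snd i))"
  using assms by (auto simp: L_function_def trivial_zero_def)

lemma summable_on_trivial_index:
  assumes "g summable_on (UNIV :: nat set)" "\<And>n. 0 \<le> g n"
  shows "(\<lambda>i. g (snd i) :: real) summable_on trivial_index f"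
  by (rule summable_on_SigmaI[where g = "\<lambda>_. infsum g UNIV"]) (use assms in auto)

lemma trivial_zero_summable:
  assumes f: "L_function f"
  shows "(\<lambda>i. 1 / (norm (1 - trivial_zero f i))\<^sup>2) summable_on trivial_index f"
proof -
  have "summable (\<lambda>n. inverse ((real n)\<^sup>2))" by (rule inverse_power_summable) simp
  then have "summable (\<lambda>n. 1 / (real n + 1)\<^sup>2)"
    by (subst (asm) summable_Suc_iff[symmetric]) (simp add: divide_inverse add.commute)
  then have "(\<lambda>n. 1 / (real n + 1)\<^sup>2) summable_on UNIV"
    by (subst summable_on_UNIV_nonneg_real_iff) auto
  then have 1: "(\<lambda>i. 1 / (real (snd i) + 1)\<^sup>2) summable_on trivial_index f"
    by (rule summable_on_trivial_index) simp
  have 2: "norm (1 / (norm (1 - trivial_zero f i))\<^sup>2) \<le> 1 / (real (snd i) + 1)\<^sup>2" if i: "i \<in> trivial_index f" for i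
  proof -
    have "real (snd i) + 1 \<le> Re (1 - trivial_zero f i)" using Re_trivial_zero[OF f i] by simp
    also have "\<dots> \<le> norm (1 - trivial_zero f i)" by (rule complex_Re_le_cmod)
    finally show ?thesis by (auto intro!: divide_left_mono power_mono mult_pos_pos)
  qed
  show ?thesis
    by (rule abs_summable_summable[OF Infinite_Sum.abs_summable_on_comparison_test'[OF 1 2]])
qed

lemma Digamma_diff_sums:
  fixes a b :: complex
  assumes "a \<noteq> 0" "b \<noteq> 0"
  shows "(\<lambda>n. 1 / (a + of_nat n) - 1 / (b + of_nat n)) sums (Digamma b - Digamma a)"
proof -
  have s: "(\<lambda>k. inverse (of_nat (Suc k)) - inverse (z + of_nat k)) sums (Digamma z + of_real euler_mascheroni)"
    if "z \<noteq> 0" for z :: complex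
    using summable_sums[OF summable_Digamma[OF that]] by (simp add: Digamma_def)
  show ?thesis using sums_diff[OF s[OF assms(2)] s[OF assms(1)]] by (simp add: inverse_eq_divide)
qed

text \<open>The partial fractions of Digamma at (s + k_j)/2 have their poles at the trivial zeros;
  the factor 1/2 comes from s - z = 2 (a + n). The conductor and pi terms cancel in the difference.
  Unordered convergence comes from \<open>summable_on_inverse_diff\<close>, the values from the
  ordinary series in n.\<close>

lemma trivial_zero_has_sum:
  assumes f: "L_function f" and s: "0 < Re s" and t: "0 < Re t"
  shows "((\<lambda>i. 1 / (s - trivial_zero f i) - 1 / (t - trivial_zero f i)) has_sum
    L_prefactor_logderiv f (1 / 2 + t) - L_prefactor_logderiv f (1 / 2 + s)) (trivial_index f)"
proof -
  define g where "g = (\<lambda>i. 1 / (s - trivial_zero f i) - 1 / (t - trivial_zero f i))"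
  have Rez: "Re (trivial_zero f i) \<le> 0" if "i \<in> trivial_index f" for i using Re_trivial_zero[OF f that] by simp
  have "(\<lambda>i. of_real 1 * (1 / (s - trivial_zero f i) - 1 / (t - trivial_zero f i))) summable_on trivial_index f"
    by (rule summable_on_inverse_diff) (use Rez trivial_zero_summable[OF f] s t in auto)
  then have sm: "g summable_on trivial_index f" by (simp add: g_def)
  define a where "a = (\<lambda>s j. (1 / 2 + s + lshift f j) / 2)"
  have "((\<lambda>n. g (j, n)) has_sum (Digamma (a t j) - Digamma (a s j)) / 2) UNIV" if j: "j \<in> {1..ldeg f}" for j
  proof -
    have k: "0 \<le> Re (lshift f j)" using f j by (auto simp: L_function_def)
    have nz: "a s j \<noteq> 0" "a t j \<noteq> 0" using s t k by (auto simp: a_def complex_eq_iff)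
    have eq: "g (j, n) = (1 / (a s j + of_nat n) - 1 / (a t j + of_nat n)) / 2" for n
    proof -
      have "s - trivial_zero f (j, n) = 2 * (a s j + of_nat n)" "t - trivial_zero f (j, n) = 2 * (a t j + of_nat n)"
        by (simp_all add: a_def trivial_zero_def)
      moreover have "1 / (2 * u) - 1 / (2 * v) = (1 / u - 1 / v) / 2" for u v :: complex
        by (simp add: diff_divide_distrib mult.commute)
      ultimately show ?thesis by (simp only: g_def)
    qed
    have sums: "(\<lambda>n. g (j, n)) sums ((Digamma (a t j) - Digamma (a s j)) / 2)"
      unfolding eq by (intro sums_divide Digamma_diff_sums nz)
    have "(\<lambda>n. g (j, n)) summable_on UNIV"
      using summable_on_SigmaD1[of "\<lambda>x y. g (x, y)" "{1..ldeg f}" "\<lambda>_. UNIV" j] sm j by simp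
    then have "((\<lambda>n. g (j, n)) has_sum infsum (\<lambda>n. g (j, n)) UNIV) UNIV" by simp
    moreover have "infsum (\<lambda>n. g (j, n)) UNIV = (Digamma (a t j) - Digamma (a s j)) / 2"
      using has_sum_imp_sums[OF calculation] sums sums_unique2 by blast
    ultimately show ?thesis by simp
  qed
  moreover have "((\<lambda>j. (Digamma (a t j) - Digamma (a s j)) / 2) has_sum
     (\<Sum>j=1..ldeg f. (Digamma (a t j) - Digamma (a s j)) / 2)) {1..ldeg f}" by (rule has_sum_finite) simp
  ultimately have "(g has_sum (\<Sum>j=1..ldeg f. (Digamma (a t j) - Digamma (a s j)) / 2)) (trivial_index f)"
    using sm by (rule has_sum_SigmaI)
  moreover have "(\<Sum>j=1..ldeg f. (Digamma (a t j) - Digamma (a s j)) / 2)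
     = L_prefactor_logderiv f (1 / 2 + t) - L_prefactor_logderiv f (1 / 2 + s)"
    by (simp add: L_prefactor_logderiv_def a_def sum_divide_distrib[symmetric] sum_subtractf diff_divide_distrib add_ac)
  ultimately show ?thesis by (simp add: g_def)
qed

text \<open>The n-th trivial zero of a Gamma factor has weight at most x^(-1/2) x^(-2n) <= x^(-1/2)
  25^-n, and |y - z| >= 1/2 costs a factor 4. The geometric series gives 4 (25/24) = 25/6 for each
  of the d factors.\<close>

lemma trivial_zero_weighted_sum:
  assumes f: "L_function f" and x: "5 \<le> x" and y: "0 < y"
  obtains S where "((\<lambda>i. exp (Re (trivial_zero f i) * ln x) / (norm (of_real y - trivial_zero f i))\<^sup>2) has_sum S) (trivial_index f)"
    "S \<le> real (ldeg f) * (25 / 6) / x powr (1 / 2)"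
proof -
  define v where "v = (\<lambda>n::nat. 4 / x powr (1 / 2) * (1 / 25) ^ n)"
  have v0: "0 \<le> v n" for n using x by (simp add: v_def)
  have "(\<lambda>n. (1 / 25) ^ n) sums (1 / (1 - 1 / 25 :: real))" by (rule geometric_sums) simp
  from sums_mult[OF this, of "4 / x powr (1 / 2)"]
  have "v sums (4 / x powr (1 / 2) * (25 / 24))" by (simp add: v_def)
  then have vs: "(v has_sum (4 / x powr (1 / 2) * (25 / 24))) UNIV"
    using v0 by (intro norm_summable_imp_has_sum) (auto simp: sums_iff)
  have "((\<lambda>i. v (snd i)) has_sum (\<Sum>j=1..ldeg f. 4 / x powr (1 / 2) * (25 / 24))) (trivial_index f)"
  proof (rule has_sum_SigmaI)
    show "((\<lambda>n. v (snd (j, n))) has_sum (4 / x powr (1 / 2) * (25 / 24))) UNIV" for j :: nat using vs by simp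
    show "(\<lambda>i. v (snd i)) summable_on trivial_index f"
      using vs v0 by (intro summable_on_trivial_index) (auto intro: has_sum_imp_summable)
  qed (rule has_sum_finite, simp)
  then have vs': "((\<lambda>i. v (snd i)) has_sum (real (ldeg f) * (25 / 6) / x powr (1 / 2))) (trivial_index f)" by simp
  define g where "g = (\<lambda>i. exp (Re (trivial_zero f i) * ln x) / (norm (of_real y - trivial_zero f i))\<^sup>2)"
  have le: "norm (g i) \<le> v (snd i)" if i: "i \<in> trivial_index f" for i
  proof -
    define n where "n = snd i"
    have Re: "Re (trivial_zero f i) \<le> - (1 / 2 + 2 * real n)" using Re_trivial_zero[OF f i] by (simp add: n_def)
    have lx: "0 < ln x" using x by simp
    have "exp (Re (trivial_zero f i) * ln x) \<le> exp (- (1 / 2 + 2 * real n) * ln x)"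
      using Re lx by (simp add: mult_right_mono)
    also have "\<dots> = x powr (- (1 / 2 + 2 * real n))" using x by (simp add: powr_def)
    also have "\<dots> = 1 / x powr (1 / 2) * (1 / x\<^sup>2) ^ n"
    proof -
      have "x powr (1 / 2 + 2 * real n) = x powr (1 / 2) * (x\<^sup>2) ^ n"
        using x powr_realpow[of x "2 * n"] by (simp add: powr_add power_mult)
      then show ?thesis unfolding powr_minus_divide by (simp add: power_one_over)
    qed
    also have "\<dots> \<le> 1 / x powr (1 / 2) * (1 / 25) ^ n"
    proof -
      have "5\<^sup>2 \<le> x\<^sup>2" using x by (intro power_mono) auto
      then show ?thesis using x by (intro mult_left_mono power_mono) (auto simp: field_simps)
    qed
    finally have e: "exp (Re (trivial_zero f i) * ln x) \<le> 1 / x powr (1 / 2) * (1 / 25) ^ n" .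
    have "1 / 2 \<le> Re (of_real y - trivial_zero f i)" using Re y by simp
    also have "\<dots> \<le> norm (of_real y - trivial_zero f i)" by (rule complex_Re_le_cmod)
    finally have "(1 / 2)\<^sup>2 \<le> (norm (of_real y - trivial_zero f i))\<^sup>2" by (intro power_mono) auto
    then have "exp (Re (trivial_zero f i) * ln x) / (norm (of_real y - trivial_zero f i))\<^sup>2
       \<le> (1 / x powr (1 / 2) * (1 / 25) ^ n) / (1 / 2)\<^sup>2"
      using e by (intro frac_le) auto
    then show ?thesis by (simp add: g_def v_def n_def power_divide mult.commute)
  qed
  have "g summable_on trivial_index f"
    by (rule abs_summable_summable[OF Infinite_Sum.abs_summable_on_comparison_test'[OF has_sum_imp_summable[OF vs'] le]])
  then have gs: "(g has_sum infsum g (trivial_index f)) (trivial_index f)" by simp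
  have "infsum g (trivial_index f) \<le> real (ldeg f) * (25 / 6) / x powr (1 / 2)"
    using le by (intro has_sum_mono[OF gs vs']) (auto intro: order_trans[OF abs_ge_self])
  then show thesis using that gs by (simp add: g_def)
qed

text \<open>To be read with \<open>L0 = log |L(1/2)|\<close>, \<open>P = log |L(1/2 + y)|\<close>, \<open>RD = - Re L'/L(1/2 + y)\<close>,
  \<open>A\<close> the Dirichlet polynomial, \<open>S\<close> the contribution of the trivial zeros, and \<open>B + Lam\<close> the
  logarithm of the analytic conductor.\<close>

lemma final_estimate:
  fixes T lam L0 P F A B Psi GG RD S Lam :: real
  assumes T: "2 \<le> T" and lam: "exp (- lam) \<le> lam + lam\<^sup>2 / 2" "2 / 5 \<le> lam"
    and y: "y = lam / T" and F: "0 \<le> F" and d: "0 \<le> d" and w: "0 \<le> w" "w \<le> 1 / 2"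
    and S: "S \<le> d * (25 / 6) * w"
    and bracket: "T * P - RD - T * A \<le> (F / y + S) * exp (- lam) / T"
    and logderiv: "F = B / 2 + Psi / 2 - RD"
    and growth: "y * F / 2 \<le> (y / 2 * B + GG + P) - L0"
    and Psi: "Psi \<le> Lam + d * (2 * y)"
    and GG: "GG \<le> y / 2 * Lam + d * (2 * (y / 2)\<^sup>2)"
  shows "L0 \<le> A + (1 + lam) / 2 * ((B + Lam) / T) + (lam\<^sup>2 + lam) * d / T\<^sup>2 + 4 * d * exp (- lam) * w / T\<^sup>2"
proof -
  have T0: "T > 0" using T by simp
  have lam0: "lam > 0" using lam by simp
  have y0: "y > 0" using y T0 lam0 by simp
  have "P = (T * P - RD - T * A) / T + RD / T + A" using T0 by (simp add: field_simps)
  also have "(T * P - RD - T * A) / T \<le> (F / y + S) * exp (- lam) / T / T"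
    using bracket T0 by (intro divide_right_mono) auto
  also have "RD / T \<le> (B / 2 + (Lam + d * (2 * y)) / 2 - F) / T"
    using logderiv Psi T0 by (intro divide_right_mono) auto
  finally have P: "P \<le> (F / y + S) * exp (- lam) / T / T + (B / 2 + (Lam + d * (2 * y)) / 2 - F) / T + A" by simp
  have "L0 \<le> y / 2 * B + (y / 2 * Lam + d * (2 * (y / 2)\<^sup>2)) + P - y * F / 2"
    using growth GG by linarith
  also have "\<dots> \<le> y / 2 * B + (y / 2 * Lam + d * (2 * (y / 2)\<^sup>2))
      + ((F / y + S) * exp (- lam) / T / T + (B / 2 + (Lam + d * (2 * y)) / 2 - F) / T + A) - y * F / 2"
    using P by simp
  \<comment> \<open>The coefficient of F collects e^-lam / lam from the zeros in
    \<open>bracket\<close>, -1 from \<open>logderiv\<close> and - lam/2 from \<open>growth\<close>.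
    The Gamma factors produce lam^2/2 + lam, so half of lam^2 remains available.\<close>
  also have "\<dots> = A + (1 + lam) / 2 * ((B + Lam) / T) + (lam\<^sup>2 / 2 + lam) * d / T\<^sup>2
      + S * exp (- lam) / T\<^sup>2 + F / T * (exp (- lam) / lam - 1 - lam / 2)"
    unfolding y using T0 lam0 by (simp add: field_simps power2_eq_square)
  also have "\<dots> \<le> A + (1 + lam) / 2 * ((B + Lam) / T) + (lam\<^sup>2 / 2 + lam) * d / T\<^sup>2
      + (4 * d * exp (- lam) * w / T\<^sup>2 + lam\<^sup>2 / 2 * d / T\<^sup>2) + 0"
  proof (intro add_mono order_refl)
    have "exp (- lam) / lam \<le> 1 + lam / 2" using lam lam0 by (simp add: field_simps power2_eq_square)
    then have "exp (- lam) / lam - 1 - lam / 2 \<le> 0" by linarith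
    moreover have "0 \<le> F / T" using F T0 by simp
    ultimately show "F / T * (exp (- lam) / lam - 1 - lam / 2) \<le> 0" by (rule mult_nonneg_nonpos[rotated])
    have e: "exp (- lam) \<le> 5 / 7"
    proof -
      have "7 / 5 \<le> exp lam" using exp_ge_add_one_self[of lam] lam by linarith
      then have "inverse (exp lam) \<le> inverse (7 / 5)" by (intro le_imp_inverse_le) auto
      then show ?thesis by (simp add: exp_minus)
    qed
    have "(2 / 5)\<^sup>2 \<le> lam\<^sup>2" using lam by (intro power_mono) auto
    then have l2: "4 / 25 \<le> lam\<^sup>2" by (simp add: power2_eq_square)
    have we: "w * exp (- lam) \<le> 1 / 2 * (5 / 7)" using w e by (intro mult_mono) auto
    \<comment> \<open>The trivial zeros give 25/6 in place of 4. The surplus d w e^-lam / 6 is at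
      most 5 d / 84, which is below the 2 d / 25 <= d lam^2 / 2 held in reserve.\<close>
    have "S * exp (- lam) \<le> d * (25 / 6) * w * exp (- lam)" using S by (intro mult_right_mono) auto
    also have "\<dots> = 4 * d * exp (- lam) * w + d * (1 / 6 * (w * exp (- lam)))" by (simp add: algebra_simps)
    also have "\<dots> \<le> 4 * d * exp (- lam) * w + d * (lam\<^sup>2 / 2)"
      using d we l2 by (intro add_left_mono mult_left_mono) auto
    finally have "S * exp (- lam) / T\<^sup>2 \<le> (4 * d * exp (- lam) * w + d * (lam\<^sup>2 / 2)) / T\<^sup>2"
      by (intro divide_right_mono) auto
    then show "S * exp (- lam) / T\<^sup>2 \<le> 4 * d * exp (- lam) * w / T\<^sup>2 + lam\<^sup>2 / 2 * d / T\<^sup>2"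
      by (simp add: add_divide_distrib mult.commute)
  qed
  also have "\<dots> = A + (1 + lam) / 2 * ((B + Lam) / T) + (lam\<^sup>2 + lam) * d / T\<^sup>2 + 4 * d * exp (- lam) * w / T\<^sup>2"
    by (simp add: add_divide_distrib distrib_right)
  finally show ?thesis .
qed

section \<open>Combination of the estimates\<close>

lemma ln_norm_L_prefactor_diff:
  assumes f: "L_function f" and y: "0 < y"
  defines "z \<equiv> \<lambda>j. 1 / 4 + lshift f j / 2"
  shows "ln (norm (L_prefactor f (1 / 2 + of_real y))) - ln (norm (L_prefactor f (1 / 2)))
    = y / 2 * (ln (real (lcond f)) - real (ldeg f) * ln pi)
      + (\<Sum>j=1..ldeg f. ln (norm (Gamma (z j + of_real (y / 2)))) - ln (norm (Gamma (z j))))"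
proof -
  have q: "1 \<le> lcond f" and k: "\<And>j. j \<in> {1..ldeg f} \<Longrightarrow> 0 \<le> Re (lshift f j)"
    using f by (auto simp: L_function_def)
  have *: "ln (norm (L_prefactor f (1 / 2 + of_real t))) =
      (1 / 2 + t) / 2 * ln (real (lcond f)) - real (ldeg f) * (1 / 2 + t) / 2 * ln pi
      + (\<Sum>j=1..ldeg f. ln (norm (Gamma (z j + of_real (t / 2)))))" if t: "0 \<le> t" for t
  proof -
    have arg: "(1 / 2 + of_real t + lshift f j) / 2 = z j + of_real (t / 2)" for j
      by (simp add: z_def field_simps)
    have nz: "Gamma (z j + of_real (t / 2)) \<noteq> 0" if "j \<in> {1..ldeg f}" for j
      using k[OF that] t nonpos_Ints_Re_pos[of "z j + of_real (t / 2)"]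
      by (simp add: Gamma_eq_zero_iff z_def)
    have "norm (L_prefactor f (1 / 2 + of_real t)) = real (lcond f) powr ((1 / 2 + t) / 2)
       * (pi powr (- (real (ldeg f) * (1 / 2 + t) / 2)) * (\<Prod>j=1..ldeg f. norm (Gamma (z j + of_real (t / 2)))))"
      using q by (simp add: L_prefactor_def gamma_factor_def norm_mult norm_powr_real_powr arg prod_norm[symmetric])
    also have "ln \<dots> = ln (real (lcond f) powr ((1 / 2 + t) / 2)) + (ln (pi powr (- (real (ldeg f) * (1 / 2 + t) / 2)))
       + ln (\<Prod>j=1..ldeg f. norm (Gamma (z j + of_real (t / 2)))))"
      using q nz by (subst ln_mult ln_mult_pos; auto simp: ln_mult)
    also have "ln (\<Prod>j=1..ldeg f. norm (Gamma (z j + of_real (t / 2))))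
       = (\<Sum>j=1..ldeg f. ln (norm (Gamma (z j + of_real (t / 2)))))"
      using nz by (intro ln_prod) auto
    finally show ?thesis using q by (simp add: ln_powr)
  qed
  show ?thesis using *[of y] *[of 0] y by (simp add: sum_subtractf algebra_simps add_divide_distrib)
qed

theorem theorem2p1:
  fixes f :: L_data and a :: "nat \<Rightarrow> complex" and x lam :: real
  assumes "L_function f"
    and "neg_log_deriv_coeffs f a"
    and "no_pole_or_zero (completed_L f) 0" and "no_pole_or_zero (completed_L f) 1"
    and "GRH f"
    and "0 < x" and "2 \<le> ln x" and "lam \<le> ln x / 2" and "lambda0 \<le> lam"
  shows "log_norm (lfun f (1 / 2)) \<le> ereal (
      Re (\<Sum>n | 2 \<le> n \<and> real n \<le> x.
            a n / (of_nat n powr of_real (1 / 2 + lam / ln x) * of_real (ln (real n)))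
              * of_real (ln (x / real n) / ln x))
      + (1 + lam) / 2 * (ln (analytic_conductor f) / ln x)
      + (lam\<^sup>2 + lam) * real (ldeg f) / (ln x)\<^sup>2
      + 4 * real (ldeg f) * exp (- lam) / (x powr (1 / 2) * (ln x)\<^sup>2))"
proof (cases "lfun f (1 / 2) = 0")
  case True
  then show ?thesis by (simp add: log_norm_def)
next
  case False
  note f = assms(1) and np = assms(3,4) and T2 = assms(7)
  define T where "T = ln x"
  define y where "y = lam / T"
  note lam = lambda0_props[OF assms(9)]
  have T: "2 \<le> T" using T2 by (simp add: T_def)
  have y: "0 < y" using lam T by (simp add: y_def)
  \<comment> \<open>e^2 >= 1 + 2 + 2; this is the 5 behind the ratio 1/25 in the sum over the
    trivial zeros.\<close>
  have x5: "5 \<le> x"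
  proof -
    have "5 \<le> exp (2::real)" using exp_lower_Taylor_quadratic[of 2] by (simp add: power2_eq_square)
    also have "\<dots> \<le> exp T" using T by simp
    also have "\<dots> = x" using assms(6) by (simp add: T_def)
    finally show ?thesis .
  qed
  define X where "X = (\<lambda>w. completed_L f (1 / 2 + w))"
  have Xhol: "X holomorphic_on UNIV"
    unfolding X_def by (intro holomorphic_on_compose_gen[OF _ completed_L_entire[OF f np], unfolded o_def] holomorphic_intros) auto
  have Xeq: "X w = L_prefactor f (1 / 2 + w) * lfun f (1 / 2 + w)" if "0 \<le> Re w" for w
    unfolding X_def by (rule completed_L_right_half_plane(1)[OF f np]) (use that in simp)
  have X0: "X 0 \<noteq> 0" using Xeq[of 0] False L_prefactor_nonzero[OF f, of "1 / 2"] by simp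
  have nopole: "\<not> is_pole (completed_L f) s" for s
    using completed_L_entire[OF f np] by (intro analytic_at_imp_no_pole) (metis UNIV_I analytic_at open_UNIV)
  have zeros: "Re r = 0" if "X r = 0" for r
    using assms(5) nopole that unfolding GRH_def X_def by fastforce
  obtain K p where p: "0 \<le> p" "p < 2"
    and "\<And>w. norm (completed_L f (1 / 2 + w)) \<le> K * exp (norm w powr p)"
    by (rule completed_L_growth[OF f np], rule that)
  then have growth: "norm (X w) \<le> K * exp (norm w powr p)" for w by (simp add: X_def)
  have dshift: "deriv (\<lambda>w. F (1 / 2 + w)) w = deriv F (1 / 2 + w)" if "F field_differentiable at (1 / 2 + w)" for F :: "complex \<Rightarrow> complex" and w
  proof -
    have "(F has_field_derivative deriv F (1 / 2 + w)) (at (1 / 2 + w))"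
      using that field_differentiable_derivI by blast
    then have "((\<lambda>w. F (1 / 2 + w)) has_field_derivative deriv F (1 / 2 + w) * 1) (at w)"
      by (rule DERIV_chain2) (auto intro!: derivative_eq_intros)
    then show ?thesis by (auto dest: DERIV_imp_deriv)
  qed
  have center: "Re (deriv X 0 / X 0) = 0"
  proof -
    have "completed_L f field_differentiable at (1 / 2 + 0)"
      using completed_L_entire[OF f np] holomorphic_on_imp_differentiable_at[of "completed_L f" UNIV] by simp
    then have "deriv X 0 = deriv (completed_L f) (1 / 2)" unfolding X_def by (subst dshift) auto
    then show ?thesis
      using completed_L_logderiv_center[OF f np] X0 by (simp add: X_def)
  qed
  define l where "l = (\<lambda>w. lfun f (1 / 2 + w))"
  define D where "D = (\<lambda>w. - (deriv (lfun f) (1 / 2 + w) / lfun f (1 / 2 + w)))"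
  have lnz: "lfun f (1 / 2 + w) \<noteq> 0" if "0 < Re w" for w
    using Xeq[of w] zeros[of w] that by auto
  have Ld: "lfun f field_differentiable at (1 / 2 + w)" if "0 < Re w" for w
    by (rule completed_L_right_half_plane(2)[OF f np]) (use that in simp)
  have logd: "deriv X w / X w = L_prefactor_logderiv f (1 / 2 + w) - D w" if w: "0 < Re w" for w
  proof -
    have s: "0 < Re (1 / 2 + w)" using w by simp
    have "((\<lambda>s. L_prefactor f s * lfun f s) has_field_derivative
       L_prefactor f (1 / 2 + w) * L_prefactor_logderiv f (1 / 2 + w) * lfun f (1 / 2 + w)
       + deriv (lfun f) (1 / 2 + w) * L_prefactor f (1 / 2 + w)) (at (1 / 2 + w))"
      by (intro DERIV_mult L_prefactor_deriv[OF f s] field_differentiable_derivI Ld w)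
    from DERIV_imp_deriv[OF this]
    have 1: "deriv (\<lambda>s. L_prefactor f s * lfun f s) (1 / 2 + w) =
       L_prefactor f (1 / 2 + w) * L_prefactor_logderiv f (1 / 2 + w) * lfun f (1 / 2 + w)
       + deriv (lfun f) (1 / 2 + w) * L_prefactor f (1 / 2 + w)" .
    have "deriv X w = deriv (completed_L f) (1 / 2 + w)"
      unfolding X_def using completed_L_entire[OF f np] holomorphic_on_imp_differentiable_at[of "completed_L f" UNIV]
      by (intro dshift) simp
    also have "\<dots> = deriv (\<lambda>s. L_prefactor f s * lfun f s) (1 / 2 + w)"
    proof (rule deriv_cong_ev)
      have "\<forall>\<^sub>F s in nhds (1 / 2 + w). s \<in> {s. 0 < Re s}"
        using s by (intro eventually_nhds_in_open open_halfspace_Re_gt) auto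
      then show "\<forall>\<^sub>F s in nhds (1 / 2 + w). completed_L f s = L_prefactor f s * lfun f s"
        by eventually_elim (use completed_L_right_half_plane(1)[OF f np] in auto)
    qed simp
    finally have "deriv X w = \<dots>" .
    then show ?thesis
      unfolding 1 Xeq[OF less_imp_le[OF w]] D_def using lnz[OF w] L_prefactor_nonzero[OF f s] by (simp add: field_simps)
  qed
  define Z where "Z = {r. X r = 0}"
  define m where "m = (\<lambda>r. real (nat (zorder X r)))"
  \<comment> \<open>A disjoint sum keeps the two kinds of zeros apart: those of X carry their order,
    and each Gamma pole counts once.\<close>
  define I where "I = Z <+> trivial_index f"
  define mI :: "complex + nat \<times> nat \<Rightarrow> real" where "mI = case_sum m (\<lambda>_. 1)"
  define zI where "zI = case_sum (\<lambda>r. r) (trivial_zero f)"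
  obtain c0 where c0: "\<And>s. c0 < Re s \<Longrightarrow> ((\<lambda>n. a n / of_nat n powr s) has_sum - (deriv (lfun f) s / lfun f s)) {1..}"
    using assms(2) unfolding neg_log_deriv_coeffs_def by blast
  define c where "c = max c0 0"
  \<comment> \<open>The factor n^(-1/2) moves the centre 1/2 to the origin and makes D a Dirichlet
    series in w.\<close>
  define b where "b = (\<lambda>n. a n / of_nat n powr (1 / 2))"
  have powr_half: "u n / of_nat n powr (1 / 2 + s) = u n / of_nat n powr (1 / 2) / of_nat n powr s"
    for u :: "nat \<Rightarrow> complex" and n s by (simp add: powr_add)
  interpret zeros_and_dirichlet I mI zI D b c
  proof
    show "0 \<le> mI i" if "i \<in> I" for i by (cases i) (auto simp: mI_def m_def)
    show "Re (zI i) \<le> 0" if "i \<in> I" for i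
    proof (cases i)
      case (Inl r)
      then have "X r = 0" using that by (auto simp: I_def Z_def)
      then show ?thesis using zeros Inl by (simp add: zI_def)
    next
      case (Inr j)
      then have "j \<in> trivial_index f" using that by (auto simp: I_def)
      from Re_trivial_zero[OF f this] show ?thesis using Inr by (simp add: zI_def)
    qed
    show "(\<lambda>i. mI i / (norm (1 - zI i))\<^sup>2) summable_on I"
    proof -
      have "((\<lambda>r. m r / (norm (1 - r))\<^sup>2) has_sum infsum (\<lambda>r. m r / (norm (1 - r))\<^sup>2) Z) Z"
        using imaginary_zeros_summable[OF Xhol X0 growth p zeros] unfolding Z_def m_def by simp
      moreover have "((\<lambda>i. 1 / (norm (1 - trivial_zero f i))\<^sup>2) has_sum
          infsum (\<lambda>i. 1 / (norm (1 - trivial_zero f i))\<^sup>2) (trivial_index f)) (trivial_index f)"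
        using trivial_zero_summable[OF f] by simp
      ultimately show ?thesis unfolding I_def
        by (intro has_sum_imp_summable[OF has_sum_Plus]) (auto simp: mI_def zI_def)
    qed
    show "((\<lambda>i. of_real (mI i) * (1 / (t - zI i) - 1 / (s - zI i))) has_sum D s - D t) I"
      if st: "0 < Re s" "0 < Re t" for s t
    proof -
      have "((\<lambda>r. of_real (m r) * (1 / (t - r) - 1 / (s - r))) has_sum deriv X t / X t - deriv X s / X s) Z"
        unfolding Z_def m_def by (rule imaginary_zeros_logderiv[OF Xhol X0 growth p zeros st(2,1)])
      moreover have "((\<lambda>i. 1 / (t - trivial_zero f i) - 1 / (s - trivial_zero f i)) has_sum
          L_prefactor_logderiv f (1 / 2 + s) - L_prefactor_logderiv f (1 / 2 + t)) (trivial_index f)"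
        by (rule trivial_zero_has_sum[OF f st(2,1)])
      ultimately have "((\<lambda>i. of_real (mI i) * (1 / (t - zI i) - 1 / (s - zI i))) has_sum
         (deriv X t / X t - deriv X s / X s) + (L_prefactor_logderiv f (1 / 2 + s) - L_prefactor_logderiv f (1 / 2 + t))) I"
        unfolding I_def by (intro has_sum_Plus) (auto simp: mI_def zI_def)
      then show ?thesis using logd st by simp
    qed
    show "0 \<le> c" by (simp add: c_def)
    show "((\<lambda>n. b n / of_nat n powr s) has_sum D s) {1..}" if "c < Re s" for s
      using c0[of "1 / 2 + s"] that unfolding D_def b_def powr_half c_def by simp
  qed
  define P where "P = (\<lambda>t. ln (norm (l (of_real t))))"
  have dP: "(P has_real_derivative - Re (D (of_real t))) (at t)" if t: "0 < t" for t
  proof -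
    have t': "0 < Re (of_real t)" using t by simp
    have "(lfun f has_field_derivative deriv (lfun f) (1 / 2 + of_real t)) (at (1 / 2 + of_real t))"
      by (intro field_differentiable_derivI Ld t')
    then have "(l has_field_derivative deriv (lfun f) (1 / 2 + of_real t) * 1) (at (of_real t))"
      unfolding l_def by (rule DERIV_chain2) (auto intro!: derivative_eq_intros)
    from DERIV_ln_norm_of_real[OF this] lnz[OF t'] show ?thesis by (simp add: P_def D_def l_def)
  qed
  have P0: "(P \<longlongrightarrow> 0) at_top"
  proof -
    have "((\<lambda>t. l (of_real t)) \<longlongrightarrow> (\<lambda>n. lcoeff f n / of_nat n powr (1 / 2)) 1) at_top"
    proof (rule dirichlet_series_tendsto[where c = 1])
      fix t :: real assume t: "1 < t"
      have "((\<lambda>n. lcoeff f n / of_nat n powr (1 / 2 + of_real t)) has_sum lfun f (1 / 2 + of_real t)) {1..}"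
        using f t unfolding L_function_def by auto
      then show "((\<lambda>n. lcoeff f n / of_nat n powr (1 / 2) / of_nat n powr of_real t) has_sum l (of_real t)) {1..}"
        unfolding powr_half l_def .
    qed
    moreover have "lcoeff f 1 = 1" using f by (simp add: L_function_def)
    ultimately have "((\<lambda>t. l (of_real t)) \<longlongrightarrow> 1) at_top" by simp
    from tendsto_ln[OF tendsto_norm[OF this]] show ?thesis by (simp add: P_def)
  qed
  define F where "F = Re (deriv X (of_real y) / X (of_real y))"
  note imag = ln_norm_growth_imaginary_zeros[OF Xhol X0 growth p zeros center y, folded F_def]
  obtain S where S: "((\<lambda>i. exp (Re (trivial_zero f i) * ln x) / (norm (of_real y - trivial_zero f i))\<^sup>2) has_sum S) (trivial_index f)"
    "S \<le> real (ldeg f) * (25 / 6) / x powr (1 / 2)"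
    using trivial_zero_weighted_sum[OF f x5 y] by blast
  \<comment> \<open>Under GRH the weight exp (Re z ln x) is 1 at every zero of X, so these zeros
    contribute exactly F / y.\<close>
  have Ssum: "((\<lambda>i. mI i * exp (Re (zI i) * ln x) / (norm (of_real y - zI i))\<^sup>2) has_sum F / y + S) I"
    unfolding I_def
  proof (rule has_sum_Plus)
    have "((\<lambda>r. m r / (norm (of_real y - r))\<^sup>2) has_sum F / y) Z"
      using imag(3) by (simp add: Z_def m_def)
    then show "((\<lambda>r. mI (Inl r) * exp (Re (zI (Inl r)) * ln x) / (norm (of_real y - zI (Inl r)))\<^sup>2) has_sum F / y) Z"
      by (rule has_sum_cong[THEN iffD1, rotated]) (auto simp: mI_def zI_def Z_def zeros)
    show "((\<lambda>i. mI (Inr i) * exp (Re (zI (Inr i)) * ln x) / (norm (of_real y - zI (Inr i)))\<^sup>2) has_sum S) (trivial_index f)"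
      using S(1) by (simp add: mI_def zI_def)
  qed
  define A where "A = Re (\<Sum>n | 2 \<le> n \<and> real n \<le> x.
            a n / (of_nat n powr of_real (1 / 2 + lam / ln x) * of_real (ln (real n)))
              * of_real (ln (x / real n) / ln x))"
  have TA: "Re (\<Sum>n | 2 \<le> n \<and> real n \<le> x. b n / (of_nat n powr of_real y * of_real (ln (real n))) * of_real (ln x - ln (real n))) = T * A"
  proof -
    have "(\<Sum>n | 2 \<le> n \<and> real n \<le> x. b n / (of_nat n powr of_real y * of_real (ln (real n))) * of_real (ln x - ln (real n)))
      = of_real T * (\<Sum>n | 2 \<le> n \<and> real n \<le> x.
            a n / (of_nat n powr of_real (1 / 2 + lam / ln x) * of_real (ln (real n)))
              * of_real (ln (x / real n) / ln x))"
      unfolding sum_distrib_left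
    proof (rule sum.cong)
      fix n assume n: "n \<in> {n. 2 \<le> n \<and> real n \<le> x}"
      have 1: "ln x - ln (real n) = T * (ln (x / real n) / ln x)" using n T x5 by (simp add: ln_div T_def)
      have 2: "of_nat n powr complex_of_real (1 / 2 + lam / ln x) = of_nat n powr (1 / 2) * of_nat n powr of_real y"
        by (simp add: powr_add y_def T_def)
      show "b n / (of_nat n powr of_real y * of_real (ln (real n))) * of_real (ln x - ln (real n))
        = of_real T * (a n / (of_nat n powr of_real (1 / 2 + lam / ln x) * of_real (ln (real n))) * of_real (ln (x / real n) / ln x))"
        unfolding 1 2 b_def by (simp add: mult_ac)
    qed simp
    then show ?thesis by (simp add: A_def)
  qed
  have bracket: "T * P y - Re (D (of_real y)) - T * A \<le> (F / y + S) * exp (- lam) / T"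
  proof -
    have e: "- y * ln x = - lam" using T by (simp add: y_def T_def)
    have x1: "1 < x" using x5 by simp
    show ?thesis
      using log_upper_bound[OF dP P0 x1 y Ssum] unfolding TA e unfolding T_def[symmetric] .
  qed
  \<comment> \<open>The Gamma arguments at s = 1/2, and at the same time the factors of the analytic
    conductor, whose logarithm is thus B + Lam.\<close>
  define z where "z = (\<lambda>j. 1 / 4 + lshift f j / 2)"
  have Rez: "1 / 4 \<le> Re (z j)" if "j \<in> {1..ldeg f}" for j
    using f that by (auto simp: z_def L_function_def)
  define B where "B = ln (real (lcond f)) - real (ldeg f) * ln pi"
  define Psi where "Psi = (\<Sum>j=1..ldeg f. Re (Digamma (z j + of_real (y / 2))))"
  define GG where "GG = (\<Sum>j=1..ldeg f. ln (norm (Gamma (z j + of_real (y / 2)))) - ln (norm (Gamma (z j))))"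
  define Lam where "Lam = (\<Sum>j=1..ldeg f. ln (norm (z j)))"
  have Psi: "Psi \<le> Lam + real (ldeg f) * (2 * y)"
  proof -
    have "Psi \<le> (\<Sum>j=1..ldeg f. ln (norm (z j)) + 4 * (y / 2))"
      unfolding Psi_def using y by (intro sum_mono Re_Digamma_shift_le Rez) auto
    then show ?thesis by (simp add: Lam_def sum.distrib)
  qed
  have GG: "GG \<le> y / 2 * Lam + real (ldeg f) * (2 * (y / 2)\<^sup>2)"
  proof -
    have "GG \<le> (\<Sum>j=1..ldeg f. y / 2 * ln (norm (z j)) + 2 * (y / 2)\<^sup>2)"
      unfolding GG_def using y by (intro sum_mono ln_norm_Gamma_shift_le Rez) auto
    then show ?thesis by (simp add: Lam_def sum.distrib sum_distrib_left)
  qed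
  have logderiv: "F = B / 2 + Psi / 2 - Re (D (of_real y))"
  proof -
    have arg: "(1 / 2 + of_real y + lshift f j) / 2 = z j + of_real (y / 2)" for j
      by (simp add: z_def field_simps)
    have "Re (L_prefactor_logderiv f (1 / 2 + of_real y)) = B / 2 + Psi / 2"
      unfolding L_prefactor_logderiv_def arg by (simp add: B_def Psi_def diff_divide_distrib)
    then show ?thesis using logd[of "of_real y"] y by (simp add: F_def)
  qed
  have gr: "y * F / 2 \<le> (y / 2 * B + GG + P y) - ln (norm (lfun f (1 / 2)))"
  proof -
    have ln_X: "ln (norm (X (of_real t))) = ln (norm (L_prefactor f (1 / 2 + of_real t))) + ln (norm (lfun f (1 / 2 + of_real t)))"
      if "0 \<le> t" for t
    proof -
      have "lfun f (1 / 2 + of_real t) \<noteq> 0" using lnz[of "of_real t"] False that by (cases "t = 0") auto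
      moreover have "L_prefactor f (1 / 2 + of_real t) \<noteq> 0" using that by (intro L_prefactor_nonzero[OF f]) simp
      ultimately show ?thesis using that by (simp add: Xeq norm_mult ln_mult)
    qed
    show ?thesis
      using imag(2) ln_X[of y] ln_X[of 0] y ln_norm_L_prefactor_diff[OF f y]
      unfolding B_def GG_def z_def P_def l_def by simp
  qed
  define w where "w = 1 / x powr (1 / 2)"
  have w: "0 \<le> w" "w \<le> 1 / 2"
  proof -
    have "2 = sqrt 4" by simp
    also have "\<dots> \<le> sqrt x" using x5 by (intro real_sqrt_le_mono) simp
    also have "\<dots> = x powr (1 / 2)" using x5 by (simp add: powr_half_sqrt)
    finally have "2 \<le> x powr (1 / 2)" .
    moreover from this have "0 < x powr (1 / 2)" by linarith
    ultimately show "0 \<le> w" "w \<le> 1 / 2" by (simp_all add: w_def pos_divide_le_eq)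
  qed
  have lnC: "ln (analytic_conductor f) = B + Lam"
  proof -
    have q: "real (lcond f) > 0" using f by (auto simp: L_function_def)
    have nz: "norm (z j) > 0" if "j \<in> {1..ldeg f}" for j using Rez[OF that] by auto
    have "ln (analytic_conductor f) = ln (real (lcond f) / pi ^ ldeg f) + ln (\<Prod>j=1..ldeg f. norm (z j))"
    proof -
      have "analytic_conductor f = real (lcond f) / pi ^ ldeg f * (\<Prod>j=1..ldeg f. norm (z j))"
        by (simp add: analytic_conductor_def z_def)
      moreover have "(\<Prod>j=1..ldeg f. norm (z j)) > 0" using nz by (intro prod_pos) auto
      moreover have "real (lcond f) / pi ^ ldeg f > 0" using q by simp
      ultimately show ?thesis by (simp only: ln_mult_pos)
    qed
    also have "ln (\<Prod>j=1..ldeg f. norm (z j)) = Lam" unfolding Lam_def using nz by (intro ln_prod) auto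
    also have "ln (real (lcond f) / pi ^ ldeg f) = B" using q by (simp add: ln_div ln_realpow B_def)
    finally show ?thesis .
  qed
  have "ln (norm (lfun f (1 / 2))) \<le> A + (1 + lam) / 2 * ((B + Lam) / T)
      + (lam\<^sup>2 + lam) * real (ldeg f) / T\<^sup>2 + 4 * real (ldeg f) * exp (- lam) * w / T\<^sup>2"
    by (rule final_estimate[OF T lam y_def imag(1) _ w _ bracket logderiv gr Psi GG])
       (use S(2) in \<open>auto simp: w_def\<close>)
  then show ?thesis
    using False by (simp add: log_norm_def A_def lnC T_def w_def)
qed

end
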